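(* Let $K$ be a field of characteristic zero, let $R$ be an affine $K$-algebra which is an integral domain, and let $\delta$ be a $K$-derivation of $R$. Suppose that there exist a maximal ideal $M$ of $R$ which is a $\delta$-ideal and a prime $\delta$-ideal $P$ of $R$ such that $M\supseteq P$ and the height of $P$ equals $\mathrm{K.dim}(R)-1$, where $\mathrm{K.dim}(R)$ is the Krull dimension of $R$. If $S=R[\theta;\delta]$ satisfies $(\diamond)$, then $\delta(R)\subseteq P$.
   Context: An affine $K$-algebra is a finitely generated commutative $K$-algebra. A $K$-derivation of $R$ is a $K$-linear map $\delta: R\to R$ with $\delta(ab)=\delta(a)b+a\delta(b)$. A $\delta$-ideal is an ideal $I$ of $R$ with $\delta(I)\subseteq I$; a prime $\delta$-ideal is a prime ideal that is a $\delta$-ideal. The differential operator ring $R[\theta;\delta]$ is the free left $R$-module with basis $1,\theta,\theta^2,\ldots$ with multiplication extending that of $R$ and determined by $\theta a = a\theta+\delta(a)$ for $a\in R$. A Noetherian ring $S$ satisfies property $(\diamond)$ if every cyclic essential extension of a simple $S$-module is Artinian; modules are left modules. *)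

theory Defs
  imports
    "HOL-Algebra.UnivPoly"
    "HOL-Algebra.Subrings"
    "HOL-Library.Extended_Nat"
begin

section \<open>Affine algebras and derivations\<close>

definition char_zero :: "('k, 'x) ring_scheme \<Rightarrow> bool" where
  "char_zero K \<longleftrightarrow> (\<forall>n::nat. n > 0 \<longrightarrow> [n] \<cdot>\<^bsub>K\<^esub> \<one>\<^bsub>K\<^esub> \<noteq> \<zero>\<^bsub>K\<^esub>)"

text \<open>Finite generation: no proper \<open>K\<close>-subalgebra contains the finite set \<open>A\<close>.\<close>

definition affine_algebra :: "('k, 'x) ring_scheme \<Rightarrow> ('k, 'a, 'y) module_scheme \<Rightarrow> bool" where
  "affine_algebra K R \<longleftrightarrow> algebra K R \<and>
     (\<exists>A. finite A \<and> A \<subseteq> carrier R \<and>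
        (\<forall>B. subring B R \<and> (\<forall>k\<in>carrier K. \<forall>b\<in>B. k \<odot>\<^bsub>R\<^esub> b \<in> B) \<and> A \<subseteq> B
             \<longrightarrow> B = carrier R))"

definition derivation :: "('a, 'x) ring_scheme \<Rightarrow> ('a \<Rightarrow> 'a) \<Rightarrow> bool" where
  "derivation R \<delta> \<longleftrightarrow> \<delta> \<in> carrier R \<rightarrow> carrier R \<and>
     (\<forall>a\<in>carrier R. \<forall>b\<in>carrier R. \<delta> (a \<oplus>\<^bsub>R\<^esub> b) = \<delta> a \<oplus>\<^bsub>R\<^esub> \<delta> b) \<and>
     (\<forall>a\<in>carrier R. \<forall>b\<in>carrier R.
        \<delta> (a \<otimes>\<^bsub>R\<^esub> b) = \<delta> a \<otimes>\<^bsub>R\<^esub> b \<oplus>\<^bsub>R\<^esub> a \<otimes>\<^bsub>R\<^esub> \<delta> b)"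

definition K_derivation ::
  "('k, 'x) ring_scheme \<Rightarrow> ('k, 'a, 'y) module_scheme \<Rightarrow> ('a \<Rightarrow> 'a) \<Rightarrow> bool" where
  "K_derivation K R \<delta> \<longleftrightarrow> derivation R \<delta> \<and>
     (\<forall>k\<in>carrier K. \<forall>a\<in>carrier R. \<delta> (k \<odot>\<^bsub>R\<^esub> a) = k \<odot>\<^bsub>R\<^esub> \<delta> a)"

definition delta_ideal :: "('a, 'x) ring_scheme \<Rightarrow> ('a \<Rightarrow> 'a) \<Rightarrow> 'a set \<Rightarrow> bool" where
  "delta_ideal R \<delta> I \<longleftrightarrow> ideal I R \<and> \<delta> ` I \<subseteq> I"

section \<open>Height and Krull dimension\<close>

definition prime_chain :: "('a, 'x) ring_scheme \<Rightarrow> nat \<Rightarrow> (nat \<Rightarrow> 'a set) \<Rightarrow> bool" where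
  "prime_chain R n C \<longleftrightarrow> (\<forall>i\<le>n. primeideal (C i) R) \<and> (\<forall>i<n. C i \<subset> C (Suc i))"

definition height :: "('a, 'x) ring_scheme \<Rightarrow> 'a set \<Rightarrow> enat" where
  "height R P = Sup {enat n |n. \<exists>C. prime_chain R n C \<and> C n = P}"

definition krull_dim :: "('a, 'x) ring_scheme \<Rightarrow> enat" where
  "krull_dim R = Sup {enat n |n. \<exists>C. prime_chain R n C}"

section \<open>Left modules\<close>

text \<open>The library's locale \<^locale>\<open>module\<close> requires a commutative scalar ring. Its locale
  \<^locale>\<open>submodule\<close> does not, and is used below as is. The \<open>mult\<close> and \<open>one\<close> fields of a module
  record carry no meaning.\<close>

locale left_module = S?: ring S + E?: abelian_group E
  for S :: "('s, 'x) ring_scheme" (structure)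
    and E :: "('s, 'e, 'y) module_scheme" (structure) +
  assumes smult_closed:
      "\<lbrakk>a \<in> carrier S; x \<in> carrier E\<rbrakk> \<Longrightarrow> a \<odot>\<^bsub>E\<^esub> x \<in> carrier E"
    and smult_l_distr:
      "\<lbrakk>a \<in> carrier S; b \<in> carrier S; x \<in> carrier E\<rbrakk> \<Longrightarrow>
        (a \<oplus>\<^bsub>S\<^esub> b) \<odot>\<^bsub>E\<^esub> x = a \<odot>\<^bsub>E\<^esub> x \<oplus>\<^bsub>E\<^esub> b \<odot>\<^bsub>E\<^esub> x"
    and smult_r_distr:
      "\<lbrakk>a \<in> carrier S; x \<in> carrier E; y \<in> carrier E\<rbrakk> \<Longrightarrow>
        a \<odot>\<^bsub>E\<^esub> (x \<oplus>\<^bsub>E\<^esub> y) = a \<odot>\<^bsub>E\<^esub> x \<oplus>\<^bsub>E\<^esub> a \<odot>\<^bsub>E\<^esub> y"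
    and smult_assoc:
      "\<lbrakk>a \<in> carrier S; b \<in> carrier S; x \<in> carrier E\<rbrakk> \<Longrightarrow>
        (a \<otimes>\<^bsub>S\<^esub> b) \<odot>\<^bsub>E\<^esub> x = a \<odot>\<^bsub>E\<^esub> (b \<odot>\<^bsub>E\<^esub> x)"
    and smult_one:
      "x \<in> carrier E \<Longrightarrow> \<one>\<^bsub>S\<^esub> \<odot>\<^bsub>E\<^esub> x = x"

definition cyclic_module :: "('s, 'x) ring_scheme \<Rightarrow> ('s, 'e, 'y) module_scheme \<Rightarrow> bool" where
  "cyclic_module S E \<longleftrightarrow> (\<exists>e\<in>carrier E. carrier E = (\<lambda>s. s \<odot>\<^bsub>E\<^esub> e) ` carrier S)"

definition simple_submodule ::
  "('s, 'x) ring_scheme \<Rightarrow> ('s, 'e, 'y) module_scheme \<Rightarrow> 'e set \<Rightarrow> bool" where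
  "simple_submodule S E V \<longleftrightarrow> submodule V S E \<and> V \<noteq> {\<zero>\<^bsub>E\<^esub>} \<and>
     (\<forall>N. submodule N S E \<and> N \<subseteq> V \<longrightarrow> N = {\<zero>\<^bsub>E\<^esub>} \<or> N = V)"

definition essential_submodule ::
  "('s, 'x) ring_scheme \<Rightarrow> ('s, 'e, 'y) module_scheme \<Rightarrow> 'e set \<Rightarrow> bool" where
  "essential_submodule S E V \<longleftrightarrow> submodule V S E \<and>
     (\<forall>N. submodule N S E \<and> N \<noteq> {\<zero>\<^bsub>E\<^esub>} \<longrightarrow> N \<inter> V \<noteq> {\<zero>\<^bsub>E\<^esub>})"

definition artinian_module :: "('s, 'x) ring_scheme \<Rightarrow> ('s, 'e, 'y) module_scheme \<Rightarrow> bool" where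
  "artinian_module S E \<longleftrightarrow>
     (\<forall>N::nat \<Rightarrow> 'e set. (\<forall>n. submodule (N n) S E) \<and> (\<forall>n. N (Suc n) \<subseteq> N n)
        \<longrightarrow> (\<exists>n. \<forall>m\<ge>n. N m = N n))"

text \<open>A module \<open>E\<close> whose carrier consists of sets of elements of \<open>S\<close> suffices: every cyclic
  left \<open>S\<close>-module is isomorphic to some \<open>S/I\<close>, whose elements are cosets of the left ideal \<open>I\<close>.\<close>

definition diamond :: "('s, 'x) ring_scheme \<Rightarrow> bool" where
  "diamond S \<longleftrightarrow> (\<forall>(E::('s, 's set) module) V.
     left_module S E \<and> cyclic_module S E \<and> simple_submodule S E V \<and> essential_submodule S E V
       \<longrightarrow> artinian_module S E)"

section \<open>The differential operator ring\<close>

text \<open>As a left \<open>R\<close>-module, \<open>R[\<theta>;\<delta>]\<close> is the set \<^term>\<open>up R\<close> of finitely supported coefficient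
  sequences, \<open>f\<close> standing for \<open>\<Sum>n. f n \<theta>\<^sup>n\<close>. By \<open>\<theta>a = a\<theta> + \<delta>(a)\<close>, left multiplication by \<open>\<theta>\<close>
  sends \<open>\<Sum>n. f n \<theta>\<^sup>n\<close> to \<open>\<Sum>n. (f n \<theta>\<^bsup>n+1\<^esup> + \<delta>(f n) \<theta>\<^sup>n)\<close>; and
  \<open>(\<Sum>i. p i \<theta>\<^sup>i) q = \<Sum>i. p i (\<theta>\<^sup>i q)\<close>.\<close>

definition theta_mult ::
  "('a, 'x) ring_scheme \<Rightarrow> ('a \<Rightarrow> 'a) \<Rightarrow> (nat \<Rightarrow> 'a) \<Rightarrow> nat \<Rightarrow> 'a" where
  "theta_mult R \<delta> f = (\<lambda>n. (case n of 0 \<Rightarrow> \<zero>\<^bsub>R\<^esub> | Suc m \<Rightarrow> f m) \<oplus>\<^bsub>R\<^esub> \<delta> (f n))"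

definition diff_op_ring :: "('a, 'x) ring_scheme \<Rightarrow> ('a \<Rightarrow> 'a) \<Rightarrow> (nat \<Rightarrow> 'a) ring" where
  "diff_op_ring R \<delta> =
    \<lparr>carrier = up R,
     mult = (\<lambda>p q n. \<Oplus>\<^bsub>R\<^esub>i\<in>{i. p i \<noteq> \<zero>\<^bsub>R\<^esub>}. p i \<otimes>\<^bsub>R\<^esub> (theta_mult R \<delta> ^^ i) q n),
     one = (\<lambda>n. if n = 0 then \<one>\<^bsub>R\<^esub> else \<zero>\<^bsub>R\<^esub>),
     zero = (\<lambda>n. \<zero>\<^bsub>R\<^esub>),
     add = (\<lambda>p q n. p n \<oplus>\<^bsub>R\<^esub> q n)\<rparr>"

text \<open>The element \<open>a \<theta>\<^sup>k\<close>.\<close>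

definition dop_monom :: "('a, 'x) ring_scheme \<Rightarrow> 'a \<Rightarrow> nat \<Rightarrow> nat \<Rightarrow> 'a" where
  "dop_monom R a k = (\<lambda>n. if n = k then a else \<zero>\<^bsub>R\<^esub>)"

locale deriv_ring = ring R for R (structure) +
  fixes \<delta> :: "'a \<Rightarrow> 'a"
  assumes deriv: "derivation R \<delta>"
begin

abbreviation "T \<equiv> theta_mult R \<delta>"

lemma d_closed [simp, intro]: "a \<in> carrier R \<Longrightarrow> \<delta> a \<in> carrier R"
  using deriv by (auto simp: derivation_def)

lemma d_add: "a \<in> carrier R \<Longrightarrow> b \<in> carrier R \<Longrightarrow> \<delta> (a \<oplus> b) = \<delta> a \<oplus> \<delta> b"
  using deriv by (auto simp: derivation_def)

lemma d_mult: "a \<in> carrier R \<Longrightarrow> b \<in> carrier R \<Longrightarrow> \<delta> (a \<otimes> b) = \<delta> a \<otimes> b \<oplus> a \<otimes> \<delta> b"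
  using deriv by (auto simp: derivation_def)

lemma d_zero [simp]: "\<delta> \<zero> = \<zero>"
  using d_add[of \<zero> \<zero>] by (metis d_closed l_zero zero_closed add.r_cancel_one)

lemma d_one [simp]: "\<delta> \<one> = \<zero>"
  using d_mult[of \<one> \<one>] by (metis d_closed l_one r_one one_closed add.r_cancel_one)

lemma upE:
  assumes "f \<in> up R" obtains N where "\<And>n. n > N \<Longrightarrow> f n = \<zero>"
  using assms by (auto simp: up_def bound_def)

lemma upI: "(\<And>n. f n \<in> carrier R) \<Longrightarrow> (\<And>n. n > N \<Longrightarrow> f n = \<zero>) \<Longrightarrow> f \<in> up R"
  by (auto simp: up_def bound_def)

lemma up_in [simp]: "f \<in> up R \<Longrightarrow> f n \<in> carrier R"
  by (auto simp: up_def)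

lemma T_closed [simp, intro]: "f \<in> up R \<Longrightarrow> T f \<in> up R"
proof -
  assume f: "f \<in> up R"
  obtain N where N: "\<And>n. n > N \<Longrightarrow> f n = \<zero>" using upE[OF f] by blast
  show ?thesis
    by (rule upI[where N = "Suc N"]) (use f N in \<open>auto simp: theta_mult_def split: nat.split\<close>)
qed

lemma Tn_closed [simp, intro]: "f \<in> up R \<Longrightarrow> (T ^^ i) f \<in> up R"
  by (induction i) auto

lemma T_add:
  assumes "f \<in> up R" "g \<in> up R"
  shows "T (\<lambda>n. f n \<oplus> g n) = (\<lambda>n. T f n \<oplus> T g n)"
  using assms by (auto simp: theta_mult_def d_add a_ac split: nat.split)

lemma T_zero: "T (\<lambda>n. \<zero>) = (\<lambda>n. \<zero>)"
  by (auto simp: theta_mult_def split: nat.split)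

lemma T_smult:
  assumes "a \<in> carrier R" "f \<in> up R"
  shows "T (\<lambda>n. a \<otimes> f n) = (\<lambda>n. a \<otimes> T f n \<oplus> \<delta> a \<otimes> f n)"
  using assms by (auto simp: theta_mult_def d_mult r_distr a_ac split: nat.split)

lemma add_closed' [simp, intro]: "f \<in> up R \<Longrightarrow> g \<in> up R \<Longrightarrow> (\<lambda>n. f n \<oplus> g n) \<in> up R"
  by (rule up_add_closed)

lemma smult_closed' [simp, intro]: "a \<in> carrier R \<Longrightarrow> f \<in> up R \<Longrightarrow> (\<lambda>n. a \<otimes> f n) \<in> up R"
  by (rule up_smult_closed)

lemma Tn_add:
  assumes "f \<in> up R" "g \<in> up R"
  shows "(T ^^ i) (\<lambda>n. f n \<oplus> g n) = (\<lambda>n. (T ^^ i) f n \<oplus> (T ^^ i) g n)"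
  using assms by (induction i) (auto simp: T_add)

text \<open>Multiplication with an explicit degree bound.\<close>

definition act :: "nat \<Rightarrow> (nat \<Rightarrow> 'a) \<Rightarrow> (nat \<Rightarrow> 'a) \<Rightarrow> nat \<Rightarrow> 'a" where
  "act N p q = (\<lambda>n. \<Oplus>i\<in>{..<N}. p i \<otimes> (T ^^ i) q n)"

lemma act_0: "act 0 p q = (\<lambda>n. \<zero>)"
  by (simp add: act_def)

lemma act_Suc:
  assumes "p \<in> up R" "q \<in> up R"
  shows "act (Suc N) p q = (\<lambda>n. p N \<otimes> (T ^^ N) q n \<oplus> act N p q n)"
  using assms by (auto simp: act_def lessThan_Suc Pi_def)

lemma act_closed [simp, intro]:
  assumes "p \<in> up R" "q \<in> up R" shows "act N p q \<in> up R"
proof (induction N)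
  case 0
  show ?case unfolding act_0 by (rule upI) auto
next
  case (Suc N)
  show ?case unfolding act_Suc[OF assms] using assms Suc by auto
qed

lemma mult_act:
  assumes p: "p \<in> up R" and q: "q \<in> up R" and N: "\<And>i. i \<ge> N \<Longrightarrow> p i = \<zero>"
  shows "p \<otimes>\<^bsub>diff_op_ring R \<delta>\<^esub> q = act N p q"
proof
  fix n
  have "(\<Oplus>i\<in>{i. p i \<noteq> \<zero>}. p i \<otimes> (T ^^ i) q n) = (\<Oplus>i\<in>{..<N}. p i \<otimes> (T ^^ i) q n)"
  proof (rule add.finprod_mono_neutral_cong_left)
    show "{i. p i \<noteq> \<zero>} \<subseteq> {..<N}" using N by (auto simp: not_le[symmetric])
  qed (use p q in auto)
  then show "(p \<otimes>\<^bsub>diff_op_ring R \<delta>\<^esub> q) n = act N p q n"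
    by (simp add: diff_op_ring_def act_def)
qed

lemma bound_ex:
  assumes "p \<in> up R" obtains N where "\<And>i. i \<ge> N \<Longrightarrow> p i = \<zero>"
proof -
  obtain M where "\<And>n. n > M \<Longrightarrow> p n = \<zero>" using upE[OF assms] by blast
  then show ?thesis using that[of "Suc M"] by auto
qed

lemma mult_closed: "p \<in> up R \<Longrightarrow> q \<in> up R \<Longrightarrow> p \<otimes>\<^bsub>diff_op_ring R \<delta>\<^esub> q \<in> up R"
  by (metis bound_ex mult_act act_closed)

lemma act_add_right:
  assumes "p \<in> up R" "f \<in> up R" "g \<in> up R"
  shows "act N p (\<lambda>n. f n \<oplus> g n) = (\<lambda>n. act N p f n \<oplus> act N p g n)"
proof (induction N)
  case (Suc N)
  then show ?case
    using assms by (auto simp: act_Suc Tn_add r_distr a_ac)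
qed (simp add: act_0)

lemma act_add_left:
  assumes "p \<in> up R" "f \<in> up R" "g \<in> up R"
  shows "act N (\<lambda>n. f n \<oplus> g n) p = (\<lambda>n. act N f p n \<oplus> act N g p n)"
proof (induction N)
  case (Suc N)
  then show ?case
    using assms by (auto simp: act_Suc l_distr a_ac)
qed (simp add: act_0)

lemma act_smult:
  assumes "a \<in> carrier R" "p \<in> up R" "q \<in> up R"
  shows "act N (\<lambda>n. a \<otimes> p n) q = (\<lambda>n. a \<otimes> act N p q n)"
proof (induction N)
  case (Suc N)
  then show ?case
    using assms by (auto simp: act_Suc r_distr m_assoc)
qed (use assms in \<open>simp add: act_0\<close>)

lemma T_act:
  assumes "p \<in> up R" "q \<in> up R"
  shows "T (act N p q) = (\<lambda>n. (\<Oplus>i\<in>{..<N}. p i \<otimes> (T ^^ Suc i) q n) \<oplus>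
                               (\<Oplus>i\<in>{..<N}. \<delta> (p i) \<otimes> (T ^^ i) q n))"
proof (induction N)
  case 0
  show ?case by (simp add: act_0 T_zero)
next
  case (Suc N)
  have "(T ^^ Suc i) q n \<in> carrier R" for i n
    using assms by (metis Tn_closed up_in)
  then have c: "T ((T ^^ i) q) n \<in> carrier R" for i n by simp
  show ?case
    using assms c
    by (auto simp: act_Suc T_add T_smult Suc lessThan_Suc Pi_def a_ac)
qed

lemma act_T:
  assumes p: "p \<in> up R" and q: "q \<in> up R" and N: "\<And>i. i \<ge> N \<Longrightarrow> p i = \<zero>"
  shows "act (Suc N) (T p) q = T (act N p q)"
proof
  fix n
  have c: "T ((T ^^ i) q) n \<in> carrier R" for i
    using q by (metis Tn_closed T_closed up_in)
  have "act (Suc M) (T p) q n =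
      (\<Oplus>i\<in>{..<M}. p i \<otimes> (T ^^ Suc i) q n) \<oplus> (\<Oplus>i\<in>{..<Suc M}. \<delta> (p i) \<otimes> (T ^^ i) q n)" for M
  proof (induction M)
    case 0
    then show ?case using p q by (simp add: act_def lessThan_Suc theta_mult_def[of _ _ p])
  next
    case (Suc M)
    have t: "T p (Suc M) = p M \<oplus> \<delta> (p (Suc M))" by (simp add: theta_mult_def)
    show ?case
      unfolding act_Suc[OF T_closed[OF p] q, of "Suc M"] Suc t lessThan_Suc[of M]
        lessThan_Suc[of "Suc M"]
      using p q c by (simp add: Pi_def l_distr a_ac)
  qed
  from this[of N] show "act (Suc N) (T p) q n = T (act N p q) n"
    using p q c N[of N] unfolding T_act[OF p q] lessThan_Suc[of N] by (simp add: Pi_def)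
qed

lemma T_mult:
  assumes "p \<in> up R" "q \<in> up R"
  shows "T p \<otimes>\<^bsub>diff_op_ring R \<delta>\<^esub> q = T (p \<otimes>\<^bsub>diff_op_ring R \<delta>\<^esub> q)"
proof -
  obtain N where N: "\<And>i. i \<ge> N \<Longrightarrow> p i = \<zero>" using bound_ex[OF assms(1)] by blast
  have "T p i = \<zero>" if "i \<ge> Suc N" for i
    using that N by (auto simp: theta_mult_def split: nat.split)
  then show ?thesis
    using assms N by (simp add: mult_act[of "T p" q "Suc N"] mult_act[of p q N] act_T)
qed

lemma Tn_mult:
  assumes "p \<in> up R" "q \<in> up R"
  shows "(T ^^ i) p \<otimes>\<^bsub>diff_op_ring R \<delta>\<^esub> q = (T ^^ i) (p \<otimes>\<^bsub>diff_op_ring R \<delta>\<^esub> q)"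
  using assms by (induction i) (auto simp: T_mult)

lemma mult_add_left:
  assumes "f \<in> up R" "g \<in> up R" "q \<in> up R"
  shows "(\<lambda>n. f n \<oplus> g n) \<otimes>\<^bsub>diff_op_ring R \<delta>\<^esub> q =
         (\<lambda>n. (f \<otimes>\<^bsub>diff_op_ring R \<delta>\<^esub> q) n \<oplus> (g \<otimes>\<^bsub>diff_op_ring R \<delta>\<^esub> q) n)"
proof -
  obtain N where N: "\<And>i. i \<ge> N \<Longrightarrow> f i = \<zero>" using bound_ex[OF assms(1)] by blast
  obtain M where M: "\<And>i. i \<ge> M \<Longrightarrow> g i = \<zero>" using bound_ex[OF assms(2)] by blast
  show ?thesis
    using assms N M
    by (simp add: mult_act[of _ q "max N M"] act_add_left)
qed

lemma mult_smult_left: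
  assumes "a \<in> carrier R" "p \<in> up R" "q \<in> up R"
  shows "(\<lambda>n. a \<otimes> p n) \<otimes>\<^bsub>diff_op_ring R \<delta>\<^esub> q = (\<lambda>n. a \<otimes> (p \<otimes>\<^bsub>diff_op_ring R \<delta>\<^esub> q) n)"
proof -
  obtain N where N: "\<And>i. i \<ge> N \<Longrightarrow> p i = \<zero>" using bound_ex[OF assms(2)] by blast
  show ?thesis
    using assms N by (simp add: mult_act[of _ q N] act_smult)
qed

lemma act_assoc:
  assumes "p \<in> up R" "q \<in> up R" "r \<in> up R"
  shows "act N p q \<otimes>\<^bsub>diff_op_ring R \<delta>\<^esub> r = act N p (q \<otimes>\<^bsub>diff_op_ring R \<delta>\<^esub> r)"
proof (induction N)
  case 0
  have "(\<lambda>n. \<zero>) \<in> up R" by (rule upI) auto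
  then show ?case using assms by (simp add: act_0 mult_act[of _ r 0])
next
  case (Suc N)
  then show ?case
    using assms by (simp add: act_Suc mult_closed mult_add_left mult_smult_left Tn_mult)
qed

lemma mult_assoc:
  assumes "p \<in> up R" "q \<in> up R" "r \<in> up R"
  shows "(p \<otimes>\<^bsub>diff_op_ring R \<delta>\<^esub> q) \<otimes>\<^bsub>diff_op_ring R \<delta>\<^esub> r =
         p \<otimes>\<^bsub>diff_op_ring R \<delta>\<^esub> (q \<otimes>\<^bsub>diff_op_ring R \<delta>\<^esub> r)"
proof -
  obtain N where N: "\<And>i. i \<ge> N \<Longrightarrow> p i = \<zero>" using bound_ex[OF assms(1)] by blast
  show ?thesis
    using assms N by (simp add: mult_act[of p _ N] mult_closed act_assoc)
qed

lemma mult_add_right: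
  assumes "f \<in> up R" "g \<in> up R" "p \<in> up R"
  shows "p \<otimes>\<^bsub>diff_op_ring R \<delta>\<^esub> (\<lambda>n. f n \<oplus> g n) =
         (\<lambda>n. (p \<otimes>\<^bsub>diff_op_ring R \<delta>\<^esub> f) n \<oplus> (p \<otimes>\<^bsub>diff_op_ring R \<delta>\<^esub> g) n)"
proof -
  obtain N where N: "\<And>i. i \<ge> N \<Longrightarrow> p i = \<zero>" using bound_ex[OF assms(3)] by blast
  show ?thesis
    using assms N by (simp add: mult_act[of p _ N] act_add_right)
qed

lemma dop_monom_closed [simp, intro]: "a \<in> carrier R \<Longrightarrow> dop_monom R a k \<in> up R"
  by (rule upI[where N = k]) (auto simp: dop_monom_def)

lemma monom_mult:
  assumes "a \<in> carrier R" "q \<in> up R"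
  shows "dop_monom R a k \<otimes>\<^bsub>diff_op_ring R \<delta>\<^esub> q = (\<lambda>n. a \<otimes> (T ^^ k) q n)"
proof -
  have "act k (dop_monom R a k) q = (\<lambda>n. \<zero>)"
  proof
    fix n
    have "act k (dop_monom R a k) q n = (\<Oplus>i\<in>{..<k}. \<zero>)"
      unfolding act_def by (rule add.finprod_cong') (use assms in \<open>auto simp: dop_monom_def\<close>)
    then show "act k (dop_monom R a k) q n = \<zero>" by simp
  qed
  moreover have "dop_monom R a k \<otimes>\<^bsub>diff_op_ring R \<delta>\<^esub> q = act (Suc k) (dop_monom R a k) q"
    by (rule mult_act) (use assms in simp_all, simp add: dop_monom_def)
  moreover have "dop_monom R a k k = a" by (simp add: dop_monom_def)
  ultimately show ?thesis using assms by (simp add: act_Suc)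
qed

lemma T_monom_one: "T (dop_monom R \<one> k) = dop_monom R \<one> (Suc k)"
  by (auto simp: theta_mult_def dop_monom_def fun_eq_iff split: nat.split)

lemma Tn_monom_one: "(T ^^ i) (dop_monom R \<one> k) = dop_monom R \<one> (i + k)"
  by (induction i) (auto simp: T_monom_one)

lemma one_monom: "(\<lambda>n. if n = 0 then \<one> else \<zero>) = dop_monom R \<one> 0"
  by (simp add: dop_monom_def)

lemma act_one:
  assumes "p \<in> up R"
  shows "act N p (dop_monom R \<one> 0) = (\<lambda>n. if n < N then p n else \<zero>)"
proof (induction N)
  case (Suc N)
  have "act (Suc N) p (dop_monom R \<one> 0) = (\<lambda>n. p N \<otimes> dop_monom R \<one> N n \<oplus> (if n < N then p n else \<zero>))"
    using assms by (simp add: act_Suc Tn_monom_one Suc)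
  then show ?case
    using assms by (auto simp: dop_monom_def fun_eq_iff less_Suc_eq)
qed (simp add: act_0)

lemma mult_one_right:
  assumes "p \<in> up R" shows "p \<otimes>\<^bsub>diff_op_ring R \<delta>\<^esub> dop_monom R \<one> 0 = p"
proof -
  obtain N where N: "\<And>i. i \<ge> N \<Longrightarrow> p i = \<zero>" using bound_ex[OF assms] by blast
  show ?thesis
    using assms N by (auto simp: mult_act[of p _ N] act_one fun_eq_iff)
qed

theorem ring_diff_op_ring: "ring (diff_op_ring R \<delta>)"
proof (rule ringI)
  show "abelian_group (diff_op_ring R \<delta>)"
  proof (rule abelian_groupI)
    fix x assume x: "x \<in> carrier (diff_op_ring R \<delta>)"
    show "\<exists>y\<in>carrier (diff_op_ring R \<delta>).
        y \<oplus>\<^bsub>diff_op_ring R \<delta>\<^esub> x = \<zero>\<^bsub>diff_op_ring R \<delta>\<^esub>"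
      by (rule bexI[of _ "\<lambda>n. \<ominus> x n"])
        (use x in \<open>auto simp: diff_op_ring_def l_neg intro: up_a_inv_closed\<close>)
  qed (auto simp: diff_op_ring_def a_ac intro: upI)
  show "monoid (diff_op_ring R \<delta>)"
  proof (rule monoidI)
    fix x assume "x \<in> carrier (diff_op_ring R \<delta>)"
    then have x: "x \<in> up R" by (simp add: diff_op_ring_def)
    have o: "\<one>\<^bsub>diff_op_ring R \<delta>\<^esub> = dop_monom R \<one> 0"
      by (simp add: diff_op_ring_def one_monom)
    show "\<one>\<^bsub>diff_op_ring R \<delta>\<^esub> \<otimes>\<^bsub>diff_op_ring R \<delta>\<^esub> x = x"
      unfolding o using x by (simp add: monom_mult)
    show "x \<otimes>\<^bsub>diff_op_ring R \<delta>\<^esub> \<one>\<^bsub>diff_op_ring R \<delta>\<^esub> = x"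
      unfolding o using x by (rule mult_one_right)
  next
    fix x y z
    assume "x \<in> carrier (diff_op_ring R \<delta>)" "y \<in> carrier (diff_op_ring R \<delta>)"
      "z \<in> carrier (diff_op_ring R \<delta>)"
    then show "x \<otimes>\<^bsub>diff_op_ring R \<delta>\<^esub> y \<otimes>\<^bsub>diff_op_ring R \<delta>\<^esub> z =
        x \<otimes>\<^bsub>diff_op_ring R \<delta>\<^esub> (y \<otimes>\<^bsub>diff_op_ring R \<delta>\<^esub> z)"
      by (intro mult_assoc) (simp_all add: diff_op_ring_def)
  next
    fix x y
    assume "x \<in> carrier (diff_op_ring R \<delta>)" "y \<in> carrier (diff_op_ring R \<delta>)"
    then show "x \<otimes>\<^bsub>diff_op_ring R \<delta>\<^esub> y \<in> carrier (diff_op_ring R \<delta>)"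
      using mult_closed[of x y] by (simp add: diff_op_ring_def)
  qed (auto simp: diff_op_ring_def one_monom)
  fix x y z
  assume "x \<in> carrier (diff_op_ring R \<delta>)" "y \<in> carrier (diff_op_ring R \<delta>)"
      "z \<in> carrier (diff_op_ring R \<delta>)"
  then have u: "x \<in> up R" "y \<in> up R" "z \<in> up R" by (simp_all add: diff_op_ring_def)
  have a: "p \<oplus>\<^bsub>diff_op_ring R \<delta>\<^esub> q = (\<lambda>n. p n \<oplus> q n)" for p q
    by (simp add: diff_op_ring_def)
  show "(x \<oplus>\<^bsub>diff_op_ring R \<delta>\<^esub> y) \<otimes>\<^bsub>diff_op_ring R \<delta>\<^esub> z =
      x \<otimes>\<^bsub>diff_op_ring R \<delta>\<^esub> z \<oplus>\<^bsub>diff_op_ring R \<delta>\<^esub> y \<otimes>\<^bsub>diff_op_ring R \<delta>\<^esub> z"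
    unfolding a using u by (rule mult_add_left)
  show "z \<otimes>\<^bsub>diff_op_ring R \<delta>\<^esub> (x \<oplus>\<^bsub>diff_op_ring R \<delta>\<^esub> y) =
      z \<otimes>\<^bsub>diff_op_ring R \<delta>\<^esub> x \<oplus>\<^bsub>diff_op_ring R \<delta>\<^esub> z \<otimes>\<^bsub>diff_op_ring R \<delta>\<^esub> y"
    unfolding a using u by (rule mult_add_right)
qed

text \<open>The embedding \<open>a \<mapsto> dop_monom R a 0\<close> of \<open>R\<close>, and \<open>\<theta> = dop_monom R \<one> 1\<close>.\<close>

theorem const_hom: "(\<lambda>a. dop_monom R a 0) \<in> ring_hom R (diff_op_ring R \<delta>)"
proof (rule ring_hom_memI)
  fix a b assume ab: "a \<in> carrier R" "b \<in> carrier R"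
  show "dop_monom R a 0 \<in> carrier (diff_op_ring R \<delta>)"
    using ab by (simp add: diff_op_ring_def)
  show "dop_monom R (a \<otimes> b) 0 = dop_monom R a 0 \<otimes>\<^bsub>diff_op_ring R \<delta>\<^esub> dop_monom R b 0"
    using ab by (simp add: monom_mult) (auto simp: dop_monom_def)
  show "dop_monom R (a \<oplus> b) 0 = dop_monom R a 0 \<oplus>\<^bsub>diff_op_ring R \<delta>\<^esub> dop_monom R b 0"
    using ab by (auto simp: dop_monom_def diff_op_ring_def)
qed (simp add: diff_op_ring_def dop_monom_def)

theorem theta_commute:
  assumes "a \<in> carrier R"
  shows "dop_monom R \<one> 1 \<otimes>\<^bsub>diff_op_ring R \<delta>\<^esub> dop_monom R a 0 =
         dop_monom R a 0 \<otimes>\<^bsub>diff_op_ring R \<delta>\<^esub> dop_monom R \<one> 1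
           \<oplus>\<^bsub>diff_op_ring R \<delta>\<^esub> dop_monom R (\<delta> a) 0"
proof -
  have a: "p \<oplus>\<^bsub>diff_op_ring R \<delta>\<^esub> q = (\<lambda>n. p n \<oplus> q n)" for p q
    by (simp add: diff_op_ring_def)
  show ?thesis
    using assms unfolding a
    by (simp add: monom_mult)
      (auto simp: dop_monom_def theta_mult_def fun_eq_iff split: nat.split)
qed

theorem const_mult_theta_power:
  assumes "a \<in> carrier R"
  shows "dop_monom R a 0 \<otimes>\<^bsub>diff_op_ring R \<delta>\<^esub>
           (dop_monom R \<one> 1 [^]\<^bsub>diff_op_ring R \<delta>\<^esub> (k::nat)) = dop_monom R a k"
proof -
  interpret D: ring "diff_op_ring R \<delta>" by (rule ring_diff_op_ring)
  have "dop_monom R \<one> 1 [^]\<^bsub>diff_op_ring R \<delta>\<^esub> k = dop_monom R \<one> k"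
  proof (induction k)
    case 0
    show ?case by (simp add: diff_op_ring_def dop_monom_def)
  next
    case (Suc k)
    then show ?case
      by (simp add: monom_mult Tn_monom_one T_monom_one)
  qed
  then show ?thesis using assms by (simp add: monom_mult) (auto simp: dop_monom_def fun_eq_iff)
qed

end

end

theory Submission
  imports Defs "HOL-Algebra.Ring_Divisibility"
begin

text \<open>Suppose \<open>\<delta>(R)\<close> is not contained in \<open>P\<close>. Since \<open>R/P\<close> has Krull dimension at most one, there is a
  maximal ideal \<open>Q\<close> above \<open>P\<close> that is not \<open>\<delta>\<close>-stable: take \<open>Q\<close> maximal among the ideals avoiding the
  powers of some \<open>\<delta>(x)\<close> outside \<open>P\<close>; a \<open>\<delta>\<close>-stable \<open>Q\<close> would make \<open>R/Q\<close> an affine G-domain with a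
  nonzero derivation, contrary to Zariski's lemma. As \<open>Q\<close> is not \<open>\<delta>\<close>-stable, \<open>S/SQ\<close> is a simple
  module, and \<open>S/(SQ\<theta> + SP)\<close> is an essential extension of the submodule
  \<open>(S\<theta> + SP)/(SQ\<theta> + SP)\<close>, which is isomorphic to \<open>S/SQ\<close>. The factor module is \<open>R/P\<close>, whose
  submodules are the \<open>\<delta>\<close>-ideals above \<open>P\<close>. It is not Artinian: the ideal \<open>D\<close> generated by \<open>\<delta>(R)\<close>
  is finitely generated and contained in \<open>M\<close>, so by Nakayama's lemma the powers of \<open>D\<close> decrease
  strictly modulo \<open>P\<close>.\<close>

section \<open>Adjoining one element to a subring\<close>

text \<open>The hypothesis on P equates extended naturals and says nothing while both sides may be
  infinite, so the Krull dimension must first be bounded. Only finiteness is wanted, and the crude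
  bound 2^n for n generators comes from the same elimination along A[c_1,...,c_n] that replaces
  Zariski's lemma. Relations are kept over subrings of R, whose leading coefficients need not be
  invertible; hence pseudo-division instead of minimal polynomials over fraction fields.
  Characteristic zero enters three times as a positive integer factor: in the derivative of a
  minimal relation, in the Leibniz coefficient that makes the stable core of Q prime, and in the
  commutator [a, h]. The core is needed for essentiality: no \<delta>-ideal strictly above P lies in
  Q, as otherwise P, the core and Q would be one prime too many. Hence a left ideal above SQ\<theta>
  + SP that is not inside S\<theta> + SP contains some f with constant term c outside Q, and c
  \<theta> f - \<delta>(c) f is an element without constant term whose leading coefficient can be
  controlled.\<close>

primrec poly_span :: "('a, 'x) ring_scheme \<Rightarrow> 'a set \<Rightarrow> 'a \<Rightarrow> nat \<Rightarrow> 'a set" where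
  "poly_span R A c 0 = {\<zero>\<^bsub>R\<^esub>}"
| "poly_span R A c (Suc d) =
    {a \<otimes>\<^bsub>R\<^esub> c [^]\<^bsub>R\<^esub> d \<oplus>\<^bsub>R\<^esub> x | a x. a \<in> A \<and> x \<in> poly_span R A c d}"

definition adjoin :: "('a, 'x) ring_scheme \<Rightarrow> 'a set \<Rightarrow> 'a \<Rightarrow> 'a set" where
  "adjoin R A c = (\<Union>d. poly_span R A c d)"

text \<open>\<open>poly_span R A c d\<close> holds the values at c of polynomials of degree below d,
  so this is a relation of degree d whose leading coefficient s need not be invertible. Over a
  subring A, d = 0 would force s = 0, so relations have positive degree.\<close>

definition alg_over :: "('a, 'x) ring_scheme \<Rightarrow> 'a set \<Rightarrow> 'a \<Rightarrow> bool" where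
  "alg_over R A c \<longleftrightarrow> (\<exists>d. \<exists>s\<in>A. s \<noteq> \<zero>\<^bsub>R\<^esub> \<and> s \<otimes>\<^bsub>R\<^esub> c [^]\<^bsub>R\<^esub> d \<in> poly_span R A c d)"

text \<open>A G-domain in the sense of Kaplansky: inverting a single element gives the fraction field.\<close>

definition G_domain :: "('a, 'x) ring_scheme \<Rightarrow> 'a set \<Rightarrow> bool" where
  "G_domain R B \<longleftrightarrow> (\<exists>u\<in>B. u \<noteq> \<zero>\<^bsub>R\<^esub> \<and>
     (\<forall>b\<in>B. b \<noteq> \<zero>\<^bsub>R\<^esub> \<longrightarrow> (\<exists>(n::nat). \<exists>r\<in>B. r \<otimes>\<^bsub>R\<^esub> b = u [^]\<^bsub>R\<^esub> n)))"

locale cring_adjoin = cring R for R (structure) +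
  fixes A :: "'a set" and c :: 'a
  assumes subring_A: "subring A R" and c_closed [simp, intro]: "c \<in> carrier R"
begin

abbreviation "U \<equiv> poly_span R A c"

lemma A_carrier [simp]: "a \<in> A \<Longrightarrow> a \<in> carrier R"
  using subringE(1)[OF subring_A] by auto

lemmas A_closed [simp, intro] = subringE(2,3,5,6,7)[OF subring_A]

lemma A_pow [simp, intro]: "a \<in> A \<Longrightarrow> a [^] (n::nat) \<in> A"
  by (induction n) auto

lemma span_SucE:
  assumes "x \<in> U (Suc d)"
  obtains a y where "a \<in> A" "y \<in> U d" "x = a \<otimes> c [^] d \<oplus> y"
  using assms by auto

lemma span_SucI: "a \<in> A \<Longrightarrow> y \<in> U d \<Longrightarrow> a \<otimes> c [^] d \<oplus> y \<in> U (Suc d)"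
  by auto

declare poly_span.simps(2) [simp del]

lemma span_carrier [simp]: "x \<in> U d \<Longrightarrow> x \<in> carrier R"
  by (induction d arbitrary: x) (auto elim!: span_SucE)

lemma span_zero [simp, intro]: "\<zero> \<in> U d"
proof (induction d)
  case (Suc d)
  then show ?case using span_SucI[of \<zero> \<zero> d] by simp
qed simp

lemma span_Suc [intro]: "x \<in> U d \<Longrightarrow> x \<in> U (Suc d)"
  using span_SucI[of \<zero> x d] by simp

lemma span_mono: "d \<le> e \<Longrightarrow> x \<in> U d \<Longrightarrow> x \<in> U e"
  by (induction rule: dec_induct) auto

lemma monom_span: "a \<in> A \<Longrightarrow> a \<otimes> c [^] d \<in> U (Suc d)"
  using span_SucI[of a \<zero> d] by simp

lemma span_add [simp, intro]: "x \<in> U d \<Longrightarrow> y \<in> U d \<Longrightarrow> x \<oplus> y \<in> U d"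
proof (induction d arbitrary: x y)
  case (Suc d)
  obtain a x' b y' where *: "a \<in> A" "x' \<in> U d" "x = a \<otimes> c [^] d \<oplus> x'"
      "b \<in> A" "y' \<in> U d" "y = b \<otimes> c [^] d \<oplus> y'"
    using Suc.prems by (metis span_SucE)
  then have "x \<oplus> y = (a \<oplus> b) \<otimes> c [^] d \<oplus> (x' \<oplus> y')"
    by (simp add: l_distr a_ac)
  then show ?case using * Suc.IH by (simp add: span_SucI)
qed simp

lemma span_smult [simp, intro]: "a \<in> A \<Longrightarrow> x \<in> U d \<Longrightarrow> a \<otimes> x \<in> U d"
proof (induction d arbitrary: x)
  case (Suc d)
  obtain b y where *: "b \<in> A" "y \<in> U d" "x = b \<otimes> c [^] d \<oplus> y"
    using Suc.prems by (metis span_SucE)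
  then have "a \<otimes> x = (a \<otimes> b) \<otimes> c [^] d \<oplus> a \<otimes> y"
    using Suc.prems by (simp add: r_distr m_assoc)
  then show ?case using * Suc by (simp add: span_SucI)
qed simp

lemma span_minus [simp, intro]: "x \<in> U d \<Longrightarrow> \<ominus> x \<in> U d"
  using span_smult[of "\<ominus> \<one>" x d] by (simp add: l_minus)

lemma span_diff [simp, intro]: "x \<in> U d \<Longrightarrow> y \<in> U d \<Longrightarrow> x \<ominus> y \<in> U d"
  by (simp add: a_minus_def)

lemma span_mult_c: "x \<in> U d \<Longrightarrow> c \<otimes> x \<in> U (Suc d)"
proof (induction d arbitrary: x)
  case (Suc d)
  obtain b y where *: "b \<in> A" "y \<in> U d" "x = b \<otimes> c [^] d \<oplus> y"
    using Suc.prems by (metis span_SucE)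
  then have "c \<otimes> x = b \<otimes> c [^] Suc d \<oplus> c \<otimes> y"
    by (simp add: r_distr m_ac)
  then show ?case using * Suc.IH[of y] span_SucI[of b "c \<otimes> y" "Suc d"] by simp
qed auto

lemma span_mult_pow: "x \<in> U d \<Longrightarrow> c [^] (e::nat) \<otimes> x \<in> U (d + e)"
proof (induction e)
  case (Suc e)
  have "c [^] Suc e \<otimes> x = c \<otimes> (c [^] e \<otimes> x)"
    using Suc.prems by (simp add: m_ac)
  then show ?case using span_mult_c Suc by simp
qed simp

lemma span_mult: "x \<in> U d \<Longrightarrow> y \<in> U e \<Longrightarrow> x \<otimes> y \<in> U (d + e)"
proof (induction d arbitrary: x)
  case (Suc d)
  obtain b z where *: "b \<in> A" "z \<in> U d" "x = b \<otimes> c [^] d \<oplus> z"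
    using Suc.prems by (metis span_SucE)
  then have "x \<otimes> y = b \<otimes> (c [^] d \<otimes> y) \<oplus> z \<otimes> y"
    using Suc.prems by (simp add: l_distr m_assoc)
  moreover have "c [^] d \<otimes> y \<in> U (d + e)" using span_mult_pow[OF Suc.prems(2), of d]
    by (simp add: add.commute)
  ultimately show ?case using * Suc by (auto intro!: span_Suc)
qed (auto intro: span_mono)

text \<open>Leading coefficients are tracked because a product equal to 1 will be refuted by a
  nonzero coefficient in positive degree.\<close>

lemma span_mult_top:
  assumes "a \<in> A" "x \<in> U d" "b \<in> A" "y \<in> U e"
  obtains z where "z \<in> U (d + e)"
    "(a \<otimes> c [^] d \<oplus> x) \<otimes> (b \<otimes> c [^] e \<oplus> y) = (a \<otimes> b) \<otimes> c [^] (d + e) \<oplus> z"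
proof
  let ?z = "a \<otimes> (c [^] d \<otimes> y) \<oplus> b \<otimes> (c [^] e \<otimes> x) \<oplus> x \<otimes> y"
  have "c [^] d \<otimes> y \<in> U (d + e)" "c [^] e \<otimes> x \<in> U (d + e)"
    using span_mult_pow[OF assms(2), of e] span_mult_pow[OF assms(4), of d]
    by (auto simp: add.commute)
  then show "?z \<in> U (d + e)" using assms by (auto intro: span_mult)
  have "c [^] (d + e) = c [^] d \<otimes> c [^] e" by (simp add: nat_pow_mult)
  then show "(a \<otimes> c [^] d \<oplus> x) \<otimes> (b \<otimes> c [^] e \<oplus> y) = (a \<otimes> b) \<otimes> c [^] (d + e) \<oplus> ?z"
    using assms by (simp add: l_distr r_distr m_ac a_ac)
qed

text \<open>Splits off the constant term instead of the leading one; constant terms are what is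
  compared when an equation in A[c] is brought down to A.\<close>

lemma span_horner:
  assumes "x \<in> U (Suc d)"
  obtains a y where "a \<in> A" "y \<in> U d" "x = a \<oplus> c \<otimes> y"
proof -
  have "x \<in> U (Suc d) \<Longrightarrow> \<exists>a y. a \<in> A \<and> y \<in> U d \<and> x = a \<oplus> c \<otimes> y"
  proof (induction d arbitrary: x)
    case 0
    then obtain a where "a \<in> A" "x = a" by (auto elim!: span_SucE)
    then show ?case by (intro exI[of _ a] exI[of _ \<zero>]) auto
  next
    case (Suc d)
    obtain b y where *: "b \<in> A" "y \<in> U (Suc d)" "x = b \<otimes> c [^] Suc d \<oplus> y"
      using Suc.prems by (metis span_SucE)
    obtain a z where **: "a \<in> A" "z \<in> U d" "y = a \<oplus> c \<otimes> z" using Suc.IH *(2) by blast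
    have "x = a \<oplus> c \<otimes> (b \<otimes> c [^] d \<oplus> z)"
      using * ** by (simp add: r_distr m_ac a_ac)
    then show ?case using * ** span_SucI by blast
  qed
  then show ?thesis using assms that by blast
qed

lemma const_span: "a \<in> A \<Longrightarrow> a \<in> U (Suc d)"
proof (induction d)
  case 0
  then show ?case using monom_span[of a 0] by simp
qed auto

lemma adjoinE:
  assumes "x \<in> adjoin R A c" obtains d where "x \<in> U d"
  using assms by (auto simp: adjoin_def)

lemma adjoinI: "x \<in> U d \<Longrightarrow> x \<in> adjoin R A c"
  by (auto simp: adjoin_def)

lemma adjoin_subring: "subring (adjoin R A c) R"
proof (rule subringI)
  show "\<one> \<in> adjoin R A c" by (rule adjoinI[OF const_span]) auto
  fix x y assume "x \<in> adjoin R A c" "y \<in> adjoin R A c"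
  then obtain d e where "x \<in> U d" "y \<in> U e" by (metis adjoinE)
  then show "x \<otimes> y \<in> adjoin R A c"
    by (intro adjoinI[OF span_mult])
  show "x \<oplus> y \<in> adjoin R A c"
    by (rule adjoinI[of _ "max d e"], rule span_add)
      (use \<open>x \<in> U d\<close> \<open>y \<in> U e\<close> in \<open>auto intro: span_mono[rotated]\<close>)
qed (auto simp: adjoin_def)

lemmas adjoin_closed [simp, intro] = subringE(2,3,5,6,7)[OF adjoin_subring]

lemma adjoin_carrier [simp]: "x \<in> adjoin R A c \<Longrightarrow> x \<in> carrier R"
  by (auto simp: adjoin_def)

lemma adjoin_diff [simp, intro]:
  "x \<in> adjoin R A c \<Longrightarrow> y \<in> adjoin R A c \<Longrightarrow> x \<ominus> y \<in> adjoin R A c"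
  by (simp add: a_minus_def)

lemma adjoin_pow [simp, intro]: "x \<in> adjoin R A c \<Longrightarrow> x [^] (n::nat) \<in> adjoin R A c"
  by (induction n) auto

lemma A_adjoin [simp, intro]: "a \<in> A \<Longrightarrow> a \<in> adjoin R A c"
  by (rule adjoinI[OF const_span])

lemma c_adjoin [simp, intro]: "c \<in> adjoin R A c"
  using monom_span[of \<one> 1] by (auto intro: adjoinI)

lemma span_top:
  assumes "x \<in> U d" "x \<noteq> \<zero>"
  obtains a e y where "a \<in> A" "a \<noteq> \<zero>" "e < d" "y \<in> U e" "x = a \<otimes> c [^] e \<oplus> y"
proof -
  have "x \<in> U d \<Longrightarrow> \<exists>a e y. a \<in> A \<and> a \<noteq> \<zero> \<and> e < d \<and> y \<in> U e \<and> x = a \<otimes> c [^] e \<oplus> y"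
  proof (induction d)
    case 0
    then show ?case using assms(2) by simp
  next
    case (Suc d)
    obtain b y where *: "b \<in> A" "y \<in> U d" "x = b \<otimes> c [^] d \<oplus> y"
      using Suc.prems by (metis span_SucE)
    show ?case
    proof (cases "b = \<zero>")
      case True
      then have "x \<in> U d" using * by simp
      then show ?thesis using Suc.IH less_SucI by blast
    next
      case False
      then show ?thesis using * by blast
    qed
  qed
  then show ?thesis using assms(1) that by blast
qed

lemma alg_overI:
  assumes "a \<in> A" "a \<noteq> \<zero>" "y \<in> U d" "a \<otimes> c [^] d \<oplus> y = \<zero>"
  shows "alg_over R A c"
proof -
  have "a \<otimes> c [^] d = \<ominus> y"
    using assms by (metis A_carrier c_closed m_closed minus_equality nat_pow_closed span_carrier)
  then have "a \<otimes> c [^] d \<in> U d" using assms by simp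
  then show ?thesis using assms by (auto simp: alg_over_def)
qed

end

lemma (in domain) nat_pow_nonzero:
  "x \<in> carrier R \<Longrightarrow> x \<noteq> \<zero> \<Longrightarrow> x [^] (n::nat) \<noteq> \<zero>"
  by (induction n) (auto simp: integral_iff)

section \<open>Pseudo-division and minimal relations over a subring of a domain\<close>

locale domain_adjoin = domain R + cring_adjoin R A c
  for R (structure) and A and c
begin

text \<open>Each drop of one degree costs one factor b: x is replaced by b x - a c^j h, with a its
  top coefficient, and the terms of degree e + j cancel.\<close>

lemma reduce:
  assumes b: "b \<in> A" and h': "h' \<in> U e" and h: "h = b \<otimes> c [^] e \<oplus> h'"
  shows "x \<in> U (e + j) \<Longrightarrow> \<exists>q \<in> U j. b [^] j \<otimes> x \<ominus> q \<otimes> h \<in> U e"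
proof (induction j arbitrary: x)
  case 0
  then show ?case using b h' h by (intro bexI[of _ \<zero>]) auto
next
  case (Suc j)
  obtain a y where *: "a \<in> A" "y \<in> U (e + j)" "x = a \<otimes> c [^] (e + j) \<oplus> y"
    using Suc.prems by (metis add_Suc_right span_SucE)
  have hc: "h \<in> carrier R" and cc: "h' \<in> carrier R" "y \<in> carrier R" "a \<in> carrier R" "b \<in> carrier R"
    using b h h' * by auto
  let ?z = "b \<otimes> y \<ominus> a \<otimes> (c [^] j \<otimes> h')"
  have "?z \<in> U (e + j)" using b h' * span_mult_pow[OF h', of j] by auto
  then obtain q where q: "q \<in> U j" "b [^] j \<otimes> ?z \<ominus> q \<otimes> h \<in> U e" using Suc.IH by blast
  let ?q = "(b [^] j \<otimes> a) \<otimes> c [^] j \<oplus> q"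
  have qc: "q \<in> carrier R" using q by auto
  have p: "c [^] (e + j) = c [^] e \<otimes> c [^] j" by (simp add: nat_pow_mult)
  have "b [^] Suc j \<otimes> x \<ominus> ?q \<otimes> h = b [^] j \<otimes> ?z \<ominus> q \<otimes> h"
  proof -
    have "b [^] j \<otimes> b \<otimes> (a \<otimes> (C1 \<otimes> C2) \<oplus> y) \<ominus> (b [^] j \<otimes> a \<otimes> C2 \<oplus> q) \<otimes> (b \<otimes> C1 \<oplus> h') =
        b [^] j \<otimes> (b \<otimes> y \<ominus> a \<otimes> (C2 \<otimes> h')) \<ominus> q \<otimes> (b \<otimes> C1 \<oplus> h')"
      if "C1 \<in> carrier R" "C2 \<in> carrier R" for C1 C2
    proof -
      have B: "b [^] j \<in> carrier R" using cc by simp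
      show ?thesis using B that cc qc by algebra
    qed
    from this[of "c [^] e" "c [^] j"] show ?thesis
      unfolding * h p nat_pow_Suc by simp
  qed
  then show ?case using q b * span_SucI[of "b [^] j \<otimes> a" q j] by (intro bexI[of _ ?q]) auto
qed

text \<open>Pseudo-division keeps track of the leading coefficient of the quotient.\<close>

lemma reduce_top:
  assumes b: "b \<in> A" and h': "h' \<in> U e" and h: "h = b \<otimes> c [^] e \<oplus> h'"
    and a: "a \<in> A" and y: "y \<in> U (e + j)"
  shows "\<exists>q \<in> U j. b [^] Suc j \<otimes> (a \<otimes> c [^] (e + j) \<oplus> y)
    \<ominus> ((b [^] j \<otimes> a) \<otimes> c [^] j \<oplus> q) \<otimes> h \<in> U e"
proof -
  have hc: "h \<in> carrier R" and cc: "h' \<in> carrier R" "y \<in> carrier R" "a \<in> carrier R" "b \<in> carrier R"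
    using assms by auto
  let ?z = "b \<otimes> y \<ominus> a \<otimes> (c [^] j \<otimes> h')"
  have "?z \<in> U (e + j)" using assms span_mult_pow[OF h', of j] by auto
  then obtain q where q: "q \<in> U j" "b [^] j \<otimes> ?z \<ominus> q \<otimes> h \<in> U e"
    using reduce[OF b h' h] by blast
  have qc: "q \<in> carrier R" using q by auto
  have p: "c [^] (e + j) = c [^] e \<otimes> c [^] j" by (simp add: nat_pow_mult)
  have "b [^] j \<otimes> b \<otimes> (a \<otimes> (C1 \<otimes> C2) \<oplus> y) \<ominus> (b [^] j \<otimes> a \<otimes> C2 \<oplus> q) \<otimes> (b \<otimes> C1 \<oplus> h') =
      b [^] j \<otimes> (b \<otimes> y \<ominus> a \<otimes> (C2 \<otimes> h')) \<ominus> q \<otimes> (b \<otimes> C1 \<oplus> h')"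
    if "C1 \<in> carrier R" "C2 \<in> carrier R" for C1 C2
  proof -
    have B: "b [^] j \<in> carrier R" using cc by simp
    show ?thesis using B that cc qc by algebra
  qed
  from this[of "c [^] e" "c [^] j"] show ?thesis
    unfolding h p nat_pow_Suc using q(1) q(2)[unfolded h] by (intro bexI[of _ q]) auto
qed

text \<open>For algebraic c, the degree of its minimal polynomial over the fraction field of A, read
  off from relations inside R.\<close>

definition mindeg :: nat where
  "mindeg = (LEAST d. \<exists>s\<in>A. s \<noteq> \<zero> \<and> s \<otimes> c [^] d \<in> U d)"

lemma mindeg_ex:
  assumes "alg_over R A c"
  obtains s y where "s \<in> A" "s \<noteq> \<zero>" "y \<in> U mindeg" "s \<otimes> c [^] mindeg \<oplus> y = \<zero>"
proof -
  obtain s where s: "s \<in> A" "s \<noteq> \<zero>" "s \<otimes> c [^] mindeg \<in> U mindeg"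
    using LeastI_ex[OF assms[unfolded alg_over_def]] by (auto simp: mindeg_def)
  then show ?thesis
    by (intro that[of s "\<ominus> (s \<otimes> c [^] mindeg)"]) (auto simp: r_neg)
qed

lemma mindeg_free:
  assumes "a \<in> A" "d < mindeg" "y \<in> U d" "a \<otimes> c [^] d \<oplus> y = \<zero>"
  shows "a = \<zero>"
proof (rule ccontr)
  assume "a \<noteq> \<zero>"
  have "a \<otimes> c [^] d = \<ominus> y"
    using assms by (metis A_carrier c_closed m_closed minus_equality nat_pow_closed span_carrier)
  then have "mindeg \<le> d"
    unfolding mindeg_def using \<open>a \<noteq> \<zero>\<close> assms by (intro Least_le) auto
  then show False using assms by simp
qed

text \<open>A relation shorter than the minimal one has only zero coefficients:
  \<open>mindeg_free\<close> strips them from the top until the constant one is left.\<close>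

lemma mindeg_const:
  assumes "e \<in> A" "y \<in> U d" "d < mindeg" "e \<oplus> c \<otimes> y = \<zero>"
  shows "e = \<zero>"
  using assms(2-4)
proof (induction d arbitrary: y)
  case 0
  then show ?case using assms(1) by simp
next
  case (Suc d)
  obtain a z where *: "a \<in> A" "z \<in> U d" "y = a \<otimes> c [^] d \<oplus> z"
    using Suc.prems by (metis span_SucE)
  have E: "e \<oplus> c \<otimes> y = a \<otimes> c [^] Suc d \<oplus> (e \<oplus> c \<otimes> z)"
    using * assms(1) by (simp add: r_distr m_ac a_ac)
  have "e \<oplus> c \<otimes> z \<in> U (Suc d)"
    using assms(1) * span_mult_c const_span by blast
  then have "a = \<zero>" using mindeg_free[OF *(1) Suc.prems(2)] E Suc.prems(3) by simp
  then have "e \<oplus> c \<otimes> z = \<zero>" using E * assms(1) Suc.prems(3) by simp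
  then show ?case using Suc.IH[of z] * Suc.prems(2) by simp
qed

text \<open>If \<open>c\<close> is algebraic over \<open>A\<close>, every nonzero ideal of \<open>A[c]\<close> meets \<open>A\<close> nontrivially: an
  element \<open>h\<close> of minimal degree in the ideal divides the minimal relation of \<open>c\<close> up to a factor
  from \<open>A\<close>, and if \<open>h\<close> were nonconstant, the quotient would be a shorter relation.\<close>

lemma alg_meet:
  assumes alg: "alg_over R A c" and g: "g \<in> adjoin R A c" "g \<noteq> \<zero>"
  obtains w where "w \<in> adjoin R A c" "w \<otimes> g \<in> A" "w \<otimes> g \<noteq> \<zero>"
proof -
  \<comment> \<open>Some nonzero multiple of g has degree below d. The bound is strict, so n is one
    more than the least degree that occurs.\<close>
  define P where "P d \<longleftrightarrow> (\<exists>w\<in>adjoin R A c. w \<otimes> g \<in> U d \<and> w \<otimes> g \<noteq> \<zero>)" for d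
  define n where "n = (LEAST d. P d)"
  obtain d where d: "g \<in> U d" using g adjoinE by blast
  have Pd: "P d" unfolding P_def by (rule bexI[of _ \<one>]) (use d g in auto)
  have Pn: "P n" unfolding n_def using Pd by (rule LeastI)
  have min: "n \<le> d" if "P d" for d unfolding n_def using that by (rule Least_le)
  obtain s y where s: "s \<in> A" "s \<noteq> \<zero>" "y \<in> U mindeg" "s \<otimes> c [^] mindeg \<oplus> y = \<zero>"
    using mindeg_ex[OF alg] .
  let ?f = "s \<otimes> c [^] mindeg \<oplus> y"
  have "P mindeg"
  proof (cases "d \<le> mindeg")
    case True
    then show ?thesis using Pd span_mono unfolding P_def by blast
  next
    case False
    then obtain j where j: "d = mindeg + j" using le_Suc_ex nat_le_linear by blast
    obtain q where q: "q \<in> U j" "s [^] j \<otimes> g \<ominus> q \<otimes> ?f \<in> U mindeg"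
      using reduce[OF s(1,3) refl, of g j] d j by blast
    \<comment> \<open>The minimal relation \<open>?f\<close> is zero in R, so the pseudo-remainder
      is s^j g itself.\<close>
    have "s [^] j \<otimes> g \<in> U mindeg" using q s(4) g s(1) by (simp add: a_minus_def)
    moreover have "s [^] j \<otimes> g \<noteq> \<zero>" using s g integral
      by (metis A_carrier adjoin_carrier nat_pow_closed nat_pow_nonzero)
    ultimately show ?thesis unfolding P_def using s(1) by blast
  qed
  then have nm: "n \<le> mindeg" by (rule min)
  obtain w where w: "w \<in> adjoin R A c" "w \<otimes> g \<in> U n" "w \<otimes> g \<noteq> \<zero>" using Pn P_def by blast
  obtain b e h' where h: "b \<in> A" "b \<noteq> \<zero>" "e < n" "h' \<in> U e" "w \<otimes> g = b \<otimes> c [^] e \<oplus> h'"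
    using span_top[OF w(2,3)] by blast
  have wc: "w \<in> carrier R" "g \<in> carrier R" using w g by auto
  define j where "j = mindeg - e"
  have j: "mindeg = e + j" using h nm by (simp add: j_def)
  obtain q where q: "q \<in> U j"
    "b [^] Suc j \<otimes> ?f \<ominus> ((b [^] j \<otimes> s) \<otimes> c [^] j \<oplus> q) \<otimes> (w \<otimes> g) \<in> U e"
    using reduce_top[OF h(1,4,5) s(1), of y j] s(3) unfolding j by blast
  let ?q = "(b [^] j \<otimes> s) \<otimes> c [^] j \<oplus> q"
  have qa: "?q \<in> adjoin R A c" using q h(1) s(1) by (intro adjoinI[of _ "Suc j"] span_SucI) auto
  have "?q \<otimes> (w \<otimes> g) \<in> carrier R" using qa wc by simp
  then have "\<ominus> (?q \<otimes> (w \<otimes> g)) \<in> U e"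
    using q(2) s(4) h(1) by (simp add: a_minus_def)
  then have qU: "?q \<otimes> (w \<otimes> g) \<in> U e"
    using span_minus \<open>?q \<otimes> (w \<otimes> g) \<in> carrier R\<close> by (metis minus_minus)
  have "?q \<otimes> (w \<otimes> g) = \<zero>"
  proof (rule ccontr)
    assume "?q \<otimes> (w \<otimes> g) \<noteq> \<zero>"
    then have "P e" unfolding P_def using qU qa w wc
      by (intro bexI[of _ "?q \<otimes> w"]) (auto simp: m_assoc)
    then show False using min h(3) by fastforce
  qed
  \<comment> \<open>A vanishing quotient is a relation of degree j with leading coefficient b^j s,
    so mindeg \<le> j = mindeg - e, which forces e = 0.\<close>
  then have "?q = \<zero>" using integral[of ?q "w \<otimes> g"] w(3) wc qa by auto
  moreover have "b [^] j \<otimes> s \<noteq> \<zero>"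
    using h s integral by (metis A_carrier nat_pow_closed nat_pow_nonzero)
  ultimately have "mindeg \<le> j" using mindeg_free[of "b [^] j \<otimes> s" j q] q(1) h(1) s(1)
    by (meson A_closed(4) A_pow not_le)
  then have "e = 0" using j by simp
  then have "w \<otimes> g \<in> A" using h by simp
  then show ?thesis using that w by blast
qed

text \<open>For transcendental c, the element 1 + c u would divide a power of u while being
  congruent to 1 modulo u, hence be a unit of A[c]. Its degree is positive and leading coefficients
  multiply without cancelling, so no product with it can equal 1.\<close>

lemma G_domain_alg:
  assumes "G_domain R (adjoin R A c)"
  shows "alg_over R A c"
proof (rule ccontr)
  assume na: "\<not> alg_over R A c"
  obtain u where u: "u \<in> adjoin R A c" "u \<noteq> \<zero>"
    and G: "\<And>b. b \<in> adjoin R A c \<Longrightarrow> b \<noteq> \<zero> \<Longrightarrow>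
      \<exists>(n::nat). \<exists>r\<in>adjoin R A c. r \<otimes> b = u [^] n"
    using assms unfolding G_domain_def by blast
  let ?b = "\<one> \<oplus> c \<otimes> u"
  have uc: "u \<in> carrier R" using u by simp
  obtain d where "u \<in> U d" using u adjoinE by blast
  then obtain a e u' where a: "a \<in> A" "a \<noteq> \<zero>" "u' \<in> U e" "u = a \<otimes> c [^] e \<oplus> u'"
    using span_top u(2) by metis
  have b': "\<one> \<oplus> c \<otimes> u' \<in> U (Suc e)" using a(3) span_mult_c const_span by blast
  have b: "?b = a \<otimes> c [^] Suc e \<oplus> (\<one> \<oplus> c \<otimes> u')"
    using a by (simp add: r_distr m_ac a_ac)
  have b0: "?b \<noteq> \<zero>" using alg_overI[OF a(1,2) b'] b na by auto
  have ba: "?b \<in> adjoin R A c" using u by blast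
  obtain n r where "r \<in> adjoin R A c" "r \<otimes> ?b = u [^] (n::nat)" using G[OF ba b0] by blast
  then have "\<exists>r\<in>adjoin R A c. r \<otimes> ?b = \<one>"
  proof (induction n arbitrary: r)
    case (Suc n)
    have rc: "r \<in> carrier R" using Suc.prems by simp
    \<comment> \<open>Descent on the exponent: if r b = u^(n+1), then (u^n - c r) b = u^n b - c
      u^(n+1) = u^n.\<close>
    have "(u [^] n \<ominus> c \<otimes> r) \<otimes> ?b = u [^] n \<otimes> ?b \<ominus> c \<otimes> (r \<otimes> ?b)"
    proof -
      have n: "u [^] n \<in> carrier R" using uc by simp
      show ?thesis using uc rc n c_closed by algebra
    qed
    also have "\<dots> = u [^] n \<otimes> ?b \<ominus> c \<otimes> (u [^] n \<otimes> u)" using Suc.prems by simp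
    also have "\<dots> = u [^] n"
    proof -
      have n: "u [^] n \<in> carrier R" using uc by simp
      show ?thesis using uc n c_closed by algebra
    qed
    finally show ?case using Suc.IH[of "u [^] n \<ominus> c \<otimes> r"] Suc.prems u by auto
  qed auto
  then obtain r where r: "r \<in> adjoin R A c" "r \<otimes> ?b = \<one>" by blast
  have "r \<noteq> \<zero>" using r b0 ba by auto
  moreover obtain d where "r \<in> U d" using r adjoinE by blast
  ultimately obtain a2 e2 r' where a2: "a2 \<in> A" "a2 \<noteq> \<zero>" "r' \<in> U e2" "r = a2 \<otimes> c [^] e2 \<oplus> r'"
    using span_top by metis
  obtain z where z: "z \<in> U (e2 + Suc e)"
      "r \<otimes> ?b = (a2 \<otimes> a) \<otimes> c [^] (e2 + Suc e) \<oplus> z"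
    using span_mult_top[OF a2(1,3) a(1) b'] a2(4) b by metis
  have "(a2 \<otimes> a) \<otimes> c [^] (e2 + Suc e) \<oplus> (z \<ominus> \<one>) = r \<otimes> ?b \<ominus> \<one>"
    unfolding z a_minus_def using z(1) a a2 by (simp add: a_ac)
  also have "\<dots> = \<zero>" unfolding r by (simp add: a_minus_def r_neg)
  finally have e: "(a2 \<otimes> a) \<otimes> c [^] (e2 + Suc e) \<oplus> (z \<ominus> \<one>) = \<zero>" .
  have "\<one> \<in> U (e2 + Suc e)" using const_span[of \<one>] by simp
  then have z1: "z \<ominus> \<one> \<in> U (e2 + Suc e)" using z(1) by blast
  have "a2 \<otimes> a \<in> A" "a2 \<otimes> a \<noteq> \<zero>" using a a2 integral_iff by auto
  from alg_overI[OF this z1 e] na show False by simp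
qed

text \<open>The witness for A is s v: v is a multiple of u that lies in A, and s, the leading
  coefficient of a minimal relation, pays for the pseudo-divisions that bring cofactors from A[c]
  down to A.\<close>

lemma G_domain_descend:
  assumes "G_domain R (adjoin R A c)"
  shows "G_domain R A"
proof -
  note alg = G_domain_alg[OF assms]
  obtain u where u: "u \<in> adjoin R A c" "u \<noteq> \<zero>"
    and G: "\<And>b. b \<in> adjoin R A c \<Longrightarrow> b \<noteq> \<zero> \<Longrightarrow>
      \<exists>(n::nat). \<exists>r\<in>adjoin R A c. r \<otimes> b = u [^] n"
    using assms unfolding G_domain_def by blast
  obtain w where w: "w \<in> adjoin R A c" "w \<otimes> u \<in> A" "w \<otimes> u \<noteq> \<zero>" using alg_meet[OF alg u] .
  obtain s y where s: "s \<in> A" "s \<noteq> \<zero>" "y \<in> U mindeg" "s \<otimes> c [^] mindeg \<oplus> y = \<zero>"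
    using mindeg_ex[OF alg] .
  have m0: "mindeg \<noteq> 0" using s by (auto intro: ccontr)
  define v where "v = w \<otimes> u"
  have vA: "v \<in> A" "v \<noteq> \<zero>" using w v_def by auto
  have "\<exists>(n::nat). \<exists>r\<in>A. r \<otimes> a = (s \<otimes> v) [^] n" if a: "a \<in> A" "a \<noteq> \<zero>" for a
  proof -
    obtain n r where r: "r \<in> adjoin R A c" "r \<otimes> a = u [^] (n::nat)" using G[of a] a by blast
    define r' where "r' = w [^] n \<otimes> r"
    have r'a: "r' \<in> adjoin R A c" using w r by (auto simp: r'_def)
    have "r' \<otimes> a = w [^] n \<otimes> (r \<otimes> a)" using w r a by (simp add: r'_def m_assoc)
    also have "\<dots> = v [^] n" using r w u by (simp add: v_def nat_pow_distrib)
    finally have r'v: "r' \<otimes> a = v [^] n" .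
    obtain d where d: "r' \<in> U d" using r'a adjoinE by blast
    obtain j where j: "r' \<in> U (mindeg + j)"
      using d span_mono[of d "mindeg + d"] by auto
    obtain q where q: "q \<in> U j"
      "s [^] j \<otimes> r' \<ominus> q \<otimes> (s \<otimes> c [^] mindeg \<oplus> y) \<in> U mindeg"
      using reduce[OF s(1,3) refl j] by blast
    have "s [^] j \<otimes> r' \<in> U mindeg" using q s(4) s(1) r'a by (simp add: a_minus_def)
    then obtain e z where ez: "e \<in> A" "z \<in> U (mindeg - 1)" "s [^] j \<otimes> r' = e \<oplus> c \<otimes> z"
      using span_horner[of _ "mindeg - 1"] m0 by (metis Suc_pred' gr0I)
    have cc: "s [^] j \<in> carrier R" "v [^] n \<in> carrier R" "a \<in> carrier R" "e \<in> carrier R"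
      "z \<in> carrier R" "r' \<in> carrier R"
      using s vA a ez r'a by auto
    \<comment> \<open>The difference of s^j r' a and s^j v^n is a relation of degree below mindeg,
      so its constant term vanishes.\<close>
    have "(e \<otimes> a \<ominus> s [^] j \<otimes> v [^] n) \<oplus> c \<otimes> (a \<otimes> z) =
        (e \<oplus> c \<otimes> z) \<otimes> a \<ominus> s [^] j \<otimes> v [^] n"
      using cc c_closed by algebra
    also have "\<dots> = s [^] j \<otimes> (r' \<otimes> a) \<ominus> s [^] j \<otimes> v [^] n"
      using cc unfolding ez(3)[symmetric] by (simp add: m_assoc)
    also have "\<dots> = \<zero>" using cc by (simp add: r'v a_minus_def r_neg)
    finally have "e \<otimes> a \<ominus> s [^] j \<otimes> v [^] n = \<zero>"
      using mindeg_const[of "e \<otimes> a \<ominus> s [^] j \<otimes> v [^] n" "a \<otimes> z" "mindeg - 1"]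
        ez a s(1) vA m0 by (auto simp: a_minus_def)
    then have ea: "e \<otimes> a = s [^] j \<otimes> v [^] n" using cc by simp
    \<comment> \<open>The extra factor s^n v^j raises both exponents to n + j and so produces a
      power of s v.\<close>
    have "(s [^] n \<otimes> v [^] j \<otimes> e) \<otimes> a = s [^] n \<otimes> v [^] j \<otimes> (e \<otimes> a)"
      using cc s vA by (simp add: m_assoc)
    also have "\<dots> = (s [^] n \<otimes> s [^] j) \<otimes> (v [^] n \<otimes> v [^] j)"
      using cc s vA unfolding ea by (simp add: m_ac)
    also have "\<dots> = (s \<otimes> v) [^] (n + j)"
      using s vA by (simp add: nat_pow_mult nat_pow_distrib)
    finally show ?thesis using s(1) vA ez(1) by (metis A_closed(4) A_pow)
  qed
  moreover have "s \<otimes> v \<in> A" "s \<otimes> v \<noteq> \<zero>" using s vA integral_iff by auto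
  ultimately show ?thesis unfolding G_domain_def by blast
qed

end

section \<open>Iterated adjunction and derivations\<close>

primrec tower :: "('a, 'x) ring_scheme \<Rightarrow> 'a set \<Rightarrow> 'a list \<Rightarrow> 'a set" where
  "tower R A [] = A"
| "tower R A (c # cs) = adjoin R (tower R A cs) c"

lemma (in cring) cring_adjoinI: "subring A R \<Longrightarrow> c \<in> carrier R \<Longrightarrow> cring_adjoin R A c"
  by (simp add: cring_adjoin_def cring_adjoin_axioms_def is_cring)

lemma (in domain) domain_adjoinI: "subring A R \<Longrightarrow> c \<in> carrier R \<Longrightarrow> domain_adjoin R A c"
  by (simp add: domain_adjoin_def cring_adjoinI domain_axioms)

lemma (in cring) tower_subring:
  assumes "subring A R" "set cs \<subseteq> carrier R"
  shows "subring (tower R A cs) R"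
  using assms(2)
proof (induction cs)
  case (Cons c cs)
  then interpret cring_adjoin R "tower R A cs" c by (intro cring_adjoinI) auto
  show ?case using adjoin_subring by simp
qed (simp add: assms)

context cring_adjoin
begin

lemma hom_poly_span:
  assumes "ring_hom_cring R S h"
  shows "h ` poly_span R A c d = poly_span S (h ` A) (h c) d"
proof -
  interpret h: ring_hom_cring R S h by fact
  show ?thesis
  proof (induction d)
    case 0
    then show ?case by simp
  next
    case (Suc d)
    have e: "h (a \<otimes> c [^] d \<oplus> x) = h a \<otimes>\<^bsub>S\<^esub> h c [^]\<^bsub>S\<^esub> d \<oplus>\<^bsub>S\<^esub> h x"
      if "a \<in> A" "x \<in> U d" for a x
      using that by simp
    have "h ` poly_span R A c (Suc d) =
        {h (a \<otimes> c [^] d \<oplus> x) | a x. a \<in> A \<and> x \<in> U d}"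
      unfolding poly_span.simps(2) by blast
    also have "\<dots> = {h a \<otimes>\<^bsub>S\<^esub> h c [^]\<^bsub>S\<^esub> d \<oplus>\<^bsub>S\<^esub> h x | a x. a \<in> A \<and> x \<in> U d}"
      using e by (intro Collect_cong iff_exI) auto
    also have "\<dots> = poly_span S (h ` A) (h c) (Suc d)"
      unfolding poly_span.simps(2) Suc[symmetric] by blast
    finally show ?case .
  qed
qed

lemma hom_adjoin:
  assumes "ring_hom_cring R S h"
  shows "h ` adjoin R A c = adjoin S (h ` A) (h c)"
  unfolding adjoin_def image_UN hom_poly_span[OF assms] ..

end

lemma (in cring) hom_tower:
  assumes "subring A R" "set cs \<subseteq> carrier R" "ring_hom_cring R S h"
  shows "h ` tower R A cs = tower S (h ` A) (map h cs)"
  using assms(2)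
proof (induction cs)
  case (Cons c cs)
  then interpret cring_adjoin R "tower R A cs" c
    by (intro cring_adjoinI tower_subring assms) auto
  show ?case using Cons hom_adjoin[OF assms(3)] by simp
qed simp

lemma (in cring) nat_subring: "subring A R \<Longrightarrow> [(n::nat)] \<cdot> \<one> \<in> A"
  by (induction n) (auto simp: subringE)

lemma (in deriv_ring) d_pow:
  assumes "cring R" "c \<in> carrier R"
  shows "\<delta> (c [^] Suc d) = [Suc d] \<cdot> \<one> \<otimes> c [^] d \<otimes> \<delta> c"
proof -
  interpret cring R by fact
  show ?thesis
  proof (induction d)
    case 0
    then show ?case using assms by simp
  next
    case (Suc d)
    have "\<delta> (c [^] Suc (Suc d)) = \<delta> (c [^] Suc d) \<otimes> c \<oplus> c [^] Suc d \<otimes> \<delta> c"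
      using assms(2) d_mult[of "c [^] Suc d" c] by simp
    also have "\<dots> = [Suc d] \<cdot> \<one> \<otimes> c [^] d \<otimes> \<delta> c \<otimes> c \<oplus> c [^] d \<otimes> c \<otimes> \<delta> c"
      using Suc by simp
    also have "\<dots> = ([Suc d] \<cdot> \<one> \<oplus> \<one>) \<otimes> (c [^] d \<otimes> c) \<otimes> \<delta> c"
    proof -
      have "c [^] d \<in> carrier R" "[Suc d] \<cdot> \<one> \<in> carrier R" "\<delta> c \<in> carrier R"
        using assms(2) by auto
      then show ?thesis using assms(2) by algebra
    qed
    finally show ?case by simp
  qed
qed

context domain_adjoin
begin

text \<open>If x = f(c) and \<delta> kills the coefficients of f, then \<delta>(x) = f'(c)
  \<delta>(c). The witness y is f'(c), one degree lower.\<close>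

lemma deriv_span:
  assumes "deriv_ring R \<delta>" and zero: "\<And>a. a \<in> A \<Longrightarrow> \<delta> a = \<zero>"
  shows "x \<in> U (Suc d) \<Longrightarrow> \<exists>y\<in>U d. \<delta> x = y \<otimes> \<delta> c"
proof -
  interpret deriv_ring R \<delta> by fact
  show "x \<in> U (Suc d) \<Longrightarrow> \<exists>y\<in>U d. \<delta> x = y \<otimes> \<delta> c"
  proof (induction d arbitrary: x)
    case 0
    then show ?case using zero by (auto elim!: span_SucE)
  next
    case (Suc d)
    obtain a z where *: "a \<in> A" "z \<in> U (Suc d)" "x = a \<otimes> c [^] Suc d \<oplus> z"
      using Suc.prems by (metis span_SucE)
    obtain y where y: "y \<in> U d" "\<delta> z = y \<otimes> \<delta> c" using Suc.IH *(2) by blast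
    have "\<delta> x = a \<otimes> \<delta> (c [^] Suc d) \<oplus> y \<otimes> \<delta> c"
      unfolding * using * y zero d_mult[of a "c [^] Suc d"] d_add by simp
    also have "\<dots> = ((a \<otimes> [Suc d] \<cdot> \<one>) \<otimes> c [^] d \<oplus> y) \<otimes> \<delta> c"
    proof -
      have "c [^] d \<in> carrier R" "[Suc d] \<cdot> \<one> \<in> carrier R" "\<delta> c \<in> carrier R" "a \<in> carrier R"
        "y \<in> carrier R"
        using * y by auto
      then show ?thesis unfolding d_pow[OF is_cring c_closed] by algebra
    qed
    finally show ?case
      using y *(1) nat_subring[OF subring_A, of "Suc d"] by (meson A_closed(4) span_SucI)
  qed
qed

text \<open>Differentiating the minimal relation f(c) = 0 gives f'(c) \<delta>(c) = 0. The leading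
  coefficient of f' is mindeg times s, nonzero in characteristic zero, so f'(c) is nonzero by
  minimality and \<delta>(c) = 0.\<close>

lemma deriv_adjoin_zero:
  assumes "deriv_ring R \<delta>" and zero: "\<And>a. a \<in> A \<Longrightarrow> \<delta> a = \<zero>"
    and char: "\<And>n::nat. n > 0 \<Longrightarrow> [n] \<cdot> \<one> \<noteq> \<zero>"
    and alg: "alg_over R A c" and x: "x \<in> adjoin R A c"
  shows "\<delta> x = \<zero>"
proof -
  interpret deriv_ring R \<delta> by fact
  obtain s y where s: "s \<in> A" "s \<noteq> \<zero>" "y \<in> U mindeg" "s \<otimes> c [^] mindeg \<oplus> y = \<zero>"
    using mindeg_ex[OF alg] .
  have "mindeg \<noteq> 0" using s by (auto intro: ccontr)
  then obtain m where m: "mindeg = Suc m" using not0_implies_Suc by blast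
  obtain y' where y': "y' \<in> U m" "\<delta> y = y' \<otimes> \<delta> c"
    using deriv_span[OF assms(1) zero] s(3) m by metis
  have "\<zero> = \<delta> (s \<otimes> c [^] Suc m \<oplus> y)" using s m by simp
  also have "\<dots> = s \<otimes> \<delta> (c [^] Suc m) \<oplus> y' \<otimes> \<delta> c"
    using s y' zero d_mult[of s "c [^] Suc m"] d_add by simp
  also have "\<dots> = ((s \<otimes> [Suc m] \<cdot> \<one>) \<otimes> c [^] m \<oplus> y') \<otimes> \<delta> c"
  proof -
    have "c [^] m \<in> carrier R" "[Suc m] \<cdot> \<one> \<in> carrier R" "\<delta> c \<in> carrier R" "s \<in> carrier R"
      "y' \<in> carrier R"
      using s y' by auto
    then show ?thesis unfolding d_pow[OF is_cring c_closed] by algebra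
  qed
  finally have p: "((s \<otimes> [Suc m] \<cdot> \<one>) \<otimes> c [^] m \<oplus> y') \<otimes> \<delta> c = \<zero>" by simp
  have "s \<otimes> [Suc m] \<cdot> \<one> \<in> A" using s nat_subring[OF subring_A] by blast
  moreover have "s \<otimes> [Suc m] \<cdot> \<one> \<noteq> \<zero>" using s char[of "Suc m"] by (simp add: integral_iff del: add.nat_pow_Suc)
  ultimately have "(s \<otimes> [Suc m] \<cdot> \<one>) \<otimes> c [^] m \<oplus> y' \<noteq> \<zero>"
    using mindeg_free[of _ m y'] y' m by auto
  then have dc: "\<delta> c = \<zero>" using p s y' by (subst (asm) integral_iff) auto
  obtain d where "x \<in> U d" using x adjoinE by blast
  then have "x \<in> U (Suc d)" by blast
  then obtain y where "y \<in> U d" "\<delta> x = y \<otimes> \<delta> c" using deriv_span[OF assms(1) zero] by blast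
  then show ?thesis using dc by simp
qed

end

text \<open>The generator adjoined last is algebraic over the tower below it, which is again a
  G-domain; so the vanishing of \<delta> climbs from A by algebraic steps.\<close>

lemma (in domain) G_domain_deriv_zero:
  assumes "deriv_ring R \<delta>" "subring A R" and zero: "\<And>a. a \<in> A \<Longrightarrow> \<delta> a = \<zero>"
    and char: "\<And>n::nat. n > 0 \<Longrightarrow> [n] \<cdot> \<one> \<noteq> \<zero>"
    and "set cs \<subseteq> carrier R" "G_domain R (tower R A cs)" "x \<in> tower R A cs"
  shows "\<delta> x = \<zero>"
  using assms(5-7)
proof (induction cs arbitrary: x)
  case (Cons c cs)
  then interpret domain_adjoin R "tower R A cs" c
    by (intro domain_adjoinI tower_subring assms) auto
  have "G_domain R (adjoin R (tower R A cs) c)" using Cons.prems by simp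
  note G = G_domain_descend[OF this] G_domain_alg[OF this]
  have "\<delta> a = \<zero>" if "a \<in> tower R A cs" for a
    by (rule Cons.IH[OF _ G(1) that]) (use Cons.prems in simp)
  then show ?case
    by (rule deriv_adjoin_zero[OF assms(1) _ char G(2)]) (use Cons.prems in simp_all)
qed (use zero in simp)

section \<open>Finiteness of the Krull dimension\<close>

lemma (in ideal) rcos_zero_iff:
  assumes "x \<in> carrier R"
  shows "I +> x = \<zero>\<^bsub>R Quot I\<^esub> \<longleftrightarrow> x \<in> I"
  using assms a_rcos_const[of x] a_rcos_self[of x] by (auto simp: FactRing_def)

text \<open>By \<open>alg_meet\<close>, an element of Q' outside I would have, modulo I, a nonzero
  multiple in the image of A. Lifted to A, that multiple lies in Q' but not in I.\<close>

lemma (in primeideal) alg_contraction: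
  assumes sub: "subring A R" and c: "c \<in> carrier R" and Q': "primeideal Q' R" "I \<subseteq> Q'"
    and eq: "Q' \<inter> A \<subseteq> I"
    and alg: "alg_over (R Quot I) ((+>) I ` A) (I +> c)"
  shows "Q' \<inter> adjoin R A c \<subseteq> I"
proof (rule ccontr)
  assume "\<not> Q' \<inter> adjoin R A c \<subseteq> I"
  then obtain g where g: "g \<in> Q'" "g \<in> adjoin R A c" "g \<notin> I" by blast
  interpret Q': primeideal Q' R by fact
  interpret h: ring_hom_cring R "R Quot I" "(+>) I" by (rule rcos_ring_hom_cring)
  interpret cring_adjoin R A c by (intro cring_adjoinI sub c)
  interpret D: domain "R Quot I" by (rule quotient_is_domain)
  have sub': "subring ((+>) I ` A) (R Quot I)"
    using ring_hom_ring.img_is_subring[OF rcos_ring_hom_ring sub] by simp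
  interpret D: domain_adjoin "R Quot I" "(+>) I ` A" "I +> c"
    by (intro D.domain_adjoinI sub' h.hom_closed c)
  have gc: "g \<in> carrier R" using g by simp
  have "I +> g \<in> adjoin (R Quot I) ((+>) I ` A) (I +> c)"
    using g hom_adjoin[OF h.ring_hom_cring_axioms] by blast
  moreover have "I +> g \<noteq> \<zero>\<^bsub>R Quot I\<^esub>" using g rcos_zero_iff[OF gc] by simp
  ultimately obtain w' where w': "w' \<in> adjoin (R Quot I) ((+>) I ` A) (I +> c)"
      "w' \<otimes>\<^bsub>R Quot I\<^esub> (I +> g) \<in> (+>) I ` A" "w' \<otimes>\<^bsub>R Quot I\<^esub> (I +> g) \<noteq> \<zero>\<^bsub>R Quot I\<^esub>"
    using D.alg_meet[OF alg] by blast
  obtain w where w: "w \<in> adjoin R A c" "w' = I +> w"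
    using w'(1) hom_adjoin[OF h.ring_hom_cring_axioms] by blast
  obtain a where a: "a \<in> A" "w' \<otimes>\<^bsub>R Quot I\<^esub> (I +> g) = I +> a" using w'(2) by blast
  have ac: "a \<in> carrier R" "w \<in> carrier R" using a w by auto
  have "I +> w \<otimes> g = I +> a" using a(2) ac gc w by simp
  then have "w \<otimes> g \<ominus> a \<in> I"
    using quotient_eq_iff_same_a_r_cos[OF is_ideal, of "w \<otimes> g" a] ac gc by simp
  then have "w \<otimes> g \<ominus> a \<in> Q'" using Q' by blast
  moreover have "w \<otimes> g \<in> Q'" using g ac Q'.I_l_closed by blast
  moreover have "a = w \<otimes> g \<ominus> (w \<otimes> g \<ominus> a)" using ac gc by algebra
  ultimately have "a \<in> Q'"
    by (metis Q'.is_additive_subgroup a_minus_def additive_subgroup.a_closed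
        additive_subgroup.a_inv_closed)
  then have "a \<in> I" using eq a by blast
  then show False using w'(3) a(2) rcos_zero_iff ac by simp
qed

text \<open>When g is written as a polynomial in c, leading coefficients in I lie in J too and may
  be dropped. As g is not in J, a coefficient outside I is eventually reached, and membership in I
  becomes an algebraic relation modulo I.\<close>

lemma (in primeideal) alg_larger:
  assumes sub: "subring A R" and c: "c \<in> carrier R" and J: "ideal J R"
    and eq: "I \<inter> A \<subseteq> J"
  shows "g \<in> poly_span R A c d \<Longrightarrow> g \<in> I \<Longrightarrow> g \<notin> J \<Longrightarrow>
    alg_over (R Quot I) ((+>) I ` A) (I +> c)"
proof (induction d arbitrary: g)
  case 0
  then show ?case using J by (simp add: additive_subgroup.zero_closed ideal.axioms(1))
next
  case (Suc d)
  interpret J: ideal J R by fact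
  interpret h: ring_hom_cring R "R Quot I" "(+>) I" by (rule rcos_ring_hom_cring)
  interpret cring_adjoin R A c by (intro cring_adjoinI sub c)
  interpret D: domain "R Quot I" by (rule quotient_is_domain)
  have sub': "subring ((+>) I ` A) (R Quot I)"
    using ring_hom_ring.img_is_subring[OF rcos_ring_hom_ring sub] by simp
  interpret D: domain_adjoin "R Quot I" "(+>) I ` A" "I +> c"
    by (intro D.domain_adjoinI sub' h.hom_closed c)
  obtain a y where *: "a \<in> A" "y \<in> U d" "g = a \<otimes> c [^] d \<oplus> y"
    using Suc.prems by (metis span_SucE)
  have cc: "a \<in> carrier R" "y \<in> carrier R" "c [^] d \<in> carrier R" using * by auto
  show ?case
  proof (cases "a \<in> I")
    case True
    have y: "y = g \<ominus> a \<otimes> c [^] d" unfolding * using cc by algebra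
    have "a \<otimes> c [^] d \<in> I" "a \<otimes> c [^] d \<in> J"
      using True cc *(1) eq I_r_closed J.I_r_closed by blast+
    then have "y \<in> I"
      unfolding y a_minus_def using Suc.prems(2) is_additive_subgroup
      by (simp add: additive_subgroup.a_closed additive_subgroup.a_inv_closed)
    moreover have "y \<notin> J"
    proof
      assume "y \<in> J"
      then have "g \<in> J" unfolding *(3) using \<open>a \<otimes> c [^] d \<in> J\<close>
        by (rule additive_subgroup.a_closed[OF J.is_additive_subgroup, rotated])
      then show False using Suc.prems by simp
    qed
    ultimately show ?thesis using Suc.IH *(2) by blast
  next
    case False
    have "I +> y \<in> poly_span (R Quot I) ((+>) I ` A) (I +> c) d"
      using * hom_poly_span[OF h.ring_hom_cring_axioms] by blast
    moreover have "(I +> a) \<otimes>\<^bsub>R Quot I\<^esub> (I +> c) [^]\<^bsub>R Quot I\<^esub> d \<oplus>\<^bsub>R Quot I\<^esub> (I +> y) = I +> g"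
      using cc unfolding *(3) by simp
    moreover have "I +> g = \<zero>\<^bsub>R Quot I\<^esub>" using rcos_zero_iff[of g] Suc.prems by simp
    ultimately show ?thesis
      using D.alg_overI[of "I +> a"] *(1) False rcos_zero_iff[OF cc(1)] by auto
  qed
qed

lemma (in cring) prime_chain_mono:
  assumes "prime_chain R n C" "i \<le> j" "j \<le> n"
  shows "C i \<subseteq> C j"
  using assms(2,3)
proof (induction rule: dec_induct)
  case (step j)
  have "C j \<subset> C (Suc j)" using assms(1) step by (simp add: prime_chain_def)
  then show ?case using step by auto
qed simp

text \<open>Primes of a chain with the same trace on a ring B have at most two traces on B[c]: one
  where c is transcendental modulo the prime, one where it is algebraic. This is the factor 2 for
  each generator.\<close>

lemma (in cring) card_contractions:
  assumes C: "prime_chain R n C" and A: "subring A R" and cs: "set cs \<subseteq> carrier R"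
  shows "card ((\<lambda>j. C j \<inter> tower R A cs) ` {..n}) \<le> 2 ^ length cs * card ((\<lambda>j. C j \<inter> A) ` {..n})"
  using cs
proof (induction cs)
  case (Cons c cs)
  let ?B = "tower R A cs"
  have B: "subring ?B R" and c: "c \<in> carrier R" using tower_subring[OF A] Cons.prems by auto
  \<comment> \<open>The aim is that \<open>f j\<close> determines the trace of \<open>C j\<close> on
    the larger ring.\<close>
  define f where "f j = (C j \<inter> ?B, alg_over (R Quot C j) ((+>) (C j) ` ?B) (C j +> c))" for j
  have p: "primeideal (C j) R" if "j \<le> n" for j using C that by (simp add: prime_chain_def)
  have sub: "C j \<inter> adjoin R ?B c \<subseteq> C i" if ij: "i \<le> j" "j \<le> n" "f i = f j" for i j
  proof (rule ccontr)
    assume "\<not> C j \<inter> adjoin R ?B c \<subseteq> C i"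
    then obtain g d where g: "g \<in> C j" "g \<notin> C i" "g \<in> poly_span R ?B c d"
      by (auto simp: adjoin_def)
    interpret I: primeideal "C i" R using p ij by simp
    interpret J: primeideal "C j" R using p ij by simp
    have e: "C j \<inter> ?B \<subseteq> C i" using ij(3) by (auto simp: f_def)
    \<comment> \<open>A trace that grows from i to j makes c algebraic modulo \<open>C j\<close>. As
      \<open>f i = f j\<close>, it is algebraic modulo \<open>C i\<close> as well, and then the
      trace cannot have grown.\<close>
    have "alg_over (R Quot C j) ((+>) (C j) ` ?B) (C j +> c)"
      by (rule J.alg_larger[OF B c I.is_ideal e g(3,1,2)])
    then have "alg_over (R Quot C i) ((+>) (C i) ` ?B) (C i +> c)" using ij(3) by (simp add: f_def)
    from I.alg_contraction[OF B c p[OF ij(2)] prime_chain_mono[OF C ij(1,2)] e this]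
    show False using g by (auto simp: adjoin_def)
  qed
  have eq: "C i \<inter> adjoin R ?B c = C j \<inter> adjoin R ?B c" if "i \<le> j" "j \<le> n" "f i = f j" for i j
    using sub[OF that] prime_chain_mono[OF C that(1,2)] by blast
  have eq': "C i \<inter> adjoin R ?B c = C j \<inter> adjoin R ?B c" if "i \<le> n" "j \<le> n" "f i = f j" for i j
    using eq[of i j] eq[of j i] that by (metis nat_le_linear)
  define g where "g p = C (SOME j. j \<le> n \<and> f j = p) \<inter> adjoin R ?B c" for p
  have "C i \<inter> adjoin R ?B c = g (f i)" if "i \<le> n" for i
  proof -
    have "(SOME j. j \<le> n \<and> f j = f i) \<le> n \<and> f (SOME j. j \<le> n \<and> f j = f i) = f i"
      using that by (rule_tac someI[of _ i]) simp
    then show ?thesis unfolding g_def using eq' that by metis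
  qed
  then have "(\<lambda>j. C j \<inter> tower R A (c # cs)) ` {..n} = g ` f ` {..n}" by (auto simp: image_iff)
  then have "card ((\<lambda>j. C j \<inter> tower R A (c # cs)) ` {..n}) \<le> card (f ` {..n})"
    by (simp add: card_image_le)
  also have "\<dots> \<le> card ((\<lambda>j. C j \<inter> ?B) ` {..n} \<times> (UNIV :: bool set))"
    by (rule card_mono) (auto simp: f_def)
  also have "\<dots> \<le> 2 ^ length (c # cs) * card ((\<lambda>j. C j \<inter> A) ` {..n})"
    using Cons by (simp add: card_cartesian_product)
  finally show ?case .
qed simp

text \<open>Nonzero elements of A are units, so every prime has trace zero on A; doubling once per
  generator leaves at most 2^length traces for the n + 1 distinct primes.\<close>

lemma (in cring) prime_chain_bound:
  assumes C: "prime_chain R n C" and A: "subring A R" and cs: "set cs \<subseteq> carrier R"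
    and t: "tower R A cs = carrier R" and u: "A - {\<zero>} \<subseteq> Units R"
  shows "n < 2 ^ length cs"
proof -
  have p: "primeideal (C j) R" if "j \<le> n" for j using C that by (simp add: prime_chain_def)
  have "C j \<inter> A = {\<zero>}" if "j \<le> n" for j
  proof -
    interpret primeideal "C j" R by (rule p[OF that])
    have "a = \<zero>" if a: "a \<in> C j" "a \<in> A" for a
    proof (rule ccontr)
      assume "a \<noteq> \<zero>"
      then have "a \<in> Units R" using u a by blast
      then have "\<one> \<in> C j" using a by (metis I_l_closed Units_inv_closed Units_l_inv)
      then show False using I_notcarr one_imp_carrier by blast
    qed
    then show ?thesis using subringE(2)[OF A] by auto
  qed
  then have "(\<lambda>j. C j \<inter> A) ` {..n} = {{\<zero>}}" by auto
  moreover have "inj_on C {..n}"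
  proof -
    have "C i \<noteq> C j" if "i < j" "j \<le> n" for i j
    proof -
      have "C i \<subset> C (Suc i)" using C that by (simp add: prime_chain_def)
      then show ?thesis using prime_chain_mono[OF C, of "Suc i" j] that by auto
    qed
    then show ?thesis by (metis atMost_iff inj_onI nat_neq_iff)
  qed
  moreover have "(\<lambda>j. C j \<inter> carrier R) ` {..n} = C ` {..n}"
  proof (rule image_cong[OF refl])
    fix j assume "j \<in> {..n}"
    then interpret primeideal "C j" R using p by simp
    show "C j \<inter> carrier R = C j" using a_subset by blast
  qed
  ultimately show ?thesis using card_contractions[OF C A cs] t by (simp add: card_image)
qed

section \<open>Prime ideals and derivations\<close>

lemma (in ideal) carrier_Quot: "carrier (R Quot I) = (+>) I ` carrier R"
  by (auto simp: FactRing_def A_RCOSETS_def')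

lemma (in deriv_ring) quotient_deriv:
  assumes "ideal I R" "\<delta> ` I \<subseteq> I"
  obtains \<delta>' where "deriv_ring (R Quot I) \<delta>'" "\<And>x. x \<in> carrier R \<Longrightarrow> \<delta>' (I +> x) = I +> \<delta> x"
proof -
  interpret I: ideal I R by fact
  interpret h: ring_hom_ring R "R Quot I" "(+>) I" by (rule I.rcos_ring_hom_ring)
  define \<delta>' where "\<delta>' X = I +> \<delta> (SOME x. x \<in> carrier R \<and> X = I +> x)" for X
  have eq: "\<delta>' (I +> x) = I +> \<delta> x" if x: "x \<in> carrier R" for x
  proof -
    define y where "y = (SOME y. y \<in> carrier R \<and> I +> x = I +> y)"
    have y: "y \<in> carrier R" "I +> x = I +> y"
      using someI[of "\<lambda>y. y \<in> carrier R \<and> I +> x = I +> y" x] x by (auto simp: y_def)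
    then have "x \<ominus> y \<in> I" using quotient_eq_iff_same_a_r_cos[OF assms(1) x] by simp
    then have "\<delta> (x \<ominus> y) \<in> I" using assms(2) by blast
    moreover have "\<delta> (x \<ominus> y) \<oplus> \<delta> y = \<delta> x"
      using d_add[of "x \<ominus> y" y] x y by (simp add: a_minus_def a_assoc l_neg)
    then have "\<delta> (x \<ominus> y) = \<delta> x \<ominus> \<delta> y" using x y
      by (metis a_minus_def add.inv_solve_right d_closed minus_closed)
    ultimately have "I +> \<delta> x = I +> \<delta> y"
      using quotient_eq_iff_same_a_r_cos[OF assms(1)] x y by simp
    then show ?thesis by (simp add: \<delta>'_def y_def)
  qed
  have "deriv_ring (R Quot I) \<delta>'"
  proof (intro deriv_ring.intro deriv_ring_axioms.intro I.quotient_is_ring)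
    show "derivation (R Quot I) \<delta>'"
      unfolding derivation_def I.carrier_Quot
      by (auto simp: eq d_add d_mult simp flip: h.hom_add h.hom_mult)
  qed
  then show ?thesis using eq that by blast
qed

lemma (in cring) ideal_subset_sum_PIdl:
  assumes "ideal Q R" "r \<in> carrier R"
  shows "Q \<subseteq> Q <+>\<^bsub>R\<^esub> PIdl r" "r \<in> Q <+>\<^bsub>R\<^esub> PIdl r"
proof -
  interpret Q: ideal Q R by fact
  have P: "\<zero> \<in> PIdl r" "r \<in> PIdl r"
    using ideal.axioms(1)[OF cgenideal_ideal[OF assms(2)]] cgenideal_self[OF assms(2)]
    by (auto simp: additive_subgroup.zero_closed)
  have "q \<oplus> p \<in> Q <+>\<^bsub>R\<^esub> PIdl r" if "q \<in> Q" "p \<in> PIdl r" for p q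
    using that unfolding set_add_def' by blast
  from this[OF _ P(1)] this[OF Q.zero_closed P(2)]
  show "Q \<subseteq> Q <+>\<^bsub>R\<^esub> PIdl r" and "r \<in> Q <+>\<^bsub>R\<^esub> PIdl r" using assms(2) by auto
qed

text \<open>Maximality gives the last conclusion, since Q enlarged by b contains a power of t. It
  says that R/Q is a G-domain with the class of t as witness.\<close>

lemma (in cring) exists_prime_avoiding:
  assumes J: "ideal J R" and t: "t \<in> carrier R" and tJ: "\<And>n::nat. t [^] n \<notin> J"
  obtains Q where "primeideal Q R" "J \<subseteq> Q" "t \<notin> Q"
    "\<And>b. b \<in> carrier R \<Longrightarrow> b \<notin> Q \<Longrightarrow> \<exists>n::nat. \<exists>r\<in>carrier R. r \<otimes> b \<ominus> t [^] n \<in> Q"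
proof -
  define S where "S = {I. ideal I R \<and> J \<subseteq> I \<and> (\<forall>n::nat. t [^] n \<notin> I)}"
  have "\<exists>M\<in>S. \<forall>X\<in>S. M \<subseteq> X \<longrightarrow> X = M"
  proof (rule subset_Zorn_nonempty)
    show "S \<noteq> {}" using J tJ by (auto simp: S_def)
    fix \<C> assume C: "\<C> \<noteq> {}" "subset.chain S \<C>"
    then have sub: "\<C> \<subseteq> S" and tot: "\<And>X Y. X \<in> \<C> \<Longrightarrow> Y \<in> \<C> \<Longrightarrow> X \<subseteq> Y \<or> Y \<subseteq> X"
      by (auto simp: subset.chain_def)
    have id: "ideal X R" if "X \<in> \<C>" for X using sub that by (auto simp: S_def)
    have "subset.chain {I. ideal I R} \<C>" using id tot by (auto simp: subset.chain_def)
    then have "ideal (\<Union>\<C>) R" using chain_Union_is_ideal[of \<C>] C(1) by simp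
    then show "\<Union>\<C> \<in> S" using sub C(1) by (auto simp: S_def)
  qed
  then obtain Q where Q: "Q \<in> S" and max: "\<And>X. X \<in> S \<Longrightarrow> Q \<subseteq> X \<Longrightarrow> X = Q" by blast
  interpret Q: ideal Q R using Q by (simp add: S_def)
  have tQ: "t [^] n \<notin> Q" for n :: nat using Q by (simp add: S_def)
  have G: "\<exists>n::nat. \<exists>r\<in>carrier R. r \<otimes> b \<ominus> t [^] n \<in> Q" if b: "b \<in> carrier R" "b \<notin> Q" for b
  proof -
    have id: "ideal (Q <+>\<^bsub>R\<^esub> PIdl b) R" by (rule add_ideals[OF Q.is_ideal cgenideal_ideal[OF b(1)]])
    note sub = ideal_subset_sum_PIdl[OF Q.is_ideal b(1)]
    have "Q <+>\<^bsub>R\<^esub> PIdl b \<noteq> Q" using sub(2) b by blast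
    then have "Q <+>\<^bsub>R\<^esub> PIdl b \<notin> S" using max sub(1) by blast
    then obtain n :: nat where "t [^] n \<in> Q <+>\<^bsub>R\<^esub> PIdl b"
      using id sub(1) Q by (auto simp: S_def)
    then obtain q r where q: "q \<in> Q" "r \<in> carrier R" "t [^] n = q \<oplus> r \<otimes> b"
      by (auto simp: set_add_def' cgenideal_def)
    have "r \<otimes> b \<ominus> t [^] n = \<ominus> q" unfolding q(3)
    proof -
      have "q \<in> carrier R" using q by simp
      then show "r \<otimes> b \<ominus> (q \<oplus> r \<otimes> b) = \<ominus> q" using q(2) b by algebra
    qed
    then show ?thesis using q by (metis Q.a_inv_closed)
  qed
  have "primeideal Q R"
  proof (rule primeidealI[OF Q.is_ideal is_cring])
    show "carrier R \<noteq> Q" using tQ[of 0] by auto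
    fix a b assume ab: "a \<in> carrier R" "b \<in> carrier R" "a \<otimes> b \<in> Q"
    show "a \<in> Q \<or> b \<in> Q"
    proof (rule ccontr)
      assume "\<not> ?thesis"
      then obtain n r m s where n: "r \<in> carrier R" "r \<otimes> a \<ominus> t [^] (n::nat) \<in> Q"
        "s \<in> carrier R" "s \<otimes> b \<ominus> t [^] (m::nat) \<in> Q" using G ab by metis
      define N where "N = t [^] n"
      define M where "M = t [^] m"
      have NM: "N \<in> carrier R" "M \<in> carrier R" using t by (auto simp: N_def M_def)
      \<comment> \<open>As r a and s b are congruent modulo Q to the powers N and M of t, this
        identity puts a power of t into Q.\<close>
      have "N \<otimes> M = (r \<otimes> s) \<otimes> (a \<otimes> b) \<ominus> (r \<otimes> a) \<otimes> (s \<otimes> b \<ominus> M) \<ominus> M \<otimes> (r \<otimes> a \<ominus> N)"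
        using NM n(1,3) ab by algebra
      also have "\<dots> \<in> Q"
        using n[folded N_def M_def] NM ab Q.I_l_closed unfolding a_minus_def
        by (intro Q.a_closed Q.a_inv_closed) auto
      finally show False using tQ[of "n + m"] t by (simp add: N_def M_def nat_pow_mult)
    qed
  qed
  then show ?thesis by (rule that) (use Q G tQ[of 1] t in \<open>auto simp: S_def\<close>)
qed

text \<open>In characteristic zero, the largest \<open>\<delta>\<close>-stable subset of a prime ideal is prime: modulo
  \<open>Q\<close>, the Leibniz formula leaves one term of \<open>\<delta>\<^sup>i\<^sup>+\<^sup>j(ab)\<close> if \<open>i\<close> and \<open>j\<close> are minimal
  with \<open>\<delta>\<^sup>i a \<notin> Q\<close> and \<open>\<delta>\<^sup>j b \<notin> Q\<close>.\<close>

definition delta_core :: "('a, 'x) ring_scheme \<Rightarrow> ('a \<Rightarrow> 'a) \<Rightarrow> 'a set \<Rightarrow> 'a set" where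
  "delta_core R \<delta> Q = {x \<in> carrier R. \<forall>i. (\<delta> ^^ i) x \<in> Q}"

section \<open>Iterated derivatives of products modulo an ideal\<close>

context deriv_ring
begin

lemma d_iter_closed [simp]: "x \<in> carrier R \<Longrightarrow> (\<delta> ^^ i) x \<in> carrier R"
  by (induction i) auto

lemma d_iter_add:
  "a \<in> carrier R \<Longrightarrow> b \<in> carrier R \<Longrightarrow> (\<delta> ^^ i) (a \<oplus> b) = (\<delta> ^^ i) a \<oplus> (\<delta> ^^ i) b"
  by (induction i) (auto simp: d_add)

lemma d_minus: "a \<in> carrier R \<Longrightarrow> \<delta> (\<ominus> a) = \<ominus> \<delta> a"
  using d_add[of "\<ominus> a" a] by (metis a_inv_closed d_closed d_zero l_neg minus_equality)

text \<open>Each Leibniz term of \<delta>^m(ab) has order below i on a or below j on b. Applying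
  \<delta> once and lowering i or j by one avoids binomial sums; truncated subtraction does no harm,
  since a zero bound only leaves the other one.\<close>

lemma leibniz_vanish:
  assumes "ideal Q R"
  shows "a \<in> carrier R \<Longrightarrow> b \<in> carrier R \<Longrightarrow> (\<And>k. k < i \<Longrightarrow> (\<delta> ^^ k) a \<in> Q) \<Longrightarrow>
    (\<And>k. k < j \<Longrightarrow> (\<delta> ^^ k) b \<in> Q) \<Longrightarrow> m < i + j \<Longrightarrow> (\<delta> ^^ m) (a \<otimes> b) \<in> Q"
proof (induction m arbitrary: a b i j)
  case 0
  interpret Q: ideal Q R by fact
  have "a \<in> Q \<or> b \<in> Q" using 0(3)[of 0] 0(4)[of 0] 0(5) by auto
  then show ?case using 0 Q.I_l_closed Q.I_r_closed by auto
next
  case (Suc m)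
  interpret Q: ideal Q R by fact
  have 1: "(\<delta> ^^ m) (\<delta> a \<otimes> b) \<in> Q"
  proof (rule Suc.IH[of _ _ "i - 1" j])
    fix k assume "k < i - 1"
    then show "(\<delta> ^^ k) (\<delta> a) \<in> Q" using Suc.prems(3)[of "Suc k"] by (simp add: funpow_swap1)
  qed (use Suc.prems in auto)
  have 2: "(\<delta> ^^ m) (a \<otimes> \<delta> b) \<in> Q"
  proof (rule Suc.IH[of _ _ i "j - 1"])
    fix k assume "k < j - 1"
    then show "(\<delta> ^^ k) (\<delta> b) \<in> Q" using Suc.prems(4)[of "Suc k"] by (simp add: funpow_swap1)
  qed (use Suc.prems in auto)
  show ?case
    using 1 2 Suc.prems by (simp add: funpow_Suc_right d_mult d_iter_add del: funpow.simps)
qed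

text \<open>Modulo Q only the term of order i on a and j on b survives. Its coefficient N arises by
  Pascal's rule, and only its positivity is recorded.\<close>

lemma leibniz_top:
  assumes "ideal Q R"
  shows "a \<in> carrier R \<Longrightarrow> b \<in> carrier R \<Longrightarrow> (\<And>k. k < i \<Longrightarrow> (\<delta> ^^ k) a \<in> Q) \<Longrightarrow>
    (\<And>k. k < j \<Longrightarrow> (\<delta> ^^ k) b \<in> Q) \<Longrightarrow> m = i + j \<Longrightarrow>
    \<exists>N::nat. N > 0 \<and> (\<delta> ^^ m) (a \<otimes> b) \<ominus> [N] \<cdot> ((\<delta> ^^ i) a \<otimes> (\<delta> ^^ j) b) \<in> Q"
proof (induction m arbitrary: a b i j)
  case 0
  interpret Q: ideal Q R by fact
  show ?case by (rule exI[of _ 1]) (use 0 in \<open>simp add: a_minus_def r_neg\<close>)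
next
  case (Suc m)
  interpret Q: ideal Q R by fact
  let ?X = "(\<delta> ^^ i) a \<otimes> (\<delta> ^^ j) b"
  have X: "?X \<in> carrier R" using Suc.prems by simp
  have a': "(\<delta> ^^ k) (\<delta> a) \<in> Q" if "k < i - 1" for k
    using Suc.prems(3)[of "Suc k"] that by (simp add: funpow_swap1)
  have b': "(\<delta> ^^ k) (\<delta> b) \<in> Q" if "k < j - 1" for k
    using Suc.prems(4)[of "Suc k"] that by (simp add: funpow_swap1)
  \<comment> \<open>For i = 0 this half vanishes modulo Q and N = 0 is chosen. As i + j is positive,
    one of the two halves still contributes a positive count.\<close>
  have 1: "\<exists>N::nat. (i > 0 \<longrightarrow> N > 0) \<and> (\<delta> ^^ m) (\<delta> a \<otimes> b) \<ominus> [N] \<cdot> ?X \<in> Q"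
  proof (cases i)
    case 0
    have "(\<delta> ^^ m) (\<delta> a \<otimes> b) \<in> Q"
      by (rule leibniz_vanish[OF assms, of _ _ 0 j]) (use Suc.prems 0 in auto)
    then show ?thesis using 0 Suc.prems by (intro exI[of _ 0]) (simp add: a_minus_def)
  next
    case k: (Suc k)
    have "\<exists>N::nat. N > 0 \<and> (\<delta> ^^ m) (\<delta> a \<otimes> b) \<ominus> [N] \<cdot> ((\<delta> ^^ k) (\<delta> a) \<otimes> (\<delta> ^^ j) b) \<in> Q"
      by (rule Suc.IH) (use Suc.prems a' k in auto)
    then show ?thesis using k by (simp add: funpow_swap1)
  qed
  have 2: "\<exists>N::nat. (j > 0 \<longrightarrow> N > 0) \<and> (\<delta> ^^ m) (a \<otimes> \<delta> b) \<ominus> [N] \<cdot> ?X \<in> Q"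
  proof (cases j)
    case 0
    have "(\<delta> ^^ m) (a \<otimes> \<delta> b) \<in> Q"
      by (rule leibniz_vanish[OF assms, of _ _ i 0]) (use Suc.prems 0 in auto)
    then show ?thesis using 0 Suc.prems by (intro exI[of _ 0]) (simp add: a_minus_def)
  next
    case k: (Suc k)
    have "\<exists>N::nat. N > 0 \<and> (\<delta> ^^ m) (a \<otimes> \<delta> b) \<ominus> [N] \<cdot> ((\<delta> ^^ i) a \<otimes> (\<delta> ^^ k) (\<delta> b)) \<in> Q"
      by (rule Suc.IH) (use Suc.prems b' k in auto)
    then show ?thesis using k by (simp add: funpow_swap1)
  qed
  obtain N1 N2 :: nat where N: "i > 0 \<longrightarrow> N1 > 0" "j > 0 \<longrightarrow> N2 > 0"
    "(\<delta> ^^ m) (\<delta> a \<otimes> b) \<ominus> [N1] \<cdot> ?X \<in> Q" "(\<delta> ^^ m) (a \<otimes> \<delta> b) \<ominus> [N2] \<cdot> ?X \<in> Q"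
    using 1 2 by blast
  define Y where "Y = (\<delta> ^^ m) (\<delta> a \<otimes> b)"
  define Z where "Z = (\<delta> ^^ m) (a \<otimes> \<delta> b)"
  have YZ: "Y \<in> carrier R" "Z \<in> carrier R" "[N1] \<cdot> ?X \<in> carrier R" "[N2] \<cdot> ?X \<in> carrier R"
    using Suc.prems X by (auto simp: Y_def Z_def)
  have "(\<delta> ^^ Suc m) (a \<otimes> b) \<ominus> [(N1 + N2)] \<cdot> ?X = (Y \<ominus> [N1] \<cdot> ?X) \<oplus> (Z \<ominus> [N2] \<cdot> ?X)"
  proof -
    have "[(N1 + N2)] \<cdot> ?X = [N1] \<cdot> ?X \<oplus> [N2] \<cdot> ?X" using X by (simp add: add.nat_pow_mult)
    moreover have "(\<delta> ^^ Suc m) (a \<otimes> b) = Y \<oplus> Z"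
      using Suc.prems(1,2)
      by (simp add: funpow_Suc_right d_mult d_iter_add Y_def Z_def del: funpow.simps)
    ultimately show ?thesis using YZ by (simp add: a_minus_def minus_add a_ac)
  qed
  also have "\<dots> \<in> Q"
    using N(3,4)[folded Y_def Z_def] by (rule additive_subgroup.a_closed[OF Q.is_additive_subgroup])
  finally show ?case using N Suc.prems(5) by (intro exI[of _ "N1 + N2"]) auto
qed

lemma delta_core_ideal:
  assumes "ideal Q R"
  shows "delta_ideal R \<delta> (delta_core R \<delta> Q)"
proof -
  interpret Q: ideal Q R by fact
  have m: "(\<delta> ^^ i) (a \<otimes> b) \<in> Q" if "a \<in> carrier R" "b \<in> delta_core R \<delta> Q" for i a b
    by (rule leibniz_vanish[OF assms, of a b 0 "Suc i"]) (use that in \<open>auto simp: delta_core_def\<close>)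
  have m': "(\<delta> ^^ i) (b \<otimes> a) \<in> Q" if "a \<in> carrier R" "b \<in> delta_core R \<delta> Q" for i a b
    by (rule leibniz_vanish[OF assms, of b a "Suc i" 0]) (use that in \<open>auto simp: delta_core_def\<close>)
  have "ideal (delta_core R \<delta> Q) R"
  proof (rule idealI)
    show "ring R" ..
    have z: "\<zero> \<in> delta_core R \<delta> Q"
    proof -
      have "(\<delta> ^^ i) \<zero> = \<zero>" for i by (induction i) auto
      then show ?thesis by (simp add: delta_core_def)
    qed
    show "subgroup (delta_core R \<delta> Q) (add_monoid R)"
    proof (rule add.subgroupI)
      show "delta_core R \<delta> Q \<noteq> {}" using z by blast
      fix a assume a: "a \<in> delta_core R \<delta> Q"
      have "\<ominus> a = \<ominus> \<one> \<otimes> a" using a by (simp add: delta_core_def l_minus)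
      then show "\<ominus> a \<in> delta_core R \<delta> Q"
        using m[of "\<ominus> \<one>" a] a by (simp add: delta_core_def)
    qed (auto simp: delta_core_def d_iter_add)
  qed (use m m' in \<open>auto simp: delta_core_def\<close>)
  moreover have "\<delta> x \<in> delta_core R \<delta> Q" if "x \<in> delta_core R \<delta> Q" for x
  proof -
    have "(\<delta> ^^ i) (\<delta> x) = (\<delta> ^^ Suc i) x" for i by (simp add: funpow_swap1)
    then show ?thesis using that unfolding delta_core_def by (simp del: funpow.simps)
  qed
  ultimately show ?thesis by (auto simp: delta_ideal_def)
qed

lemma delta_core_subset: "delta_core R \<delta> Q \<subseteq> Q"
  by (auto simp: delta_core_def dest: spec[of _ 0])

lemma delta_ideal_core:
  assumes "delta_ideal R \<delta> J" "J \<subseteq> Q"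
  shows "J \<subseteq> delta_core R \<delta> Q"
proof
  fix x assume x: "x \<in> J"
  have "(\<delta> ^^ i) x \<in> J" for i
    using x assms(1) by (induction i) (auto simp: delta_ideal_def)
  then show "x \<in> delta_core R \<delta> Q"
    using assms x ideal.Icarr by (fastforce simp: delta_core_def delta_ideal_def)
qed

lemma delta_core_prime:
  assumes Q: "primeideal Q R" and char: "\<And>n::nat. n > 0 \<Longrightarrow> [n] \<cdot> \<one> \<notin> Q"
  shows "primeideal (delta_core R \<delta> Q) R"
proof -
  interpret Q: primeideal Q R by fact
  show ?thesis
  proof (rule primeidealI)
    show "ideal (delta_core R \<delta> Q) R"
      using delta_core_ideal[OF Q.is_ideal] by (simp add: delta_ideal_def)
    show "cring R" by (rule Q.is_cring)
    show "carrier R \<noteq> delta_core R \<delta> Q"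
      using delta_core_subset Q.I_notcarr Q.a_subset by blast
    fix a b assume ab: "a \<in> carrier R" "b \<in> carrier R" "a \<otimes> b \<in> delta_core R \<delta> Q"
    show "a \<in> delta_core R \<delta> Q \<or> b \<in> delta_core R \<delta> Q"
    proof (rule ccontr)
      assume n: "\<not> ?thesis"
      define i where "i = (LEAST i. (\<delta> ^^ i) a \<notin> Q)"
      define j where "j = (LEAST j. (\<delta> ^^ j) b \<notin> Q)"
      have i: "(\<delta> ^^ i) a \<notin> Q" and j: "(\<delta> ^^ j) b \<notin> Q"
        unfolding i_def j_def using n ab
        by (auto simp: delta_core_def intro!: LeastI_ex[of "\<lambda>i. (\<delta> ^^ i) _ \<notin> Q"])
      have i': "(\<delta> ^^ k) a \<in> Q" if "k < i" for k using not_less_Least that i_def by blast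
      have j': "(\<delta> ^^ k) b \<in> Q" if "k < j" for k using not_less_Least that j_def by blast
      let ?X = "(\<delta> ^^ i) a \<otimes> (\<delta> ^^ j) b"
      obtain N :: nat where N: "N > 0" "(\<delta> ^^ (i + j)) (a \<otimes> b) \<ominus> [N] \<cdot> ?X \<in> Q"
        using leibniz_top[OF Q.is_ideal ab(1,2) i' j' refl] by blast
      have X: "?X \<in> carrier R" "[N] \<cdot> ?X \<in> carrier R" using ab by auto
      have d: "(\<delta> ^^ (i + j)) (a \<otimes> b) \<in> Q" using ab(3) by (simp add: delta_core_def)
      then have dc: "(\<delta> ^^ (i + j)) (a \<otimes> b) \<in> carrier R" by (rule Q.Icarr)
      have "[N] \<cdot> ?X = (\<delta> ^^ (i + j)) (a \<otimes> b) \<ominus> ((\<delta> ^^ (i + j)) (a \<otimes> b) \<ominus> [N] \<cdot> ?X)"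
        using X dc by (simp add: a_minus_def minus_add a_assoc[symmetric] r_neg)
      also have "\<dots> \<in> Q" using d N(2) unfolding a_minus_def
        by (meson additive_subgroup.a_closed additive_subgroup.a_inv_closed Q.is_additive_subgroup)
      finally have "[N] \<cdot> \<one> \<otimes> ?X \<in> Q" using X by (simp add: add_pow_ldistr)
      then have "[N] \<cdot> \<one> \<in> Q \<or> ?X \<in> Q" using X(1) Q.I_prime[of "[N] \<cdot> \<one>" ?X] by simp
      then show False using Q.I_prime[of "(\<delta> ^^ i) a" "(\<delta> ^^ j) b"] i j char N(1) ab by auto
    qed
  qed
qed

end

section \<open>Affine algebras with a derivation\<close>

lemma (in cring) sum_PIdl_one:
  assumes "ideal Q R" "r \<in> carrier R" "\<one> \<in> Q <+>\<^bsub>R\<^esub> PIdl r"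
  shows "\<exists>s\<in>carrier R. s \<otimes> r \<ominus> \<one> \<in> Q"
proof -
  interpret Q: ideal Q R by fact
  obtain q s where q: "q \<in> Q" "s \<in> carrier R" "\<one> = q \<oplus> s \<otimes> r"
    using assms(3) by (auto simp: set_add_def' cgenideal_def)
  have "q \<in> carrier R" using q by simp
  then have "s \<otimes> r \<ominus> (q \<oplus> s \<otimes> r) = \<ominus> q" using q(2) assms(2) by algebra
  then have "s \<otimes> r \<ominus> \<one> = \<ominus> q" using q(3) by simp
  then show ?thesis using q by (metis Q.a_inv_closed)
qed

lemma (in cring) maximalideal_inverse:
  assumes "maximalideal M R" "r \<in> carrier R" "r \<notin> M"
  shows "\<exists>s\<in>carrier R. s \<otimes> r \<ominus> \<one> \<in> M"
proof -
  interpret M: maximalideal M R by fact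
  have id: "ideal (M <+>\<^bsub>R\<^esub> PIdl r) R"
    by (rule add_ideals[OF M.is_ideal cgenideal_ideal[OF assms(2)]])
  note sub = ideal_subset_sum_PIdl[OF M.is_ideal assms(2)]
  have "M <+>\<^bsub>R\<^esub> PIdl r \<subseteq> carrier R" using id by (meson ideal.Icarr subsetI)
  then have "M <+>\<^bsub>R\<^esub> PIdl r = carrier R"
    using M.I_maximal[OF id sub(1)] sub(2) assms(3) by auto
  then show ?thesis using sum_PIdl_one[OF M.is_ideal assms(2)] by simp
qed

text \<open>The field is replaced by its image A in R, so that subrings, quotients and derivations
  all live in one ring. Positive integers are required to be units, not just nonzero, so that they
  survive modulo every prime.\<close>

locale affine_deriv = cring R + deriv_ring R \<delta> for R (structure) and \<delta> +
  fixes A :: "'a set" and cs :: "'a list"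
  assumes base: "subring A R" and gens: "set cs \<subseteq> carrier R" "tower R A cs = carrier R"
    and base_Units: "A - {\<zero>} \<subseteq> Units R"
    and char_Units: "\<And>n::nat. n > 0 \<Longrightarrow> [n] \<cdot> \<one> \<in> Units R"
    and d_base: "\<And>a. a \<in> A \<Longrightarrow> \<delta> a = \<zero>"
begin

lemma char_notin:
  assumes "primeideal Q R" "n > 0" shows "[(n::nat)] \<cdot> \<one> \<notin> Q"
proof
  assume Q: "[n] \<cdot> \<one> \<in> Q"
  interpret Q: primeideal Q R by fact
  have "inv ([n] \<cdot> \<one>) \<otimes> [n] \<cdot> \<one> \<in> Q"
    using char_Units[OF assms(2)] Q by (intro Q.I_l_closed) auto
  then have "\<one> \<in> Q" using char_Units[OF assms(2)] by simp
  then show False using Q.one_imp_carrier Q.I_notcarr by auto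
qed

text \<open>This plays the part of Zariski's lemma, with \<open>\<delta>\<close> as a witness of transcendence.\<close>

lemma G_prime_deriv:
  assumes Q: "primeideal Q R" "\<delta> ` Q \<subseteq> Q" and t: "t \<in> carrier R" "t \<notin> Q"
    and G: "\<And>b. b \<in> carrier R \<Longrightarrow> b \<notin> Q \<Longrightarrow> \<exists>n::nat. \<exists>r\<in>carrier R. r \<otimes> b \<ominus> t [^] n \<in> Q"
  shows "\<delta> ` carrier R \<subseteq> Q"
proof -
  interpret Q: primeideal Q R by fact
  interpret h: ring_hom_cring R "R Quot Q" "(+>) Q" by (rule Q.rcos_ring_hom_cring)
  interpret D: domain "R Quot Q" by (rule Q.quotient_is_domain)
  obtain \<delta>' where \<delta>': "deriv_ring (R Quot Q) \<delta>'" "\<And>x. x \<in> carrier R \<Longrightarrow> \<delta>' (Q +> x) = Q +> \<delta> x"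
    using quotient_deriv[OF Q.is_ideal Q(2)] by blast
  have sub: "subring ((+>) Q ` A) (R Quot Q)"
    by (rule ring_hom_ring.img_is_subring[OF Q.rcos_ring_hom_ring base])
  have A: "A \<subseteq> carrier R" using base by (rule subringE(1))
  have zero: "\<delta>' a = \<zero>\<^bsub>R Quot Q\<^esub>" if "a \<in> (+>) Q ` A" for a
    using that A \<delta>'(2) d_base by auto
  have nat: "[n] \<cdot>\<^bsub>R Quot Q\<^esub> \<one>\<^bsub>R Quot Q\<^esub> = Q +> [n] \<cdot> \<one>" for n :: nat
    by (induction n) auto
  have char: "[n] \<cdot>\<^bsub>R Quot Q\<^esub> \<one>\<^bsub>R Quot Q\<^esub> \<noteq> \<zero>\<^bsub>R Quot Q\<^esub>" if "n > 0" for n :: nat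
    unfolding nat using Q.rcos_zero_iff[of "[n] \<cdot> \<one>"] char_notin[OF Q(1) that] by simp
  have carr: "tower (R Quot Q) ((+>) Q ` A) (map ((+>) Q) cs) = (+>) Q ` carrier R"
    using hom_tower[OF base gens(1) h.ring_hom_cring_axioms] gens(2) by simp
  have cs: "set (map ((+>) Q) cs) \<subseteq> carrier (R Quot Q)"
    using gens(1) by auto
  have GD: "G_domain (R Quot Q) (tower (R Quot Q) ((+>) Q ` A) (map ((+>) Q) cs))"
    unfolding G_domain_def carr
  proof (intro bexI[of _ "Q +> t"] conjI ballI impI)
    show "Q +> t \<noteq> \<zero>\<^bsub>R Quot Q\<^esub>" using t Q.rcos_zero_iff by simp
    fix b' assume "b' \<in> (+>) Q ` carrier R" "b' \<noteq> \<zero>\<^bsub>R Quot Q\<^esub>"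
    then obtain b where b: "b \<in> carrier R" "b \<notin> Q" "b' = Q +> b" using Q.rcos_zero_iff by auto
    obtain n r where r: "r \<in> carrier R" "r \<otimes> b \<ominus> t [^] (n::nat) \<in> Q" using G b by blast
    have "Q +> r \<otimes> b = Q +> t [^] n"
      using quotient_eq_iff_same_a_r_cos[OF Q.is_ideal, of "r \<otimes> b" "t [^] n"] r b t by simp
    then have "(Q +> r) \<otimes>\<^bsub>R Quot Q\<^esub> b' = (Q +> t) [^]\<^bsub>R Quot Q\<^esub> n"
      using r b t by simp
    then show "\<exists>n::nat. \<exists>r\<in>(+>) Q ` carrier R. r \<otimes>\<^bsub>R Quot Q\<^esub> b' = (Q +> t) [^]\<^bsub>R Quot Q\<^esub> n"
      using r(1) by blast
  qed (use t in blast)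
  show ?thesis
  proof
    fix y assume "y \<in> \<delta> ` carrier R"
    then obtain x where x: "x \<in> carrier R" "y = \<delta> x" by blast
    have "Q +> x \<in> tower (R Quot Q) ((+>) Q ` A) (map ((+>) Q) cs)" using carr x by blast
    from D.G_domain_deriv_zero[OF \<delta>'(1) sub zero char cs GD this]
    have "\<delta>' (Q +> x) = \<zero>\<^bsub>R Quot Q\<^esub>" .
    then show "y \<in> Q" using \<delta>'(2)[OF x(1)] x Q.rcos_zero_iff by simp
  qed
qed

text \<open>The field R/M is a G-domain with witness 1, so the derivation induced on it
  vanishes.\<close>

lemma maximal_deriv:
  assumes "maximalideal M R" "\<delta> ` M \<subseteq> M"
  shows "\<delta> ` carrier R \<subseteq> M"
proof (rule G_prime_deriv[OF _ assms(2), of \<one>])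
  show "primeideal M R" by (rule maximalideal_prime[OF assms(1)])
  then show "\<one> \<notin> M"
    using ideal.one_imp_carrier primeideal.I_notcarr primeideal.axioms(1) by metis
  show "\<exists>n::nat. \<exists>r\<in>carrier R. r \<otimes> b \<ominus> \<one> [^] n \<in> M" if "b \<in> carrier R" "b \<notin> M" for b
    using maximalideal_inverse[OF assms(1) that] by simp
qed simp

text \<open>The last two conclusions are the forms in which Q is used later: inverses modulo Q make
  S Q a maximal left ideal, and the absence of larger \<delta>-ideals inside Q gives
  essentiality.\<close>

lemma exists_unstable_maximal:
  assumes P: "primeideal P R" "delta_ideal R \<delta> P"
    and dim: "\<And>Q1 Q2. primeideal Q1 R \<Longrightarrow> primeideal Q2 R \<Longrightarrow> P \<subset> Q1 \<Longrightarrow> \<not> Q1 \<subset> Q2"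
    and nonzero: "\<not> \<delta> ` carrier R \<subseteq> P"
  obtains Q where "primeideal Q R" "P \<subseteq> Q" "\<not> \<delta> ` Q \<subseteq> Q"
    "\<And>r. r \<in> carrier R \<Longrightarrow> r \<notin> Q \<Longrightarrow> \<exists>s\<in>carrier R. s \<otimes> r \<ominus> \<one> \<in> Q"
    "\<And>J. delta_ideal R \<delta> J \<Longrightarrow> P \<subset> J \<Longrightarrow> \<not> J \<subseteq> Q"
proof -
  interpret P: primeideal P R by fact
  obtain x where x: "x \<in> carrier R" "\<delta> x \<notin> P" using nonzero by blast
  have "\<delta> x [^] n \<notin> P" for n :: nat
  proof (induction n)
    case 0
    then show ?case using P.one_imp_carrier P.I_notcarr by auto
  next
    case (Suc n)
    then show ?case using P.I_prime[of "\<delta> x [^] n" "\<delta> x"] x by auto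
  qed
  then obtain Q where Q: "primeideal Q R" "P \<subseteq> Q" "\<delta> x \<notin> Q"
    and G: "\<And>b. b \<in> carrier R \<Longrightarrow> b \<notin> Q \<Longrightarrow>
      \<exists>n::nat. \<exists>r\<in>carrier R. r \<otimes> b \<ominus> \<delta> x [^] n \<in> Q"
    using exists_prime_avoiding[OF P.is_ideal d_closed[OF x(1)]] by blast
  interpret Q: primeideal Q R by fact
  have unstable: "\<not> \<delta> ` Q \<subseteq> Q"
    using G_prime_deriv[OF Q(1) _ d_closed[OF x(1)] Q(3) G] x Q(3) by blast
  then have PQ: "P \<subset> Q" using P(2) Q(2) by (auto simp: delta_ideal_def)
  have inverse: "\<exists>s\<in>carrier R. s \<otimes> r \<ominus> \<one> \<in> Q" if r: "r \<in> carrier R" "r \<notin> Q" for r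
  proof (rule sum_PIdl_one[OF Q.is_ideal r(1)], rule ccontr)
    assume n: "\<one> \<notin> Q <+>\<^bsub>R\<^esub> PIdl r"
    have "ideal (Q <+>\<^bsub>R\<^esub> PIdl r) R" by (rule add_ideals[OF Q.is_ideal cgenideal_ideal[OF r(1)]])
    then obtain Q2 where Q2: "primeideal Q2 R" "Q <+>\<^bsub>R\<^esub> PIdl r \<subseteq> Q2"
      by (rule exists_prime_avoiding[of _ \<one>]) (use n in auto)
    \<comment> \<open>An r without inverse modulo Q would yield a prime \<open>Q2\<close> with P, Q,
      \<open>Q2\<close> strictly increasing.\<close>
    then have "Q \<subset> Q2" using ideal_subset_sum_PIdl[OF Q.is_ideal r(1)] r(2) by blast
    then show False using dim[OF Q(1) Q2(1) PQ] by simp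
  qed
  have core: "\<not> J \<subseteq> Q" if J: "delta_ideal R \<delta> J" "P \<subset> J" for J
  proof
    assume "J \<subseteq> Q"
    then have "J \<subseteq> delta_core R \<delta> Q" by (rule delta_ideal_core[OF J(1)])
    \<comment> \<open>The core contains J, hence is strictly above P, and it is strictly below Q
      because Q is not stable; being prime, it is excluded by \<open>dim\<close>.\<close>
    moreover have "delta_core R \<delta> Q \<noteq> Q"
      using unstable delta_core_ideal[OF Q.is_ideal] by (auto simp: delta_ideal_def)
    moreover have "primeideal (delta_core R \<delta> Q) R"
      by (rule delta_core_prime[OF Q(1) char_notin[OF Q(1)]])
    ultimately show False using dim[OF _ Q(1)] J(2) delta_core_subset[of Q] by blast
  qed
  show ?thesis by (rule that[OF Q(1,2) unstable inverse core])
qed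

text \<open>Chain lengths are bounded, so a longest chain ending at P exists, of length m say.
  Prolonging it by Q1 and Q2 would give m + 2 \<le> height + 1 \<le> m + 1.\<close>

lemma no_longer_chain:
  assumes P: "primeideal P R" and h: "height R P + 1 = krull_dim R"
    and Q: "primeideal Q1 R" "primeideal Q2 R" "P \<subset> Q1" "Q1 \<subset> Q2"
  shows False
proof -
  define S where "S = {n. \<exists>C. prime_chain R n C \<and> C n = P}"
  have bound: "n < 2 ^ length cs" if "n \<in> S" for n
    using that prime_chain_bound[OF _ base gens base_Units] by (auto simp: S_def)
  then have fin: "finite S" by (meson finite_nat_set_iff_bounded)
  have "0 \<in> S" using P by (auto simp: S_def prime_chain_def intro!: exI[of _ "\<lambda>_. P"])
  then have mS: "Max S \<in> S" using fin by (intro Max_in) auto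
  define m where "m = Max S"
  have "height R P \<le> enat m"
    unfolding height_def
  proof (rule Sup_least)
    fix x assume "x \<in> {enat n |n. \<exists>C. prime_chain R n C \<and> C n = P}"
    then obtain n where "x = enat n" "n \<in> S" by (auto simp: S_def)
    then show "x \<le> enat m" using Max_ge[OF fin] by (simp add: m_def)
  qed
  obtain C where C: "prime_chain R m C" "C m = P" using mS by (auto simp: S_def m_def)
  define C' where "C' i = (if i \<le> m then C i else if i = Suc m then Q1 else Q2)" for i
  have "prime_chain R (m + 2) C'"
    unfolding prime_chain_def
  proof (intro conjI allI impI)
    fix i show "primeideal (C' i) R" if "i \<le> m + 2"
      using C Q by (auto simp: C'_def prime_chain_def)
    show "C' i \<subset> C' (Suc i)" if "i < m + 2"
    proof -
      consider "i < m" | "i = m" | "i = Suc m" using \<open>i < m + 2\<close> by linarith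
      then show ?thesis
        using C Q by cases (auto simp: C'_def prime_chain_def)
    qed
  qed
  then have "enat (m + 2) \<le> krull_dim R"
    unfolding krull_dim_def by (intro Sup_upper) blast
  also have "\<dots> \<le> enat m + 1"
    unfolding h[symmetric] using \<open>height R P \<le> enat m\<close> by (rule add_right_mono)
  also have "\<dots> = enat (m + 1)" by (simp add: one_enat_def)
  finally show False by simp
qed

end

section \<open>Left ideals and cyclic modules\<close>

definition left_ideal :: "('s, 'x) ring_scheme \<Rightarrow> 's set \<Rightarrow> bool" where
  "left_ideal S I \<longleftrightarrow> additive_subgroup I S \<and> (\<forall>s\<in>carrier S. \<forall>x\<in>I. s \<otimes>\<^bsub>S\<^esub> x \<in> I)"

text \<open>The scalar action unites the cosets of s x over all x in X, so no representative has to
  be chosen.\<close>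

definition quot_module :: "('s, 'x) ring_scheme \<Rightarrow> 's set \<Rightarrow> ('s, 's set) module" where
  "quot_module S I =
    \<lparr>carrier = (+>\<^bsub>S\<^esub>) I ` carrier S, monoid.mult = undefined, one = undefined, zero = I,
     add = (<+>\<^bsub>S\<^esub>), smult = (\<lambda>s X. \<Union>x\<in>X. I +>\<^bsub>S\<^esub> (s \<otimes>\<^bsub>S\<^esub> x))\<rparr>"

locale left_quotient = ring S for S (structure) +
  fixes I
  assumes left_ideal: "left_ideal S I"
begin

sublocale I: additive_subgroup I S
  using left_ideal by (simp add: left_ideal_def)

sublocale I: abelian_subgroup I S
  by (rule abelian_subgroupI3) (simp_all add: I.additive_subgroup_axioms abelian_group_axioms)

abbreviation "E \<equiv> quot_module S I"
abbreviation "q \<equiv> (+>) I"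

lemma l_mult: "s \<in> carrier S \<Longrightarrow> x \<in> I \<Longrightarrow> s \<otimes> x \<in> I"
  using left_ideal by (simp add: left_ideal_def)

lemma q_eq_iff:
  assumes "x \<in> carrier S" "y \<in> carrier S"
  shows "q x = q y \<longleftrightarrow> x \<ominus> y \<in> I"
proof -
  have "q x = q y \<longleftrightarrow> x \<in> q y"
    using I.a_rcos_self[OF assms(1)] I.a_repr_independence'[OF _ assms(2), of x] by auto
  then show ?thesis using I.a_rcos_module_minus[OF ring_axioms assms(2,1)] by simp
qed

lemma q_zero_iff: "x \<in> carrier S \<Longrightarrow> q x = I \<longleftrightarrow> x \<in> I"
  using I.a_rcos_self I.a_rcos_const by blast

lemma q_carrier: "carrier E = q ` carrier S"
  by (simp add: quot_module_def)

lemma q_zero: "\<zero>\<^bsub>E\<^esub> = q \<zero>"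
  using q_zero_iff[of \<zero>] by (simp add: quot_module_def)

lemma q_add: "x \<in> carrier S \<Longrightarrow> y \<in> carrier S \<Longrightarrow> q x \<oplus>\<^bsub>E\<^esub> q y = q (x \<oplus> y)"
  by (simp add: quot_module_def I.a_rcos_sum)

lemma q_smult:
  assumes "s \<in> carrier S" "x \<in> carrier S"
  shows "s \<odot>\<^bsub>E\<^esub> q x = q (s \<otimes> x)"
proof -
  have "q (s \<otimes> y) = q (s \<otimes> x)" if "y \<in> q x" for y
  proof -
    have y: "y \<in> carrier S" "y \<ominus> x \<in> I"
      using that assms I.a_rcos_module_minus[OF ring_axioms] I.a_elemrcos_carrier by blast+
    have "s \<otimes> y \<ominus> s \<otimes> x = s \<otimes> (y \<ominus> x)"
      using y(1) assms by (simp add: a_minus_def r_distr r_minus)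
    then show ?thesis using q_eq_iff y assms l_mult by simp
  qed
  then have "(\<Union>y\<in>q x. q (s \<otimes> y)) = (\<Union>y\<in>q x. q (s \<otimes> x))" by (rule SUP_cong[OF refl])
  also have "\<dots> = q (s \<otimes> x)" using I.a_rcos_self[OF assms(2)] by blast
  finally show ?thesis by (simp add: quot_module_def)
qed

lemma quot_left_module: "left_module S E"
proof (intro left_module.intro left_module_axioms.intro ring_axioms)
  show "abelian_group E"
  proof (rule abelian_groupI)
    fix x assume "x \<in> carrier E"
    then obtain a where a: "a \<in> carrier S" "x = q a" by (auto simp: q_carrier)
    show "\<exists>y\<in>carrier E. y \<oplus>\<^bsub>E\<^esub> x = \<zero>\<^bsub>E\<^esub>"
      using a by (intro bexI[of _ "q (\<ominus> a)"]) (auto simp: q_add q_zero q_carrier l_neg)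
  qed (auto simp: q_carrier q_add q_zero a_ac)
qed (auto simp: q_carrier q_add q_smult l_distr r_distr m_assoc)

lemma quot_cyclic: "cyclic_module S E"
  unfolding cyclic_module_def
  by (rule bexI[of _ "q \<one>"]) (auto simp: q_carrier q_smult)

sublocale E: left_module S E by (rule quot_left_module)

lemma q_minus: "x \<in> carrier S \<Longrightarrow> \<ominus>\<^bsub>E\<^esub> q x = q (\<ominus> x)"
  by (rule E.E.minus_equality) (auto simp: q_add q_zero q_carrier l_neg)

lemma submodule_image:
  assumes "left_ideal S N"
  shows "submodule (q ` N) S E"
proof -
  interpret N: additive_subgroup N S using assms by (simp add: left_ideal_def)
  have [simp]: "x \<in> N \<Longrightarrow> x \<in> carrier S" for x using N.a_subset by blast
  have m: "s \<in> carrier S \<Longrightarrow> x \<in> N \<Longrightarrow> s \<otimes> x \<in> N" for s x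
    using assms by (simp add: left_ideal_def)
  show ?thesis
  proof (intro submodule.intro submodule_axioms.intro)
    show "subgroup (q ` N) (add_monoid E)"
    proof (rule E.E.add.subgroupI)
      show "q ` N \<noteq> {}" using N.zero_closed by blast
      show "\<ominus>\<^bsub>E\<^esub> x \<in> q ` N" if "x \<in> q ` N" for x
        using that by (auto simp: q_minus)
    qed (auto simp: q_carrier q_add)
  qed (auto simp: q_smult m)
qed

lemma submodule_vimage:
  assumes "submodule N S E"
  shows "left_ideal S {x \<in> carrier S. q x \<in> N}" "I \<subseteq> {x \<in> carrier S. q x \<in> N}"
    "N = q ` {x \<in> carrier S. q x \<in> N}"
proof -
  interpret N: submodule N S E by fact
  have z: "q \<zero> \<in> N" using N.one_closed by (simp add: q_zero)
  have a: "q (x \<oplus> y) \<in> N" if "x \<in> carrier S" "y \<in> carrier S" "q x \<in> N" "q y \<in> N" for x y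
    using N.m_closed[OF that(3,4)] q_add[OF that(1,2)] by simp
  have s: "q (s \<otimes> x) \<in> N" if "s \<in> carrier S" "x \<in> carrier S" "q x \<in> N" for s x
    using N.smult_closed[of s "q x"] that q_smult by simp
  have sub: "N \<subseteq> q ` carrier S" using N.subset by (simp add: q_carrier)
  show "left_ideal S {x \<in> carrier S. q x \<in> N}"
    unfolding left_ideal_def
  proof (intro conjI ballI additive_subgroup.intro)
    show "subgroup {x \<in> carrier S. q x \<in> N} (add_monoid S)"
    proof (rule add.subgroupI)
      show "{x \<in> carrier S. q x \<in> N} \<noteq> {}" using z by blast
      fix x assume x: "x \<in> {x \<in> carrier S. q x \<in> N}"
      have "\<ominus> x = \<ominus> \<one> \<otimes> x" using x by (simp add: l_minus)
      then show "\<ominus> x \<in> {x \<in> carrier S. q x \<in> N}" using x s[of "\<ominus> \<one>" x] by simp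
    qed (use a in simp_all)
  qed (use s in simp)
  show "I \<subseteq> {x \<in> carrier S. q x \<in> N}"
  proof
    fix x assume "x \<in> I"
    then have "x \<in> carrier S" "q x = q \<zero>"
      using I.a_subset q_zero_iff[of x] q_zero_iff[of \<zero>] I.zero_closed by (blast, simp)
    then show "x \<in> {x \<in> carrier S. q x \<in> N}" using z by simp
  qed
  show "N = q ` {x \<in> carrier S. q x \<in> N}" using sub by blast
qed

lemma q_image_vimage:
  assumes "left_ideal S N" "I \<subseteq> N"
  shows "{x \<in> carrier S. q x \<in> q ` N} = N"
proof -
  interpret N: additive_subgroup N S using assms by (simp add: left_ideal_def)
  have "x \<in> N" if "x \<in> carrier S" "q x = q y" "y \<in> N" for x y
  proof -
    have y: "y \<in> carrier S" using that N.a_subset by blast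
    have "x \<ominus> y \<in> N" using that q_eq_iff[OF _ y] assms(2) by blast
    then have "x \<ominus> y \<oplus> y \<in> N" using that(3) by simp
    then show ?thesis using that(1) y by (simp add: a_minus_def a_assoc l_neg)
  qed
  then show ?thesis using N.a_subset by blast
qed

end

text \<open>Submodules of S/I correspond to left ideals above I, which frees the rest of the
  argument from cosets: a submodule is nonzero when its left ideal exceeds I, and two submodules
  meet when the intersection of their left ideals is not absorbed by I.\<close>

lemma diamond_left_ideals:
  fixes S :: "'s ring" (structure)
  assumes S: "ring S" "diamond S" and I: "left_ideal S I" and V: "left_ideal S V" "I \<subset> V"
    and simple: "\<And>N. left_ideal S N \<Longrightarrow> I \<subseteq> N \<Longrightarrow> N \<subseteq> V \<Longrightarrow> N = I \<or> N = V"
    and essential: "\<And>N. left_ideal S N \<Longrightarrow> I \<subset> N \<Longrightarrow> \<not> N \<inter> V \<subseteq> I"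
    and chain: "\<And>k. left_ideal S (N k)" "\<And>k. I \<subseteq> N k" "\<And>k. N (Suc k) \<subseteq> N k"
  shows "\<exists>k. \<forall>m\<ge>k. N m = N k"
proof -
  interpret left_quotient S I using S(1) I by (simp add: left_quotient_def left_quotient_axioms_def)
  have qI: "q ` I = {\<zero>\<^bsub>E\<^esub>}"
  proof -
    have "q x = \<zero>\<^bsub>E\<^esub>" if "x \<in> I" for x
      using I.a_rcos_const[OF that] by (simp add: quot_module_def)
    then show ?thesis using I.zero_closed by blast
  qed
  have eqI: "L = I" if "left_ideal S L" "I \<subseteq> L" "q ` L = {\<zero>\<^bsub>E\<^esub>}" for L
    using q_image_vimage[OF that(1,2)] q_image_vimage[OF I order_refl] that(3) qI by simp
  have simp_sub: "simple_submodule S E (q ` V)"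
    unfolding simple_submodule_def
  proof (intro conjI allI impI)
    show "submodule (q ` V) S E" by (rule submodule_image[OF V(1)])
    show "q ` V \<noteq> {\<zero>\<^bsub>E\<^esub>}" using eqI[OF V(1)] V(2) by blast
    fix N assume N: "submodule N S E \<and> N \<subseteq> q ` V"
    define W where "W = {x \<in> carrier S. q x \<in> N}"
    note W = submodule_vimage[OF conjunct1[OF N], folded W_def]
    have "W \<subseteq> {x \<in> carrier S. q x \<in> q ` V}" using N W_def by blast
    then have "W \<subseteq> V" using q_image_vimage[OF V(1)] V(2) by simp
    then have "W = I \<or> W = V" by (rule simple[OF W(1,2)])
    then have "q ` W = q ` I \<or> q ` W = q ` V" by fast
    then show "N = {\<zero>\<^bsub>E\<^esub>} \<or> N = q ` V" unfolding qI W(3)[symmetric] .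
  qed
  moreover have "essential_submodule S E (q ` V)"
    unfolding essential_submodule_def
  proof (intro conjI allI impI)
    show "submodule (q ` V) S E" by (rule submodule_image[OF V(1)])
    fix N assume N: "submodule N S E \<and> N \<noteq> {\<zero>\<^bsub>E\<^esub>}"
    define W where "W = {x \<in> carrier S. q x \<in> N}"
    note W = submodule_vimage[OF conjunct1[OF N], folded W_def]
    have "W \<noteq> I"
    proof
      assume "W = I"
      then have "q ` W = {\<zero>\<^bsub>E\<^esub>}" using qI by simp
      then show False using N unfolding W(3)[symmetric] by simp
    qed
    then have "I \<subset> W" using W(2) by (simp add: psubset_eq eq_commute)
    from essential[OF W(1) this] obtain x where x: "x \<in> W" "x \<in> V" "x \<notin> I" by blast
    then have "x \<in> carrier S" "q x \<in> N" by (simp_all add: W_def)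
    then have "q x \<noteq> \<zero>\<^bsub>E\<^esub>" using q_zero_iff[of x] x by (simp add: quot_module_def)
    moreover have "q x \<in> N \<inter> q ` V" using \<open>q x \<in> N\<close> x by simp
    ultimately show "N \<inter> q ` V \<noteq> {\<zero>\<^bsub>E\<^esub>}" by (intro notI) (simp only: singleton_iff)
  qed
  ultimately have "artinian_module S E"
    using S(2)[unfolded diamond_def, rule_format, of E "q ` V"] quot_left_module quot_cyclic
    by simp
  then have "(\<forall>n. submodule (q ` N n) S E) \<and> (\<forall>n. q ` N (Suc n) \<subseteq> q ` N n)
      \<longrightarrow> (\<exists>n. \<forall>m\<ge>n. q ` N m = q ` N n)"
    unfolding artinian_module_def by (rule spec)
  moreover have "(\<forall>n. submodule (q ` N n) S E) \<and> (\<forall>n. q ` N (Suc n) \<subseteq> q ` N n)"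
    by (intro conjI allI submodule_image chain(1) image_mono chain(3))
  ultimately have "\<exists>n. \<forall>m\<ge>n. q ` N m = q ` N n" by (rule mp)
  then obtain k where k: "\<forall>m\<ge>k. q ` N m = q ` N k" ..
  have "N m = N k" if "m \<ge> k" for m
  proof -
    have "N m = {x \<in> carrier S. q x \<in> q ` N m}" by (rule q_image_vimage[OF chain(1,2), symmetric])
    also have "q ` N m = q ` N k" by (rule k[rule_format, OF that])
    also have "{x \<in> carrier S. q x \<in> q ` N k} = N k" by (rule q_image_vimage[OF chain(1,2)])
    finally show ?thesis .
  qed
  then show ?thesis by (intro exI[of _ k] allI impI)
qed

section \<open>Left ideals of the differential operator ring\<close>

context deriv_ring
begin

abbreviation "DR \<equiv> diff_op_ring R \<delta>"
abbreviation "cst a \<equiv> dop_monom R a 0"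

lemma DR_carrier: "carrier DR = up R"
  by (simp add: diff_op_ring_def)

lemma DR_add: "f \<oplus>\<^bsub>DR\<^esub> g = (\<lambda>n. f n \<oplus> g n)"
  by (simp add: diff_op_ring_def)

lemma DR_zero: "\<zero>\<^bsub>DR\<^esub> = (\<lambda>n. \<zero>)"
  by (simp add: diff_op_ring_def)

text \<open>S is generated by R and \<theta>, so scaling and \<open>T\<close>, the left
  multiplication by \<theta>, account for all left multiplications.\<close>

lemma left_idealI:
  assumes sub: "I \<subseteq> up R" and zero: "(\<lambda>n. \<zero>) \<in> I"
    and add: "\<And>f g. f \<in> I \<Longrightarrow> g \<in> I \<Longrightarrow> (\<lambda>n. f n \<oplus> g n) \<in> I"
    and scale: "\<And>r f. r \<in> carrier R \<Longrightarrow> f \<in> I \<Longrightarrow> (\<lambda>n. r \<otimes> f n) \<in> I"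
    and T: "\<And>f. f \<in> I \<Longrightarrow> T f \<in> I"
  shows "left_ideal DR I"
proof -
  interpret D: ring DR by (rule ring_diff_op_ring)
  have Tn: "(T ^^ i) f \<in> I" if "f \<in> I" for i f
    using that T by (induction i) auto
  have act: "act N p f \<in> I" if "p \<in> up R" "f \<in> I" for N p f
  proof (induction N)
    case (Suc N)
    have "f \<in> up R" using that sub by blast
    then show ?case
      using add[OF scale[OF up_in[OF that(1)] Tn[OF that(2)]] Suc] that(1) by (simp add: act_Suc)
  qed (simp add: act_0 zero)
  have mult: "p \<otimes>\<^bsub>DR\<^esub> f \<in> I" if pf: "p \<in> up R" "f \<in> I" for p f
  proof -
    have "f \<in> up R" using pf sub by blast
    then show ?thesis using act[OF pf] mult_act[OF pf(1)] bound_ex[OF pf(1)] by metis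
  qed
  have "subgroup I (add_monoid DR)"
  proof (rule D.add.subgroupI)
    show "I \<subseteq> carrier DR" using sub by (simp add: DR_carrier)
    show "I \<noteq> {}" using zero by blast
    fix f assume f: "f \<in> I"
    then have f': "f \<in> carrier DR" using sub by (auto simp: DR_carrier)
    then have "\<ominus>\<^bsub>DR\<^esub> f = (\<ominus>\<^bsub>DR\<^esub> \<one>\<^bsub>DR\<^esub>) \<otimes>\<^bsub>DR\<^esub> f" by (simp add: D.l_minus)
    then show "\<ominus>\<^bsub>DR\<^esub> f \<in> I" using mult[OF _ f, of "\<ominus>\<^bsub>DR\<^esub> \<one>\<^bsub>DR\<^esub>"] D.a_inv_closed[OF D.one_closed]
      by (simp add: DR_carrier)
    show "f \<oplus>\<^bsub>DR\<^esub> g \<in> I" if "g \<in> I" for g using add f that by (simp add: DR_add)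
  qed
  then show ?thesis
    using mult by (auto simp: left_ideal_def DR_carrier intro: additive_subgroup.intro)
qed

lemma left_idealD:
  assumes "left_ideal DR I"
  shows "I \<subseteq> up R" "(\<lambda>n. \<zero>) \<in> I"
    "\<And>f g. f \<in> I \<Longrightarrow> g \<in> I \<Longrightarrow> (\<lambda>n. f n \<oplus> g n) \<in> I"
    "\<And>r f. r \<in> carrier R \<Longrightarrow> f \<in> I \<Longrightarrow> (\<lambda>n. r \<otimes> f n) \<in> I"
    "\<And>f. f \<in> I \<Longrightarrow> T f \<in> I"
    "\<And>p f. p \<in> up R \<Longrightarrow> f \<in> I \<Longrightarrow> p \<otimes>\<^bsub>DR\<^esub> f \<in> I"
proof -
  interpret I: additive_subgroup I DR using assms by (simp add: left_ideal_def)
  show sub: "I \<subseteq> up R" using I.a_subset by (simp add: DR_carrier)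
  show "(\<lambda>n. \<zero>) \<in> I" using I.zero_closed by (simp add: DR_zero)
  show "(\<lambda>n. f n \<oplus> g n) \<in> I" if "f \<in> I" "g \<in> I" for f g
    using I.a_closed[OF that] by (simp add: DR_add)
  show mult: "p \<otimes>\<^bsub>DR\<^esub> f \<in> I" if "p \<in> up R" "f \<in> I" for p f
    using assms that by (simp add: left_ideal_def DR_carrier)
  show "(\<lambda>n. r \<otimes> f n) \<in> I" if "r \<in> carrier R" "f \<in> I" for r f
    using mult[of "cst r" f] that sub monom_mult[of r f 0] by auto
  show "T f \<in> I" if "f \<in> I" for f
  proof -
    have f: "f \<in> up R" using sub that by blast
    then have "(\<lambda>n. \<one> \<otimes> T f n) = T f" using l_one[OF up_in[OF T_closed[OF f]]] by simp
    then show ?thesis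
      using mult[of "dop_monom R \<one> 1" f] that monom_mult[of \<one> f 1] f by simp
  qed
qed

lemma left_ideal_one:
  assumes "left_ideal DR I" "cst \<one> \<in> I" shows "I = up R"
  using left_idealD(1,6)[OF assms(1)] assms(2) mult_one_right by (metis subsetI subset_antisym)

lemma Tn_cst_above: "a \<in> carrier R \<Longrightarrow> n > d \<Longrightarrow> (T ^^ d) (cst a) n = \<zero>"
proof (induction d arbitrary: n)
  case 0
  then show ?case by (simp add: dop_monom_def)
next
  case (Suc d)
  then show ?case by (cases n) (simp_all add: theta_mult_def)
qed

lemma Tn_cst_top: "a \<in> carrier R \<Longrightarrow> (T ^^ d) (cst a) d = a"
proof (induction d)
  case 0
  then show ?case by (simp add: dop_monom_def)
next
  case (Suc d)
  then show ?case
    using Tn_cst_above[of a d "Suc d"] by (simp add: theta_mult_def[of R \<delta> "(T ^^ d) (cst a)"])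
qed

text \<open>The second term of \<theta>^(d+1) a = a \<theta>^(d+1) + (d+1) \<delta>(a) \<theta>^d +
  ...; it will be the leading term of a commutator, and characteristic zero keeps its integer factor
  outside Q.\<close>

lemma Tn_cst_below: "a \<in> carrier R \<Longrightarrow> (T ^^ Suc d) (cst a) d = [Suc d] \<cdot> \<delta> a"
proof (induction d)
  case 0
  then show ?case by (simp add: dop_monom_def theta_mult_def)
next
  case (Suc d)
  have "(T ^^ Suc (Suc d)) (cst a) (Suc d) =
      (T ^^ Suc d) (cst a) d \<oplus> \<delta> ((T ^^ Suc d) (cst a) (Suc d))"
    by (simp add: theta_mult_def[of _ _ "T _"] theta_mult_def[of _ _ "(T ^^ Suc d) _"] del: funpow.simps(2)
        add: funpow.simps(2)[of "Suc d"])
  then show ?case using Suc Tn_cst_top[of a "Suc d"] by (simp del: funpow.simps)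
qed

text \<open>\<open>right_span Q d\<close> consists of the sums \<open>\<Sum>i<d. \<theta>\<^sup>i a\<^sub>i\<close> with \<open>a\<^sub>i \<in> Q\<close>; their union is \<open>S Q\<close>.\<close>

primrec right_span :: "'a set \<Rightarrow> nat \<Rightarrow> (nat \<Rightarrow> 'a) set" where
  "right_span Q 0 = {\<lambda>n. \<zero>}"
| "right_span Q (Suc d) = {\<lambda>n. (T ^^ d) (cst a) n \<oplus> f n | a f. a \<in> Q \<and> f \<in> right_span Q d}"

definition induced :: "'a set \<Rightarrow> (nat \<Rightarrow> 'a) set" where
  "induced Q = (\<Union>d. right_span Q d)"

lemma right_span_SucE:
  assumes "f \<in> right_span Q (Suc d)"
  obtains a g where "a \<in> Q" "g \<in> right_span Q d" "f = (\<lambda>n. (T ^^ d) (cst a) n \<oplus> g n)"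
  using assms by auto

lemma right_span_SucI:
  "a \<in> Q \<Longrightarrow> g \<in> right_span Q d \<Longrightarrow> (\<lambda>n. (T ^^ d) (cst a) n \<oplus> g n) \<in> right_span Q (Suc d)"
  by auto

declare right_span.simps(2) [simp del]

lemma zero_up [simp, intro]: "(\<lambda>n. \<zero>) \<in> up R"
  by (rule upI) auto

lemma Tn_zero: "(T ^^ i) (\<lambda>n. \<zero>) = (\<lambda>n. \<zero>)"
  by (induction i) (auto simp: T_zero)

lemma cst_zero: "cst \<zero> = (\<lambda>n. \<zero>)"
  by (auto simp: dop_monom_def)

end

section \<open>The left ideal S Q and its leading coefficients\<close>

locale deriv_ideal = deriv_ring R \<delta> + Q: ideal Q R for R (structure) and \<delta> Q +
  assumes cring_R: "cring R"
begin

sublocale cring R by (rule cring_R)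

lemma Qc [simp]: "a \<in> Q \<Longrightarrow> a \<in> carrier R" by (rule Q.Icarr)

abbreviation "RS \<equiv> right_span Q"

lemma RS_up: "f \<in> RS d \<Longrightarrow> f \<in> up R"
proof (induction d arbitrary: f)
  case (Suc d)
  then show ?case by (auto elim!: right_span_SucE intro!: add_closed')
qed simp

lemma RS_above: "f \<in> RS d \<Longrightarrow> n \<ge> d \<Longrightarrow> f n = \<zero>"
proof (induction d arbitrary: f)
  case (Suc d)
  obtain a g where "a \<in> Q" "g \<in> RS d" "f = (\<lambda>n. (T ^^ d) (cst a) n \<oplus> g n)"
    using Suc.prems(1) by (rule right_span_SucE)
  then show ?case using Suc.IH[of g] Suc.prems(2) by (simp add: Tn_cst_above)
qed simp

lemma RS_top: "f \<in> RS (Suc d) \<Longrightarrow> f d \<in> Q"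
  by (auto elim!: right_span_SucE simp: Tn_cst_top RS_above)

lemma RS_Suc: "f \<in> RS d \<Longrightarrow> f \<in> RS (Suc d)"
proof -
  assume f: "f \<in> RS d"
  have "(\<lambda>n. (T ^^ d) (cst \<zero>) n \<oplus> f n) \<in> RS (Suc d)" using f by (intro right_span_SucI) auto
  then show ?thesis using RS_up[OF f] by (simp add: cst_zero Tn_zero)
qed

lemma RS_mono: "d \<le> e \<Longrightarrow> f \<in> RS d \<Longrightarrow> f \<in> RS e"
  by (induction rule: dec_induct) (auto intro: RS_Suc)

lemma RS_zero [simp]: "(\<lambda>n. \<zero>) \<in> RS d"
  using RS_mono[of 0 d] by simp

lemma RS_monom: "a \<in> Q \<Longrightarrow> (T ^^ d) (cst a) \<in> RS (Suc d)"
proof -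
  assume a: "a \<in> Q"
  have "(\<lambda>n. (T ^^ d) (cst a) n \<oplus> \<zero>) \<in> RS (Suc d)" using a by (intro right_span_SucI) auto
  moreover have "(T ^^ d) (cst a) \<in> up R" using a by auto
  ultimately show ?thesis by simp
qed

lemma RS_add: "f \<in> RS d \<Longrightarrow> g \<in> RS d \<Longrightarrow> (\<lambda>n. f n \<oplus> g n) \<in> RS d"
proof (induction d arbitrary: f g)
  case (Suc d)
  obtain a f' where f: "a \<in> Q" "f' \<in> RS d" "f = (\<lambda>n. (T ^^ d) (cst a) n \<oplus> f' n)"
    using Suc.prems(1) by (rule right_span_SucE)
  obtain b g' where g: "b \<in> Q" "g' \<in> RS d" "g = (\<lambda>n. (T ^^ d) (cst b) n \<oplus> g' n)"
    using Suc.prems(2) by (rule right_span_SucE)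
  have c: "cst (a \<oplus> b) = (\<lambda>n. cst a n \<oplus> cst b n)" by (auto simp: dop_monom_def)
  have "(T ^^ d) (cst (a \<oplus> b)) = (\<lambda>n. (T ^^ d) (cst a) n \<oplus> (T ^^ d) (cst b) n)"
    unfolding c using f g by (intro Tn_add) auto
  moreover have "(T ^^ d) (cst a) n \<in> carrier R" "(T ^^ d) (cst b) n \<in> carrier R"
    "f' n \<in> carrier R" "g' n \<in> carrier R" for n
    using f g RS_up by auto
  ultimately have "(\<lambda>n. f n \<oplus> g n) = (\<lambda>n. (T ^^ d) (cst (a \<oplus> b)) n \<oplus> (f' n \<oplus> g' n))"
    unfolding f g by (simp add: a_ac)
  then show ?case using right_span_SucI[of "a \<oplus> b" Q "\<lambda>n. f' n \<oplus> g' n" d] f g Suc.IH by auto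
qed simp

lemma RS_T: "f \<in> RS d \<Longrightarrow> T f \<in> RS (Suc d)"
proof (induction d arbitrary: f)
  case 0
  then show ?case using RS_zero[of 1] by (simp add: T_zero)
next
  case (Suc d)
  obtain a g where f: "a \<in> Q" "g \<in> RS d" "f = (\<lambda>n. (T ^^ d) (cst a) n \<oplus> g n)"
    using Suc.prems by (rule right_span_SucE)
  have "T f = (\<lambda>n. (T ^^ Suc d) (cst a) n \<oplus> T g n)"
    unfolding f using f RS_up by (subst T_add) auto
  then show ?case using right_span_SucI[OF f(1) Suc.IH[OF f(2)]] by simp
qed

text \<open>From r \<theta> = \<theta> r - \<delta>(r): r \<theta>^(d+1) a = \<theta> (r \<theta>^d
  a) - \<delta>(r) \<theta>^d a, and induction puts both terms into the required form.\<close>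

lemma RS_scale_monom:
  "r \<in> carrier R \<Longrightarrow> a \<in> Q \<Longrightarrow> (\<lambda>n. r \<otimes> (T ^^ d) (cst a) n) \<in> RS (Suc d)"
proof (induction d arbitrary: r)
  case 0
  have "(\<lambda>n. r \<otimes> cst a n) = cst (r \<otimes> a)" using 0 by (auto simp: dop_monom_def)
  then show ?case using RS_monom[of "r \<otimes> a" 0] 0 Q.I_l_closed by simp
next
  case (Suc d)
  let ?g = "(T ^^ d) (cst a)"
  have g: "?g \<in> up R" using Suc.prems by auto
  have gc: "?g n \<in> carrier R" "T ?g n \<in> carrier R" for n
    using g T_closed[OF g] up_in by blast+
  have "T (\<lambda>n. r \<otimes> ?g n) = (\<lambda>n. r \<otimes> T ?g n \<oplus> \<delta> r \<otimes> ?g n)"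
    using T_smult[OF Suc.prems(1) g] .
  then have "(\<lambda>n. r \<otimes> T ?g n) = (\<lambda>n. T (\<lambda>n. r \<otimes> ?g n) n \<oplus> (\<ominus> \<delta> r) \<otimes> ?g n)"
    using Suc.prems gc by (simp add: l_minus a_assoc r_neg)
  moreover have "T (\<lambda>n. r \<otimes> ?g n) \<in> RS (Suc (Suc d))"
    by (rule RS_T[OF Suc.IH[OF Suc.prems]])
  moreover have "(\<lambda>n. (\<ominus> \<delta> r) \<otimes> ?g n) \<in> RS (Suc (Suc d))"
    by (rule RS_Suc[OF Suc.IH]) (use Suc.prems in auto)
  ultimately show ?case using RS_add by simp
qed

lemma RS_scale: "r \<in> carrier R \<Longrightarrow> f \<in> RS d \<Longrightarrow> (\<lambda>n. r \<otimes> f n) \<in> RS d"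
proof (induction d arbitrary: f)
  case (Suc d)
  obtain a g where f: "a \<in> Q" "g \<in> RS d" "f = (\<lambda>n. (T ^^ d) (cst a) n \<oplus> g n)"
    using Suc.prems(2) by (rule right_span_SucE)
  have "(T ^^ d) (cst a) n \<in> carrier R" "g n \<in> carrier R" for n
    using f RS_up by auto
  then have "(\<lambda>n. r \<otimes> f n) = (\<lambda>n. r \<otimes> (T ^^ d) (cst a) n \<oplus> r \<otimes> g n)"
    unfolding f using Suc.prems by (simp add: r_distr)
  then show ?case
    using RS_add[OF RS_scale_monom[OF Suc.prems(1) f(1)] RS_Suc[OF Suc.IH[OF Suc.prems(1) f(2)]]]
    by simp
qed simp

lemma induced_left_ideal: "left_ideal DR (induced Q)"
proof (rule left_idealI)
  fix f g assume "f \<in> induced Q" "g \<in> induced Q"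
  then obtain d e where "f \<in> RS d" "g \<in> RS e" by (auto simp: induced_def)
  then have "f \<in> RS (max d e)" "g \<in> RS (max d e)"
    using RS_mono[of d "max d e"] RS_mono[of e "max d e"] by auto
  then show "(\<lambda>n. f n \<oplus> g n) \<in> induced Q" using RS_add by (auto simp: induced_def)
next
  show "(\<lambda>n. \<zero>) \<in> induced Q" using RS_zero by (auto simp: induced_def)
  show "induced Q \<subseteq> up R" using RS_up by (auto simp: induced_def)
qed (use RS_scale RS_T in \<open>unfold induced_def, blast+\<close>)

lemma cst_induced: "a \<in> Q \<Longrightarrow> cst a \<in> induced Q"
  using RS_monom[of a 0] by (auto simp: induced_def)

text \<open>Q need not be \<delta>-stable, so lower coefficients of an element of S Q may fall
  outside Q; only the leading one is controlled.\<close>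

lemma induced_lead:
  assumes "f \<in> induced Q" "\<And>n. n > d \<Longrightarrow> f n = \<zero>"
  shows "f d \<in> Q"
proof -
  obtain e where "f \<in> RS e" using assms(1) by (auto simp: induced_def)
  then show ?thesis
  proof (induction e)
    case (Suc e)
    consider "e < d" | "e = d" | "e > d" by linarith
    then show ?case
    proof cases
      case 1
      then show ?thesis using RS_above[OF Suc.prems, of d] Q.zero_closed by simp
    next
      case 2
      then show ?thesis using RS_top[OF Suc.prems] by simp
    next
      case 3
      \<comment> \<open>The top term \<theta>^e a contributes the coefficient f e = a, which is zero
        above degree d, so this term can be removed.\<close>
      obtain a g where f: "a \<in> Q" "g \<in> RS e" "f = (\<lambda>n. (T ^^ e) (cst a) n \<oplus> g n)"
        using Suc.prems by (rule right_span_SucE)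
      have "f e = a" using f by (simp add: Tn_cst_top RS_above)
      then have "a = \<zero>" using assms(2)[of e] 3 by simp
      then have "f = g" using f RS_up[OF f(2)] by (simp add: cst_zero Tn_zero)
      then show ?thesis using Suc.IH f(2) by simp
    qed
  qed (use Q.zero_closed in simp)
qed

text \<open>A leading coefficient a in Q is cleared by subtracting \<theta>^d a, an element of S Q.
  This ends at zero or at a leading coefficient outside Q.\<close>

lemma induced_normalize:
  assumes "f \<in> up R" "\<And>n. n \<ge> d \<Longrightarrow> f n = \<zero>"
  shows "\<exists>g\<in>induced Q. (\<lambda>n. f n \<oplus> g n) = (\<lambda>n. \<zero>) \<or>
    (\<exists>e<d. f e \<oplus> g e \<notin> Q \<and> (\<forall>n>e. f n \<oplus> g n = \<zero>))"
  using assms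
proof (induction d arbitrary: f)
  case 0
  then show ?case using left_idealD(2)[OF induced_left_ideal] by (intro bexI[of _ "\<lambda>n. \<zero>"]) auto
next
  case (Suc d)
  show ?case
  proof (cases "f d \<in> Q")
    case True
    let ?g = "(T ^^ d) (cst (\<ominus> f d))"
    have gI: "?g \<in> induced Q" using RS_monom[of "\<ominus> f d" d] True by (auto simp: induced_def)
    have gu: "?g \<in> up R" using True by auto
    let ?h = "\<lambda>n. f n \<oplus> ?g n"
    have hu: "?h \<in> up R" using Suc.prems(1) gu by auto
    have "?h n = \<zero>" if "n \<ge> d" for n
    proof (cases "n = d")
      case True
      then show ?thesis using Suc.prems(1) by (simp add: Tn_cst_top r_neg)
    next
      case False
      then show ?thesis using Suc.prems that by (simp add: Tn_cst_above)
    qed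
    then obtain g where g: "g \<in> induced Q" "(\<lambda>n. ?h n \<oplus> g n) = (\<lambda>n. \<zero>) \<or>
      (\<exists>e<d. ?h e \<oplus> g e \<notin> Q \<and> (\<forall>n>e. ?h n \<oplus> g n = \<zero>))" using Suc.IH[OF hu] by blast
    have gc: "g \<in> up R" using g(1) left_idealD(1)[OF induced_left_ideal] by blast
    have "?h n \<oplus> g n = f n \<oplus> (?g n \<oplus> g n)" for n
      using Suc.prems(1) gu gc by (simp add: a_assoc)
    moreover have "(\<lambda>n. ?g n \<oplus> g n) \<in> induced Q"
      by (rule left_idealD(3)[OF induced_left_ideal gI g(1)])
    ultimately show ?thesis using g(2) by (intro bexI[of _ "\<lambda>n. ?g n \<oplus> g n"]) (auto intro: less_SucI)
  next
    case False
    then show ?thesis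
      using Suc.prems left_idealD(2)[OF induced_left_ideal]
      by (intro bexI[of _ "\<lambda>n. \<zero>"] disjI2 exI[of _ d]) auto
  qed
qed

lemma normalize:
  assumes "f \<in> up R"
  obtains g where "g \<in> induced Q" "(\<lambda>n. f n \<oplus> g n) = (\<lambda>n. \<zero>)"
  | g e where "g \<in> induced Q" "f e \<oplus> g e \<notin> Q" "\<And>n. n > e \<Longrightarrow> f n \<oplus> g n = \<zero>"
proof -
  obtain d where "\<And>n. n \<ge> d \<Longrightarrow> f n = \<zero>" using bound_ex[OF assms] by blast
  from induced_normalize[OF assms this] show ?thesis using that by blast
qed

end

context deriv_ideal
begin

lemma act_cst_above:
  "h \<in> up R \<Longrightarrow> a \<in> carrier R \<Longrightarrow> n \<ge> N \<Longrightarrow> act N h (cst a) n = \<zero>"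
  by (induction N) (simp_all add: act_0 act_Suc Tn_cst_above)

text \<open>The two top coefficients of h a suffice for comparison with a h: the leading ones agree,
  the next ones differ by a multiple of \<delta>(a).\<close>

lemma mult_cst:
  assumes h: "h \<in> up R" "\<And>n. n > Suc k \<Longrightarrow> h n = \<zero>" and a: "a \<in> carrier R"
  shows "h \<otimes>\<^bsub>DR\<^esub> cst a = act (Suc (Suc k)) h (cst a)"
    "n > Suc k \<Longrightarrow> (h \<otimes>\<^bsub>DR\<^esub> cst a) n = \<zero>"
    "(h \<otimes>\<^bsub>DR\<^esub> cst a) (Suc k) = h (Suc k) \<otimes> a"
    "(h \<otimes>\<^bsub>DR\<^esub> cst a) k = h (Suc k) \<otimes> ([Suc k] \<cdot> \<delta> a) \<oplus> h k \<otimes> a"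
proof -
  have ca: "cst a \<in> up R" using a by simp
  show eq: "h \<otimes>\<^bsub>DR\<^esub> cst a = act (Suc (Suc k)) h (cst a)"
    using h(2) by (intro mult_act[OF h(1) ca]) auto
  show "(h \<otimes>\<^bsub>DR\<^esub> cst a) n = \<zero>" if "n > Suc k"
    unfolding eq using that by (intro act_cst_above[OF h(1) a]) auto
  have hc: "h n \<in> carrier R" for n using h(1) by simp
  have z: "act (Suc k) h (cst a) (Suc k) = \<zero>" "act k h (cst a) k = \<zero>"
    by (intro act_cst_above[OF h(1) a] order_refl)+
  have s: "act (Suc N) h (cst a) n = h N \<otimes> (T ^^ N) (cst a) n \<oplus> act N h (cst a) n" for N n
    using act_Suc[OF h(1) ca, of N] by metis
  show "(h \<otimes>\<^bsub>DR\<^esub> cst a) (Suc k) = h (Suc k) \<otimes> a"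
    unfolding eq s[of "Suc k"] z Tn_cst_top[OF a] using hc a by simp
  show "(h \<otimes>\<^bsub>DR\<^esub> cst a) k = h (Suc k) \<otimes> ([Suc k] \<cdot> \<delta> a) \<oplus> h k \<otimes> a"
    unfolding eq s[of "Suc k"] s[of k] z Tn_cst_top[OF a] Tn_cst_below[OF a] using hc a by simp
qed

text \<open>\<open>S Q\<close> is a maximal left ideal: if \<open>h\<close> has minimal degree among the elements of a larger left
  ideal with leading coefficient outside \<open>Q\<close>, then \<open>[a, h]\<close> with \<open>a \<in> Q\<close> and
  \<open>\<delta> a \<notin> Q\<close> has smaller degree, and its leading coefficient is outside \<open>Q\<close> as well.\<close>

lemma induced_maximal:
  assumes prime: "primeideal Q R" and char: "\<And>n::nat. n > 0 \<Longrightarrow> [n] \<cdot> \<one> \<notin> Q"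
    and inverse: "\<And>r. r \<in> carrier R \<Longrightarrow> r \<notin> Q \<Longrightarrow> \<exists>s\<in>carrier R. s \<otimes> r \<ominus> \<one> \<in> Q"
    and a: "a \<in> Q" "\<delta> a \<notin> Q" and N: "left_ideal DR N" "induced Q \<subset> N"
  shows "N = up R"
proof (rule left_ideal_one[OF N(1)])
  interpret Q': primeideal Q R by fact
  note ND = left_idealD[OF N(1)]
  \<comment> \<open>Degrees count only for elements with leading coefficient outside Q;
    \<open>normalize\<close> produces such an element from any member of N outside S Q.\<close>
  define P where "P e \<longleftrightarrow> (\<exists>h\<in>N. h e \<notin> Q \<and> (\<forall>n>e. h n = \<zero>))" for e
  obtain f where f: "f \<in> N" "f \<notin> induced Q" using N(2) by blast
  have fu: "f \<in> up R" using f ND(1) by blast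
  have "\<exists>e. P e"
    using fu
  proof (rule normalize)
    fix g assume g: "g \<in> induced Q" "(\<lambda>n. f n \<oplus> g n) = (\<lambda>n. \<zero>)"
    have gu: "g \<in> up R" using g(1) left_idealD(1)[OF induced_left_ideal] by blast
    have "f n = \<ominus> \<one> \<otimes> g n" for n
    proof -
      have "f n \<oplus> g n = \<zero>" using g(2) by meson
      then show ?thesis using fu gu by (simp add: l_minus minus_equality)
    qed
    then have "f = (\<lambda>n. \<ominus> \<one> \<otimes> g n)" by blast
    then have "f \<in> induced Q" using left_idealD(4)[OF induced_left_ideal _ g(1), of "\<ominus> \<one>"] by simp
    then show ?thesis using f by simp
  next
    fix g e assume g: "g \<in> induced Q" "f e \<oplus> g e \<notin> Q" "\<And>n. n > e \<Longrightarrow> f n \<oplus> g n = \<zero>"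
    have "(\<lambda>n. f n \<oplus> g n) \<in> N" using ND(3)[OF f(1)] g(1) N(2) by blast
    then have "P e" unfolding P_def using g by (intro bexI[of _ "\<lambda>n. f n \<oplus> g n"]) auto
    then show ?thesis ..
  qed
  then have Pe: "P (LEAST e. P e)" by (rule LeastI_ex)
  then obtain h where h: "h \<in> N" "h (LEAST e. P e) \<notin> Q" "\<And>n. n > (LEAST e. P e) \<Longrightarrow> h n = \<zero>"
    unfolding P_def by blast
  have hu: "h \<in> up R" using h ND(1) by blast
  show "cst \<one> \<in> N"
  proof (cases "LEAST e. P e")
    case 0
    \<comment> \<open>In degree zero h is a constant invertible modulo Q, and what separates s h
      from 1 is a constant of Q, hence an element of S Q.\<close>
    obtain s where s: "s \<in> carrier R" "s \<otimes> h 0 \<ominus> \<one> \<in> Q" using inverse[of "h 0"] h(2) hu 0 by auto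
    have 1: "(\<lambda>n. s \<otimes> h n) \<in> N" by (rule ND(4)[OF s(1) h(1)])
    have "cst (\<ominus> (s \<otimes> h 0 \<ominus> \<one>)) \<in> N"
      using cst_induced[of "\<ominus> (s \<otimes> h 0 \<ominus> \<one>)"] s(2) N(2) by blast
    from ND(3)[OF 1 this]
    have "(\<lambda>n. s \<otimes> h n \<oplus> cst (\<ominus> (s \<otimes> h 0 \<ominus> \<one>)) n) \<in> N" .
    also have "(\<lambda>n. s \<otimes> h n \<oplus> cst (\<ominus> (s \<otimes> h 0 \<ominus> \<one>)) n) = cst \<one>"
    proof
      fix n
      have h0: "h 0 \<in> carrier R" using hu by simp
      show "s \<otimes> h n \<oplus> cst (\<ominus> (s \<otimes> h 0 \<ominus> \<one>)) n = cst \<one> n"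
      proof (cases "n = 0")
        case True
        have "s \<otimes> h 0 \<oplus> \<ominus> (s \<otimes> h 0 \<ominus> \<one>) = \<one>" using h0 s(1) by algebra
        then show ?thesis using True by (simp add: dop_monom_def)
      next
        case False
        then show ?thesis using h(3)[of n] 0 s(1) by (simp add: dop_monom_def)
      qed
    qed
    finally show ?thesis .
  next
    case (Suc k)
    have hk: "h (Suc k) \<notin> Q" "\<And>n. n > Suc k \<Longrightarrow> h n = \<zero>" using h Suc by auto
    have ac: "a \<in> carrier R" using a by simp
    let ?ha = "h \<otimes>\<^bsub>DR\<^esub> cst a"
    \<comment> \<open>The commutator a h - h a. It lies in N although N is only a left ideal,
      because h a belongs to S Q.\<close>
    let ?m = "\<lambda>n. a \<otimes> h n \<oplus> \<ominus> \<one> \<otimes> ?ha n"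
    note m = mult_cst[where k = k, OF hu hk(2) ac]
    have hc: "h n \<in> carrier R" for n using hu by simp
    have "?ha \<in> induced Q" using left_idealD(6)[OF induced_left_ideal hu cst_induced[OF a(1)]] .
    then have "?ha \<in> N" using N(2) by blast
    then have mN: "?m \<in> N" using ND(4)[OF ac h(1)] ND(4)[of "\<ominus> \<one>" ?ha] by (intro ND(3)) auto
    have top: "?m n = \<zero>" if "n > k" for n
    proof (cases "n = Suc k")
      case True
      then show ?thesis using m(3) hc ac by (simp add: l_minus m_comm r_neg)
    next
      case False
      then show ?thesis using that m(2)[of n] hk(2)[of n] ac by simp
    qed
    have X: "[Suc k] \<cdot> \<delta> a \<in> carrier R" using ac by blast
    have m4: "?ha k = h (Suc k) \<otimes> ([Suc k] \<cdot> \<delta> a) \<oplus> h k \<otimes> a"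
      by (rule mult_cst(4)[OF hu hk(2) ac])
    \<comment> \<open>The terms with h k cancel. Up to sign, what remains is the product of h (k+1),
      k+1 and \<delta>(a), all outside the prime Q.\<close>
    have "a \<otimes> h k \<oplus> \<ominus> \<one> \<otimes> ?ha k = \<ominus> (h (Suc k) \<otimes> ([Suc k] \<cdot> \<delta> a))"
      unfolding m4 using X hc[of k] hc[of "Suc k"] ac by algebra
    moreover have "h (Suc k) \<otimes> ([Suc k] \<cdot> \<delta> a) \<notin> Q"
    proof
      assume "h (Suc k) \<otimes> ([Suc k] \<cdot> \<delta> a) \<in> Q"
      then have "[Suc k] \<cdot> \<delta> a \<in> Q" using Q'.I_prime[OF hc X] hk by blast
      moreover have "[Suc k] \<cdot> \<delta> a = [Suc k] \<cdot> \<one> \<otimes> \<delta> a"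
        using add_pow_ldistr[of \<one> "\<delta> a" "Suc k"] ac by simp
      ultimately have "[Suc k] \<cdot> \<one> \<otimes> \<delta> a \<in> Q" by simp
      then show False using Q'.I_prime[of "[Suc k] \<cdot> \<one>" "\<delta> a"] char[of "Suc k"] a(2) ac by blast
    qed
    ultimately have "a \<otimes> h k \<oplus> \<ominus> \<one> \<otimes> ?ha k \<notin> Q"
      using Q.a_inv_closed hc X by (metis m_closed minus_minus)
    then have "P k" unfolding P_def using mN top by (intro bexI[of _ ?m]) auto
    then have "(LEAST e. P e) \<le> k" by (rule Least_le)
    then show ?thesis using Suc by simp
  qed
qed

end

section \<open>Constant terms and right multiplication by \<theta>\<close>

context deriv_ring
begin

text \<open>For a \<delta>-ideal J this is S\<theta> + SJ, since the constant term of \<theta>^i a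
  is \<delta>^i(a). The quotient of S by it is R/J.\<close>

definition const_in :: "'a set \<Rightarrow> (nat \<Rightarrow> 'a) set" where
  "const_in J = {f \<in> up R. f 0 \<in> J}"

text \<open>Right multiplication by \<theta>, which commutes with the left multiplication
  \<open>T\<close>.\<close>

definition rshift :: "(nat \<Rightarrow> 'a) \<Rightarrow> nat \<Rightarrow> 'a" where
  "rshift g = (\<lambda>n. case n of 0 \<Rightarrow> \<zero> | Suc m \<Rightarrow> g m)"

lemma rshift_simps [simp]: "rshift g 0 = \<zero>" "rshift g (Suc n) = g n"
  by (simp_all add: rshift_def)

lemma rshift_up [simp, intro]: "g \<in> up R \<Longrightarrow> rshift g \<in> up R"
proof -
  assume g: "g \<in> up R"
  obtain N where N: "\<And>n. n > N \<Longrightarrow> g n = \<zero>" using upE[OF g] by blast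
  show ?thesis
    by (rule upI[where N = "Suc N"]) (use g N in \<open>auto simp: rshift_def split: nat.split\<close>)
qed

lemma lshift_up [simp, intro]: "f \<in> up R \<Longrightarrow> (\<lambda>n. f (Suc n)) \<in> up R"
proof -
  assume f: "f \<in> up R"
  obtain N where N: "\<And>n. n > N \<Longrightarrow> f n = \<zero>" using upE[OF f] by blast
  show ?thesis by (rule upI[where N = N]) (use f N in auto)
qed

lemma T_rshift: "g \<in> up R \<Longrightarrow> T (rshift g) = rshift (T g)"
  by (rule ext) (auto simp: theta_mult_def rshift_def split: nat.split)

lemma const_in_left_ideal:
  assumes "delta_ideal R \<delta> J"
  shows "left_ideal DR (const_in J)"
proof -
  interpret J: ideal J R using assms by (simp add: delta_ideal_def)
  have d: "x \<in> J \<Longrightarrow> \<delta> x \<in> J" for x using assms by (auto simp: delta_ideal_def)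
  have T0: "f \<in> up R \<Longrightarrow> T f 0 = \<delta> (f 0)" for f by (simp add: theta_mult_def)
  show ?thesis
    by (rule left_idealI) (auto simp: const_in_def T0 d J.I_l_closed)
qed

end

text \<open>The cyclic module in question is \<open>S / I\<close> with \<open>I = S Q \<theta> + S P\<close>. Its submodule
  \<open>(S \<theta> + S P) / I\<close> is isomorphic to \<open>S / S Q\<close>, and the factor module to \<open>R / P\<close>.\<close>

locale prime_pair = deriv_ideal R \<delta> Q for R (structure) and \<delta> Q +
  fixes P
  assumes prime: "primeideal Q R" and char: "\<And>n::nat. n > 0 \<Longrightarrow> [n] \<cdot> \<one> \<notin> Q"
    and inverse: "\<And>r. r \<in> carrier R \<Longrightarrow> r \<notin> Q \<Longrightarrow> \<exists>s\<in>carrier R. s \<otimes> r \<ominus> \<one> \<in> Q"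
    and unstable: "\<not> \<delta> ` Q \<subseteq> Q"
    and P: "delta_ideal R \<delta> P" and PQ: "P \<subseteq> Q"
    and core: "\<And>J. delta_ideal R \<delta> J \<Longrightarrow> P \<subset> J \<Longrightarrow> \<not> J \<subseteq> Q"
begin

sublocale Q': primeideal Q R by (rule prime)

sublocale P: ideal P R using P by (simp add: delta_ideal_def)

text \<open>Since P is stable and inside Q, \<theta> p = p \<theta> + \<delta>(p) lies in SQ\<theta>
  + P. So every element of SQ\<theta> + SP has the form g \<theta> + p with g in SQ and p in P, and
  membership splits into one condition on the constant term and one on the rest.\<close>

definition I :: "(nat \<Rightarrow> 'a) set" where
  "I = {f \<in> const_in P. (\<lambda>n. f (Suc n)) \<in> induced Q}"

lemma one_notin: "\<one> \<notin> Q"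
  using Q.one_imp_carrier Q'.I_notcarr by blast

lemmas SQ = left_idealD[OF induced_left_ideal]

lemma I_left_ideal: "left_ideal DR I"
proof (rule left_idealI)
  note VD = left_idealD[OF const_in_left_ideal[OF P]]
  show "I \<subseteq> up R" using VD(1) by (auto simp: I_def)
  show "(\<lambda>n. \<zero>) \<in> I" using VD(2) SQ(2) by (simp add: I_def)
  show "(\<lambda>n. f n \<oplus> g n) \<in> I" if "f \<in> I" "g \<in> I" for f g
    using that VD(3) SQ(3) by (simp add: I_def)
  show "(\<lambda>n. r \<otimes> f n) \<in> I" if "r \<in> carrier R" "f \<in> I" for r f
    using that VD(4) SQ(4) by (simp add: I_def)
  fix f assume f: "f \<in> I"
  then have fu: "f \<in> up R" and f0: "f 0 \<in> P" and fs: "(\<lambda>n. f (Suc n)) \<in> induced Q"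
    by (auto simp: I_def const_in_def)
  have fc: "f n \<in> carrier R" for n using fu by simp
  \<comment> \<open>Multiplication by \<theta> moves \<open>f 0\<close> to position 1, so the
    shifted sequence gains the constant \<open>f 0\<close>, which lies in Q because P does.\<close>
  have "T f (Suc n) = T (\<lambda>n. f (Suc n)) n \<oplus> cst (f 0) n" for n
    using fc by (cases n) (simp_all add: theta_mult_def dop_monom_def a_ac)
  moreover have "cst (f 0) \<in> induced Q" using f0 PQ cst_induced by blast
  ultimately have "(\<lambda>n. T f (Suc n)) \<in> induced Q" using SQ(3)[OF SQ(5)[OF fs]] by presburger
  then show "T f \<in> I" using f VD(5) by (simp add: I_def)
qed

lemma cst_I: "p \<in> P \<Longrightarrow> cst p \<in> I"
proof -
  assume p: "p \<in> P"
  then have "cst p \<in> up R" by (intro dop_monom_closed P.Icarr)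
  moreover have "(\<lambda>n. cst p (Suc n)) = (\<lambda>n. \<zero>)" by (simp add: dop_monom_def)
  ultimately show ?thesis using p SQ(2) by (simp add: I_def const_in_def dop_monom_def)
qed

lemma rshift_I: "g \<in> induced Q \<Longrightarrow> rshift g \<in> I"
proof -
  assume g: "g \<in> induced Q"
  then have "g \<in> up R" using SQ(1) by blast
  then show ?thesis using g by (simp add: I_def const_in_def P.zero_closed)
qed

lemma split_shift:
  assumes "f \<in> up R"
  shows "f = (\<lambda>n. rshift (\<lambda>n. f (Suc n)) n \<oplus> cst (f 0) n)"
    "rshift (\<lambda>n. f (Suc n)) = (\<lambda>n. f n \<oplus> cst (\<ominus> f 0) n)"
proof -
  have fc: "f n \<in> carrier R" for n using assms by simp
  show "f = (\<lambda>n. rshift (\<lambda>n. f (Suc n)) n \<oplus> cst (f 0) n)"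
    "rshift (\<lambda>n. f (Suc n)) = (\<lambda>n. f n \<oplus> cst (\<ominus> f 0) n)"
    using fc by (auto simp: rshift_def dop_monom_def fun_eq_iff r_neg split: nat.split)
qed

text \<open>The g with g \<theta> in N form a left ideal containing S Q. As S Q is maximal, only S Q
  and S are possible, and constants from P belong to N in either case.\<close>

lemma I_simple:
  assumes N: "left_ideal DR N" "I \<subseteq> N" "N \<subseteq> const_in P"
  shows "N = I \<or> N = const_in P"
proof -
  note ND = left_idealD[OF N(1)]
  define N' where "N' = {g \<in> up R. rshift g \<in> N}"
  have "left_ideal DR N'"
  proof (rule left_idealI)
    have "rshift (\<lambda>n. \<zero>) = (\<lambda>n. \<zero>)" by (auto simp: rshift_def split: nat.split)
    then show "(\<lambda>n. \<zero>) \<in> N'" using ND(2) by (simp add: N'_def)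
    show "(\<lambda>n. f n \<oplus> g n) \<in> N'" if "f \<in> N'" "g \<in> N'" for f g
    proof -
      have "rshift (\<lambda>n. f n \<oplus> g n) = (\<lambda>n. rshift f n \<oplus> rshift g n)"
        by (auto simp: rshift_def split: nat.split)
      then show ?thesis using that ND(3) by (simp add: N'_def add_closed')
    qed
    show "(\<lambda>n. r \<otimes> f n) \<in> N'" if "r \<in> carrier R" "f \<in> N'" for r f
    proof -
      have "rshift (\<lambda>n. r \<otimes> f n) = (\<lambda>n. r \<otimes> rshift f n)"
        using that by (auto simp: rshift_def split: nat.split)
      then show ?thesis using that ND(4) by (simp add: N'_def smult_closed')
    qed
    show "T f \<in> N'" if "f \<in> N'" for f
      using that ND(5)[of "rshift f"] T_rshift[of f] by (simp add: N'_def)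
  qed (auto simp: N'_def)
  moreover have sub: "induced Q \<subseteq> N'"
    using rshift_I N(2) SQ(1) by (auto simp: N'_def)
  ultimately consider "N' = induced Q" | "N' = up R"
    using unstable induced_maximal[OF prime char inverse, of _ N'] by blast
  then show ?thesis
  proof cases
    case 1
    have "f \<in> I" if f: "f \<in> N" for f
    proof -
      have fu: "f \<in> up R" and f0: "f 0 \<in> P" using f N(3) by (auto simp: const_in_def)
      have "cst (\<ominus> f 0) \<in> N" using cst_I[of "\<ominus> f 0"] f0 N(2) by blast
      then have "rshift (\<lambda>n. f (Suc n)) \<in> N"
        unfolding split_shift(2)[OF fu] by (rule ND(3)[OF f])
      then have "(\<lambda>n. f (Suc n)) \<in> induced Q" using fu 1 by (auto simp: N'_def)
      then show ?thesis using fu f0 by (simp add: I_def const_in_def)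
    qed
    then show ?thesis using N(2) by blast
  next
    case 2
    have "f \<in> N" if f: "f \<in> const_in P" for f
    proof -
      have fu: "f \<in> up R" and f0: "f 0 \<in> P" using f by (auto simp: const_in_def)
      have "(\<lambda>n. f (Suc n)) \<in> N'" using 2 fu by simp
      then have "rshift (\<lambda>n. f (Suc n)) \<in> N" by (simp add: N'_def)
      moreover have "cst (f 0) \<in> N" using cst_I[OF f0] N(2) by blast
      ultimately have "(\<lambda>n. rshift (\<lambda>n. f (Suc n)) n \<oplus> cst (f 0) n) \<in> N" by (rule ND(3))
      then show ?thesis using split_shift(1)[OF fu] by simp
    qed
    then show ?thesis using N(3) by blast
  qed
qed

text \<open>Stability comes from the constant term of \<theta> f, which is \<delta> of the constant
  term of f.\<close>

lemma const_terms_delta_ideal: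
  assumes "left_ideal DR N"
  shows "delta_ideal R \<delta> ((\<lambda>f. f 0) ` N)"
proof -
  note ND = left_idealD[OF assms]
  have ND1: "f \<in> N \<Longrightarrow> f n \<in> carrier R" for f n using ND(1) by auto
  have "ideal ((\<lambda>f. f 0) ` N) R"
  proof (rule idealI[OF ring_axioms])
    show "subgroup ((\<lambda>f. f 0) ` N) (add_monoid R)"
    proof (rule add.subgroupI)
      show "(\<lambda>f. f 0) ` N \<noteq> {}" using ND(2) by blast
      show "(\<lambda>f. f 0) ` N \<subseteq> carrier R" using ND1 by auto
      fix x assume "x \<in> (\<lambda>f. f 0) ` N"
      then obtain f where f: "f \<in> N" "x = f 0" by blast
      show "\<ominus> x \<in> (\<lambda>f. f 0) ` N"
        using ND(4)[OF _ f(1), of "\<ominus> \<one>"] f ND1[OF f(1)] by (auto simp: image_iff l_minus intro!: bexI)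
      fix y assume "y \<in> (\<lambda>f. f 0) ` N"
      then obtain g where g: "g \<in> N" "y = g 0" by blast
      show "x \<oplus> y \<in> (\<lambda>f. f 0) ` N"
        using ND(3)[OF f(1) g(1)] f g by (auto simp: image_iff intro!: bexI)
    qed
    fix x r assume "x \<in> (\<lambda>f. f 0) ` N" and r: "r \<in> carrier R"
    then obtain f where f: "f \<in> N" "x = f 0" by blast
    show "r \<otimes> x \<in> (\<lambda>f. f 0) ` N"
      using ND(4)[OF r f(1)] f by (auto simp: image_iff intro!: bexI)
    then show "x \<otimes> r \<in> (\<lambda>f. f 0) ` N" using m_comm[OF r ND1[OF f(1)]] f(2) by metis
  qed
  moreover have "\<delta> x \<in> (\<lambda>f. f 0) ` N" if x: "x \<in> (\<lambda>f. f 0) ` N" for x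
  proof -
    obtain f where f: "f \<in> N" "x = f 0" using x by blast
    have "T f 0 = \<delta> x" using f ND1[OF f(1)] by (simp add: theta_mult_def)
    then show ?thesis using ND(5)[OF f(1)] by (intro image_eqI[OF sym])
  qed
  ultimately show ?thesis by (auto simp: delta_ideal_def)
qed

text \<open>Some f in N has constant term c outside Q. With the rest of f normalised modulo
  SQ\<theta>, the element c \<theta> f - \<delta>(c) f has no constant term and would lie in I, but
  its leading coefficient is a product of two elements outside Q.\<close>

lemma I_essential:
  assumes N: "left_ideal DR N" "I \<subset> N"
  shows "\<not> N \<inter> const_in P \<subseteq> I"
proof
  assume sub: "N \<inter> const_in P \<subseteq> I"
  note ND = left_idealD[OF N(1)]
  let ?J = "(\<lambda>f. f 0) ` N"
  have "p \<in> ?J" if "p \<in> P" for p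
  proof -
    have "cst p \<in> N" using cst_I[OF that] N(2) by blast
    moreover have "p = cst p 0" by (simp add: dop_monom_def)
    ultimately show ?thesis by (intro image_eqI)
  qed
  moreover have "\<not> ?J \<subseteq> P"
  proof
    assume "?J \<subseteq> P"
    then have "N \<subseteq> const_in P" using ND(1) by (auto simp: const_in_def)
    then show False using sub N(2) by blast
  qed
  \<comment> \<open>Constant terms all in P would put N inside \<open>const_in P\<close> and thus
    inside I; so they form a \<delta>-ideal strictly above P.\<close>
  ultimately have "\<not> ?J \<subseteq> Q" using core[OF const_terms_delta_ideal[OF N(1)]] by blast
  then obtain f where f: "f \<in> N" "f 0 \<notin> Q" by blast
  have fu: "f \<in> up R" using f ND(1) by blast
  define c where "c = f 0"
  have c: "c \<in> carrier R" "c \<notin> Q" using f fu by (simp_all add: c_def)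
  have key: False if g: "g \<in> induced Q"
    and cases: "(\<forall>n. f (Suc n) \<oplus> g n = \<zero>) \<or>
      (\<exists>k. f (Suc k) \<oplus> g k \<notin> Q \<and> (\<forall>n>k. f (Suc n) \<oplus> g n = \<zero>))" for g
  proof -
    \<comment> \<open>Adding g \<theta> with g in S Q stays in N and does not touch the constant
      term.\<close>
    define f' where "f' = (\<lambda>n. f n \<oplus> rshift g n)"
    have f'N: "f' \<in> N" using ND(3)[OF f(1)] rshift_I[OF g] N(2) by (auto simp: f'_def)
    have f'c: "f' n \<in> carrier R" for n using f'N ND(1) by auto
    have f'0: "f' 0 = c" using fu by (simp add: f'_def c_def)
    have f'S: "f' (Suc n) = f (Suc n) \<oplus> g n" for n by (simp add: f'_def)
    define e where "e = (\<lambda>n. c \<otimes> T f' n \<oplus> (\<ominus> \<delta> c) \<otimes> f' n)"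
    have eN: "e \<in> N" unfolding e_def
      by (intro ND(3,4,5) f'N a_inv_closed d_closed c)
    have "e 0 = \<zero>" using c f'0 by (simp add: e_def theta_mult_def l_minus r_minus m_comm r_neg)
    then have "e \<in> const_in P" using eN ND(1) P.zero_closed by (auto simp: const_in_def)
    then have "e \<in> I" using eN sub by blast
    then have sh: "(\<lambda>n. e (Suc n)) \<in> induced Q" by (simp add: I_def)
    have eS: "e (Suc n) = c \<otimes> (f' n \<oplus> \<delta> (f' (Suc n))) \<oplus> (\<ominus> \<delta> c) \<otimes> f' (Suc n)" for n
      by (simp add: e_def theta_mult_def)
    have eS0: "e (Suc n) = c \<otimes> f' n" if "f' (Suc n) = \<zero>" for n
      unfolding eS that using c f'c by simp
    show False using cases
    proof
      assume z: "\<forall>n. f (Suc n) \<oplus> g n = \<zero>"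
      \<comment> \<open>Here \<open>f'\<close> is the constant c, and e = c^2 \<theta>.\<close>
      have "e (Suc n) = \<zero>" if n: "n > 0" for n
      proof -
        obtain m where "n = Suc m" using n gr0_implies_Suc by blast
        then show ?thesis using eS0[of n] z c by (simp add: f'S)
      qed
      then have "e (Suc 0) \<in> Q" by (rule induced_lead[OF sh])
      moreover have "e (Suc 0) = c \<otimes> c" using eS0[of 0] z by (simp add: f'S f'0)
      ultimately have "c \<otimes> c \<in> Q" by simp
      then show False using Q'.I_prime c by blast
    next
      assume "\<exists>k. f (Suc k) \<oplus> g k \<notin> Q \<and> (\<forall>n>k. f (Suc n) \<oplus> g n = \<zero>)"
      then obtain k where k: "f' (Suc k) \<notin> Q" "\<And>n. n > k \<Longrightarrow> f' (Suc n) = \<zero>"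
        unfolding f'S by blast
      \<comment> \<open>As \<open>f'\<close> has degree k + 1, e has degree k + 2 and leading
        coefficient c times that of \<open>f'\<close>.\<close>
      have "e (Suc n) = \<zero>" if n: "n > Suc k" for n
      proof -
        obtain m where "n = Suc m" "m > k" using n by (cases n) auto
        then show ?thesis using eS0[of n] k(2)[of n] k(2)[of m] c by simp
      qed
      then have "e (Suc (Suc k)) \<in> Q" by (rule induced_lead[OF sh])
      then have "c \<otimes> f' (Suc k) \<in> Q" using eS0[of "Suc k"] k(2) by simp
      then show False using Q'.I_prime[OF c(1) f'c] c(2) k(1) by blast
    qed
  qed
  show False
  proof (rule normalize[OF lshift_up[OF fu]])
    fix g assume "g \<in> induced Q" "(\<lambda>n. f (Suc n) \<oplus> g n) = (\<lambda>n. \<zero>)"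
    then show False using key[of g] by meson
  next
    fix g e assume "g \<in> induced Q" "f (Suc e) \<oplus> g e \<notin> Q" "\<And>n. n > e \<Longrightarrow> f (Suc n) \<oplus> g n = \<zero>"
    then show False using key[of g] by blast
  qed
qed

lemma I_proper: "I \<subset> const_in P"
proof -
  \<comment> \<open>The witness \<open>rshift (cst \<one>)\<close> is \<theta> itself.\<close>
  have "rshift (cst \<one>) \<in> const_in P" by (simp add: const_in_def P.zero_closed)
  moreover have "rshift (cst \<one>) \<notin> I"
  proof
    assume "rshift (cst \<one>) \<in> I"
    then have "cst \<one> \<in> induced Q" by (simp add: I_def)
    then have "cst \<one> 0 \<in> Q" by (rule induced_lead) (simp add: dop_monom_def)
    then show False using one_notin by (simp add: dop_monom_def)
  qed
  moreover have "I \<subseteq> const_in P" by (auto simp: I_def)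
  ultimately show ?thesis by blast
qed

text \<open>A chain of \<delta>-ideals above P lifts to left ideals above I, and each \<delta>-ideal
  is recovered from the constants in its lift.\<close>

lemma delta_ideal_dcc:
  assumes dia: "diamond DR"
    and J: "\<And>k. delta_ideal R \<delta> (J k)" "\<And>k. P \<subseteq> J k" "\<And>k. J (Suc k) \<subseteq> J k"
  shows "\<exists>k. \<forall>m\<ge>k. J m = J k"
proof -
  have "\<exists>k. \<forall>m\<ge>k. const_in (J m) = const_in (J k)"
  proof (rule diamond_left_ideals[OF ring_diff_op_ring dia I_left_ideal
        const_in_left_ideal[OF P] I_proper I_simple I_essential const_in_left_ideal[OF J(1)]])
    show "I \<subseteq> const_in (J k)" for k using J(2) by (auto simp: I_def const_in_def)
    show "const_in (J (Suc k)) \<subseteq> const_in (J k)" for k using J(3) by (auto simp: const_in_def)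
  qed
  then obtain k where k: "\<And>m. m \<ge> k \<Longrightarrow> const_in (J m) = const_in (J k)" by blast
  have "x \<in> J n" if "x \<in> J m" "const_in (J m) = const_in (J n)" for x m n
  proof -
    have "x \<in> carrier R" using that(1) J(1) by (meson delta_ideal_def ideal.Icarr)
    then have "cst x \<in> up R" by (rule dop_monom_closed)
    then have "cst x \<in> const_in (J m)" using that(1) by (simp add: const_in_def) (simp add: dop_monom_def)
    then show ?thesis unfolding that(2) by (simp add: const_in_def dop_monom_def)
  qed
  then have "J m = J k" if "m \<ge> k" for m using k[OF that] by blast
  then show ?thesis by blast
qed

end

section \<open>Powers of a finitely generated ideal\<close>

text \<open>The set I y_1 + ... + I y_n + P. For I = R and P an ideal it is the ideal generated by P
  and the list; I = M gives the sums that occur in Nakayama's lemma.\<close>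

primrec lin :: "('a, 'x) ring_scheme \<Rightarrow> 'a set \<Rightarrow> 'a set \<Rightarrow> 'a list \<Rightarrow> 'a set" where
  "lin R I P [] = P"
| "lin R I P (y # ys) = {m \<otimes>\<^bsub>R\<^esub> y \<oplus>\<^bsub>R\<^esub> l | m l. m \<in> I \<and> l \<in> lin R I P ys}"

context cring
begin

lemma idealI_left:
  assumes "J \<subseteq> carrier R" "\<zero> \<in> J" "\<And>x y. x \<in> J \<Longrightarrow> y \<in> J \<Longrightarrow> x \<oplus> y \<in> J"
    "\<And>r x. r \<in> carrier R \<Longrightarrow> x \<in> J \<Longrightarrow> r \<otimes> x \<in> J"
  shows "ideal J R"
proof (rule idealI[OF ring_axioms])
  show "subgroup J (add_monoid R)"
  proof (rule add.subgroupI)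
    fix x assume x: "x \<in> J"
    then have "\<ominus> x = \<ominus> \<one> \<otimes> x" using assms(1) by (auto simp: l_minus)
    then show "\<ominus> x \<in> J" using assms(4)[of "\<ominus> \<one>" x] x by simp
  qed (use assms in auto)
  show "x \<otimes> r \<in> J" if "x \<in> J" "r \<in> carrier R" for x r
    using assms(4)[OF that(2,1)] m_comm[of x r] that assms(1) by auto
qed (use assms in auto)

lemma lin_ideal:
  assumes I: "ideal I R" and P: "ideal P R" and ys: "set ys \<subseteq> carrier R"
  shows "ideal (lin R I P ys) R"
  using ys
proof (induction ys)
  case (Cons y ys)
  interpret I: ideal I R by fact
  interpret L: ideal "lin R I P ys" R using Cons by simp
  have y: "y \<in> carrier R" using Cons.prems by simp
  show ?case
  proof (rule idealI_left)
    show "lin R I P (y # ys) \<subseteq> carrier R" using y by (auto intro: I.Icarr L.Icarr)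
    have "\<zero> \<otimes> y \<oplus> \<zero> \<in> lin R I P (y # ys)"
      using I.zero_closed L.zero_closed unfolding lin.simps by blast
    then show "\<zero> \<in> lin R I P (y # ys)" using y by simp
  next
    fix a b assume "a \<in> lin R I P (y # ys)" "b \<in> lin R I P (y # ys)"
    then obtain m l m' l' where *: "m \<in> I" "l \<in> lin R I P ys" "a = m \<otimes> y \<oplus> l"
      "m' \<in> I" "l' \<in> lin R I P ys" "b = m' \<otimes> y \<oplus> l'" by auto
    have "m \<in> carrier R" "m' \<in> carrier R" "l \<in> carrier R" "l' \<in> carrier R"
      using * I.Icarr L.Icarr by auto
    then have "a \<oplus> b = (m \<oplus> m') \<otimes> y \<oplus> (l \<oplus> l')" unfolding *(3,6) using y by algebra
    moreover have "m \<oplus> m' \<in> I" "l \<oplus> l' \<in> lin R I P ys"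
      using * I.a_closed L.a_closed by auto
    ultimately show "a \<oplus> b \<in> lin R I P (y # ys)" unfolding lin.simps by blast
  next
    fix r a assume r: "r \<in> carrier R" and "a \<in> lin R I P (y # ys)"
    then obtain m l where *: "m \<in> I" "l \<in> lin R I P ys" "a = m \<otimes> y \<oplus> l" by auto
    have "m \<in> carrier R" "l \<in> carrier R" using * I.Icarr L.Icarr by auto
    then have "r \<otimes> a = (r \<otimes> m) \<otimes> y \<oplus> r \<otimes> l" unfolding *(3) using y r by algebra
    moreover have "r \<otimes> m \<in> I" "r \<otimes> l \<in> lin R I P ys"
      using * r I.I_l_closed L.I_l_closed by auto
    ultimately show "r \<otimes> a \<in> lin R I P (y # ys)" unfolding lin.simps by blast
  qed
qed (simp add: P)

lemma lin_base:
  assumes "ideal I R" "ideal P R" "set ys \<subseteq> carrier R"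
  shows "P \<subseteq> lin R I P ys"
  using assms(3)
proof (induction ys)
  case (Cons y ys)
  interpret P: ideal P R by fact
  interpret I: ideal I R by fact
  have y: "y \<in> carrier R" using Cons.prems by simp
  show ?case
  proof
    fix p assume p: "p \<in> P"
    then have "p = \<zero> \<otimes> y \<oplus> p" using P.Icarr y by simp
    moreover have "p \<in> lin R I P ys" using Cons p by auto
    ultimately show "p \<in> lin R I P (y # ys)" using I.zero_closed unfolding lin.simps by blast
  qed
qed simp

lemma lin_elem:
  assumes "ideal I R" "ideal P R" "set ys \<subseteq> carrier R" "m \<in> I" "y \<in> set ys"
  shows "m \<otimes> y \<in> lin R I P ys"
  using assms(3,5)
proof (induction ys)
  case (Cons z ys)
  interpret I: ideal I R by fact
  interpret L: ideal "lin R I P ys" R using Cons.prems by (intro lin_ideal assms) simp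
  have z: "z \<in> carrier R" and m: "m \<in> carrier R" using Cons.prems assms(4) I.Icarr by auto
  show ?case
  proof (cases "y = z")
    case True
    then have "m \<otimes> y = m \<otimes> z \<oplus> \<zero>" using z m by simp
    then show ?thesis using assms(4) L.zero_closed unfolding lin.simps by blast
  next
    case False
    then have "m \<otimes> y \<in> lin R I P ys" using Cons by simp
    moreover from this have "m \<otimes> y = \<zero> \<otimes> z \<oplus> m \<otimes> y" using z L.Icarr by simp
    ultimately show ?thesis using I.zero_closed unfolding lin.simps by blast
  qed
qed simp

lemma lin_least:
  assumes "I \<subseteq> carrier R" "ideal J R" "P \<subseteq> J" "set ys \<subseteq> J"
  shows "lin R I P ys \<subseteq> J"
  using assms(4)
proof (induction ys)
  case (Cons y ys)
  interpret J: ideal J R by fact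
  show ?case using Cons assms(1) by (auto intro!: J.a_closed J.I_l_closed)
qed (simp add: assms)

text \<open>With the colon ideal (J : y), a claim about products with y needs checking only on
  generators, through \<open>lin_least\<close>.\<close>

lemma colon_ideal:
  assumes "ideal J R" "y \<in> carrier R"
  shows "ideal {z \<in> carrier R. y \<otimes> z \<in> J} R"
proof (rule idealI_left)
  interpret J: ideal J R by fact
  show "\<zero> \<in> {z \<in> carrier R. y \<otimes> z \<in> J}" using assms(2) J.zero_closed by simp
  show "r \<otimes> x \<in> {z \<in> carrier R. y \<otimes> z \<in> J}"
    if "r \<in> carrier R" "x \<in> {z \<in> carrier R. y \<otimes> z \<in> J}" for r x
    using that assms(2) J.I_l_closed[of "y \<otimes> x" r] by (simp add: m_lcomm)
qed (use assms ideal.axioms(1)[OF assms(1)] in \<open>auto simp: r_distr additive_subgroup.a_closed\<close>)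

text \<open>Modulo \<open>P\<close> and up to factors outside \<open>M\<close>, the generators are eliminated one by one.\<close>

lemma nakayama:
  assumes M: "primeideal M R" and P: "ideal P R"
  shows "set ys \<subseteq> carrier R \<Longrightarrow>
    (\<And>y. y \<in> set ys \<Longrightarrow> \<exists>s\<in>carrier R. s \<notin> M \<and> s \<otimes> y \<in> lin R M P ys) \<Longrightarrow>
    \<exists>s\<in>carrier R. s \<notin> M \<and> (\<forall>y\<in>set ys. s \<otimes> y \<in> P)"
proof (induction ys)
  case Nil
  interpret M: primeideal M R by fact
  show ?case using M.one_imp_carrier M.I_notcarr by auto
next
  case (Cons y ys)
  interpret M: primeideal M R by fact
  interpret P: ideal P R by fact
  have ys: "set ys \<subseteq> carrier R" and y: "y \<in> carrier R" using Cons.prems by auto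
  interpret L: ideal "lin R M P ys" R by (rule lin_ideal[OF M.is_ideal P ys])
  obtain s where s: "s \<in> carrier R" "s \<notin> M" "s \<otimes> y \<in> lin R M P (y # ys)"
    using Cons.prems(2)[of y] by auto
  then obtain m l where m: "m \<in> M" "l \<in> lin R M P ys" "s \<otimes> y = m \<otimes> y \<oplus> l" by auto
  have c: "m \<in> carrier R" "l \<in> carrier R" using m M.Icarr L.Icarr by auto
  \<comment> \<open>Moving m y to the other side replaces s by s - m, still outside M, and leaves y
    expressed by the remaining generators.\<close>
  define s1 where "s1 = s \<ominus> m"
  have s1: "s1 \<in> carrier R" using s c by (simp add: s1_def)
  have s1M: "s1 \<notin> M"
  proof
    assume "s1 \<in> M"
    then have "s1 \<oplus> m \<in> M" using m(1) by (rule M.a_closed)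
    moreover have "s1 \<oplus> m = s" unfolding s1_def using s(1) c(1) by algebra
    ultimately show False using s by simp
  qed
  have "s1 \<otimes> y = s \<otimes> y \<ominus> m \<otimes> y" unfolding s1_def using s c y by algebra
  also have "\<dots> = l" unfolding m(3) using c y by algebra
  finally have s1y: "s1 \<otimes> y = l" .
  have "\<exists>s\<in>carrier R. s \<notin> M \<and> s \<otimes> x \<in> lin R M P ys" if x: "x \<in> set ys" for x
  proof -
    have xc: "x \<in> carrier R" using x ys by blast
    obtain s' where s': "s' \<in> carrier R" "s' \<notin> M" "s' \<otimes> x \<in> lin R M P (y # ys)"
      using Cons.prems(2)[of x] x by auto
    then obtain m' l' where m': "m' \<in> M" "l' \<in> lin R M P ys" "s' \<otimes> x = m' \<otimes> y \<oplus> l'" by auto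
    have c': "m' \<in> carrier R" "l' \<in> carrier R" using m' M.Icarr L.Icarr by auto
    have "(s1 \<otimes> s') \<otimes> x = s1 \<otimes> (s' \<otimes> x)" using s1 s' xc by (simp add: m_assoc)
    also have "\<dots> = m' \<otimes> (s1 \<otimes> y) \<oplus> s1 \<otimes> l'"
      unfolding m'(3) using s1 c' y by algebra
    also have "\<dots> \<in> lin R M P ys"
      unfolding s1y using m' m(2) s1 c' by (intro L.a_closed L.I_l_closed)
    finally have "(s1 \<otimes> s') \<otimes> x \<in> lin R M P ys" .
    moreover have "s1 \<otimes> s' \<notin> M" using M.I_prime[OF s1 s'(1)] s1M s'(2) by blast
    ultimately show ?thesis using s1 s'(1) by blast
  qed
  then obtain t where t: "t \<in> carrier R" "t \<notin> M" "\<And>x. x \<in> set ys \<Longrightarrow> t \<otimes> x \<in> P"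
    using Cons.IH[OF ys] by blast
  \<comment> \<open>As t carries the remaining generators into P, it carries their combination l =
    \<open>s1\<close> y into P as well.\<close>
  have "lin R M P ys \<subseteq> {z \<in> carrier R. t \<otimes> z \<in> P}"
    using t ys P.Icarr P.I_l_closed by (intro lin_least colon_ideal P) (auto intro: M.Icarr)
  then have "t \<otimes> l \<in> P" using m(2) by blast
  then have "(t \<otimes> s1) \<otimes> y \<in> P" using s1y t s1 y by (simp add: m_assoc)
  moreover have "(t \<otimes> s1) \<otimes> x \<in> P" if x: "x \<in> set ys" for x
  proof -
    have "(t \<otimes> s1) \<otimes> x = s1 \<otimes> (t \<otimes> x)" using t s1 x ys by (simp add: m_ac subset_iff)
    then show ?thesis using t(3)[OF x] s1 P.I_l_closed by simp
  qed
  moreover have "t \<otimes> s1 \<notin> M" using M.I_prime[OF t(1) s1] s1M t(2) by blast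
  ultimately show ?case using t(1) s1 by (intro bexI[of _ "t \<otimes> s1"]) auto
qed

lemma tower_least:
  assumes "subring B R" "A \<subseteq> B" "set cs \<subseteq> B"
  shows "tower R A cs \<subseteq> B"
  using assms(3)
proof (induction cs)
  case (Cons c cs)
  note B = subringE[OF assms(1)]
  have pow: "c [^] (n::nat) \<in> B" for n
    using Cons.prems B by (induction n) auto
  have "poly_span R (tower R A cs) c d \<subseteq> B" for d
    using Cons B pow by (induction d) (auto intro!: B(6,7))
  then show ?case by (auto simp: adjoin_def)
qed (simp add: assms)

end

text \<open>Reduces \<delta>-stability of J to generators: J is stable once this smaller ideal
  contains a generating set of J.\<close>

lemma (in deriv_ring) stable_part_ideal:
  assumes "cring R" "ideal J R"
  shows "ideal {x \<in> J. \<delta> x \<in> J} R"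
proof -
  interpret cring R by fact
  interpret J: ideal J R by fact
  show ?thesis
    by (rule idealI_left)
      (use J.zero_closed J.Icarr J.I_l_closed J.I_r_closed in \<open>auto simp: d_add d_mult\<close>)
qed

text \<open>The k-fold products of entries, which generate the k-th power of the ideal generated by
  the list. They are kept in a list because Nakayama's lemma eliminates generators one at a
  time.\<close>

primrec list_powers :: "('a, 'x) ring_scheme \<Rightarrow> 'a list \<Rightarrow> nat \<Rightarrow> 'a list" where
  "list_powers R ds 0 = [\<one>\<^bsub>R\<^esub>]"
| "list_powers R ds (Suc k) = concat (map (\<lambda>d. map (\<lambda>x. d \<otimes>\<^bsub>R\<^esub> x) (list_powers R ds k)) ds)"

section \<open>Powers of the ideal generated by the derivatives\<close>

context affine_deriv
begin

abbreviation "ds \<equiv> map \<delta> cs"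
abbreviation "X \<equiv> list_powers R ds"
abbreviation "D \<equiv> lin R (carrier R) {\<zero>} ds"

lemma ds_closed: "set ds \<subseteq> carrier R"
  using gens(1) by auto

lemma X_closed: "set (X k) \<subseteq> carrier R"
  using ds_closed by (induction k) auto

lemma D_ideal: "ideal D R"
  by (rule lin_ideal[OF oneideal zeroideal ds_closed])

lemma ds_D:
  assumes "d \<in> set ds" shows "d \<in> D"
proof -
  have "d \<in> carrier R" using assms ds_closed by blast
  then show ?thesis using lin_elem[OF oneideal zeroideal ds_closed one_closed assms] by simp
qed

text \<open>By the product rule the elements with derivative in D form a subring, and it contains A
  and the generators of R.\<close>

lemma deriv_D: "x \<in> carrier R \<Longrightarrow> \<delta> x \<in> D"
proof -
  interpret D: ideal D R by (rule D_ideal)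
  have "subring {x \<in> carrier R. \<delta> x \<in> D} R"
    by (rule subringI)
      (auto simp: d_add d_mult d_minus D.I_l_closed D.I_r_closed D.zero_closed)
  moreover have "A \<subseteq> {x \<in> carrier R. \<delta> x \<in> D}"
    using subringE(1)[OF base] d_base D.zero_closed by auto
  moreover have "set cs \<subseteq> {x \<in> carrier R. \<delta> x \<in> D}" using gens(1) ds_D by auto
  ultimately have "tower R A cs \<subseteq> {x \<in> carrier R. \<delta> x \<in> D}" by (rule tower_least)
  then show "x \<in> carrier R \<Longrightarrow> \<delta> x \<in> D" using gens(2) by blast
qed

text \<open>\<open>J k = D\<^sup>k + P\<close>, where \<open>D\<close> is the ideal generated by \<open>\<delta>(R)\<close>.\<close>

context
  fixes P assumes P: "delta_ideal R \<delta> P"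
begin

abbreviation "J k \<equiv> lin R (carrier R) P (X k)"

lemma P_ideal: "ideal P R"
  using P by (simp add: delta_ideal_def)

lemma J_ideal: "ideal (J k) R"
  by (rule lin_ideal[OF oneideal P_ideal X_closed])

lemma P_J: "P \<subseteq> J k"
  by (rule lin_base[OF oneideal P_ideal X_closed])

lemma X_J:
  assumes "x \<in> set (X k)" shows "x \<in> J k"
proof -
  have "x \<in> carrier R" using assms X_closed by blast
  then show ?thesis using lin_elem[OF oneideal P_ideal X_closed one_closed assms] by simp
qed

lemma D_mult_X:
  assumes "z \<in> D" "x \<in> set (X k)" shows "z \<otimes> x \<in> J (Suc k)"
proof -
  have x: "x \<in> carrier R" using assms(2) X_closed by blast
  have "D \<subseteq> {z \<in> carrier R. x \<otimes> z \<in> J (Suc k)}"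
  proof (rule lin_least[OF subset_refl colon_ideal[OF J_ideal x]])
    show "{\<zero>} \<subseteq> {z \<in> carrier R. x \<otimes> z \<in> J (Suc k)}"
      using x additive_subgroup.zero_closed[OF ideal.axioms(1)[OF J_ideal]]
      by (simp del: list_powers.simps)
    show "set ds \<subseteq> {z \<in> carrier R. x \<otimes> z \<in> J (Suc k)}"
    proof
      fix d assume d: "d \<in> set ds"
      then have "d \<otimes> x \<in> set (X (Suc k))" using assms(2) by auto
      then have "d \<otimes> x \<in> J (Suc k)" by (rule X_J)
      moreover have "d \<in> carrier R" using d ds_closed by blast
      ultimately show "d \<in> {z \<in> carrier R. x \<otimes> z \<in> J (Suc k)}" using x by (simp add: m_comm)
    qed
  qed
  then have "x \<otimes> z \<in> J (Suc k)" "z \<in> carrier R" using assms(1) by blast+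
  then show ?thesis using x by (simp add: m_comm)
qed

lemma ds_mult_J:
  assumes "d \<in> set ds" "z \<in> J k" shows "d \<otimes> z \<in> J (Suc k)"
proof -
  interpret J: ideal "J (Suc k)" R by (rule J_ideal)
  have d: "d \<in> carrier R" using assms(1) ds_closed by blast
  have "J k \<subseteq> {z \<in> carrier R. d \<otimes> z \<in> J (Suc k)}"
  proof (rule lin_least[OF subset_refl colon_ideal[OF J_ideal d]])
    show "P \<subseteq> {z \<in> carrier R. d \<otimes> z \<in> J (Suc k)}"
      using P_J d J.Icarr J.I_l_closed by blast
    show "set (X k) \<subseteq> {z \<in> carrier R. d \<otimes> z \<in> J (Suc k)}"
      using X_closed[of k] D_mult_X[OF ds_D[OF assms(1)]] by blast
  qed
  then show ?thesis using assms(2) by blast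
qed

text \<open>In \<delta>(d y) = \<delta>(d) y + d \<delta>(y) no power is lost: \<delta>(d) is again
  in D, and \<delta>(y) is in \<open>J k\<close> by induction.\<close>

lemma J_stable: "delta_ideal R \<delta> (J k)"
proof -
  have X: "\<delta> x \<in> J k" if "x \<in> set (X k)" for x
    using that
  proof (induction k arbitrary: x)
    case 0
    then show ?case
      using additive_subgroup.zero_closed[OF ideal.axioms(1)[OF J_ideal[of 0]]] by simp
  next
    case (Suc k)
    then obtain d y where d: "d \<in> set ds" "y \<in> set (X k)" "x = d \<otimes> y" by auto
    have c: "d \<in> carrier R" "y \<in> carrier R" using d ds_closed X_closed by blast+
    have "\<delta> x = \<delta> d \<otimes> y \<oplus> d \<otimes> \<delta> y" unfolding d(3) by (rule d_mult[OF c])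
    also have "\<dots> \<in> J (Suc k)"
      by (rule additive_subgroup.a_closed[OF ideal.axioms(1)[OF J_ideal]
            D_mult_X[OF deriv_D[OF c(1)] d(2)] ds_mult_J[OF d(1) Suc.IH[OF d(2)]]])
    finally show ?case .
  qed
  have "J k \<subseteq> {x \<in> J k. \<delta> x \<in> J k}"
  proof (rule lin_least[OF subset_refl stable_part_ideal[OF is_cring J_ideal]])
    show "P \<subseteq> {x \<in> J k. \<delta> x \<in> J k}" using P P_J by (auto simp: delta_ideal_def)
    show "set (X k) \<subseteq> {x \<in> J k. \<delta> x \<in> J k}" using X X_J by blast
  qed
  then show ?thesis using J_ideal by (auto simp: delta_ideal_def)
qed

lemma J_Suc: "J (Suc k) \<subseteq> J k"
proof (rule lin_least[OF subset_refl J_ideal P_J])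
  interpret J: ideal "J k" R by (rule J_ideal)
  show "set (X (Suc k)) \<subseteq> J k"
    using ds_closed X_J[of _ k] J.I_l_closed by auto
qed

text \<open>Entries of \<open>ds\<close> lie in M, so equality would express every k-fold product as
  an M-combination of k-fold products modulo P. Nakayama's lemma and primality then force all of
  these into P, whereas powers of an entry outside P stay outside.\<close>

lemma J_strict:
  assumes prime: "primeideal P R" and nonzero: "\<not> \<delta> ` carrier R \<subseteq> P"
    and M: "primeideal M R" "\<delta> ` carrier R \<subseteq> M" "P \<subseteq> M"
  shows "J (Suc k) \<noteq> J k"
proof
  assume eq: "J (Suc k) = J k"
  interpret P: primeideal P R by fact
  interpret M: primeideal M R by fact
  have dsM: "set ds \<subseteq> M" using M(2) gens(1) by auto
  have L: "ideal (lin R M P (X k)) R" by (rule lin_ideal[OF M.is_ideal P_ideal X_closed])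
  have "set (X (Suc k)) \<subseteq> lin R M P (X k)"
    using dsM lin_elem[OF M.is_ideal P_ideal X_closed] by auto
  then have "J (Suc k) \<subseteq> lin R M P (X k)"
    by (rule lin_least[OF subset_refl L lin_base[OF M.is_ideal P_ideal X_closed]])
  then have sub: "x \<in> lin R M P (X k)" if "x \<in> set (X k)" for x
    using X_J[OF that] eq by blast
  have "\<one> \<notin> M" using M.one_imp_carrier M.I_notcarr by blast
  have "\<exists>s\<in>carrier R. s \<notin> M \<and> (\<forall>y\<in>set (X k). s \<otimes> y \<in> P)"
  proof (rule nakayama[OF M(1) P_ideal X_closed])
    show "\<exists>s\<in>carrier R. s \<notin> M \<and> s \<otimes> x \<in> lin R M P (X k)" if x: "x \<in> set (X k)" for x
    proof (intro bexI[of _ \<one>] conjI)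
      have "x \<in> carrier R" using x X_closed by blast
      then show "\<one> \<otimes> x \<in> lin R M P (X k)" using sub[OF x] by simp
    qed (use \<open>\<one> \<notin> M\<close> in auto)
  qed
  then obtain s where s: "s \<in> carrier R" "s \<notin> M" "\<And>y. y \<in> set (X k) \<Longrightarrow> s \<otimes> y \<in> P" by blast
  \<comment> \<open>Since s is outside M, it is outside P, and the prime P allows it to be
    cancelled.\<close>
  have XP: "y \<in> P" if y: "y \<in> set (X k)" for y
  proof -
    have "y \<in> carrier R" using y X_closed by blast
    then show ?thesis using P.I_prime[OF s(1)] s(3)[OF y] s(2) M(3) by blast
  qed
  have "\<not> set ds \<subseteq> P"
  proof
    assume "set ds \<subseteq> P"
    then have "D \<subseteq> P"
      using P.zero_closed by (intro lin_least[OF subset_refl P_ideal]) auto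
    then show False using deriv_D nonzero by blast
  qed
  then obtain d where d: "d \<in> set ds" "d \<notin> P" by blast
  have dc: "d \<in> carrier R" using d ds_closed by blast
  have "\<exists>x\<in>set (X k). x \<notin> P" for k
  proof (induction k)
    case 0
    then show ?case using P.one_imp_carrier P.I_notcarr by auto
  next
    case (Suc k)
    then obtain x where x: "x \<in> set (X k)" "x \<notin> P" by blast
    have "x \<in> carrier R" using x X_closed by blast
    then have "d \<otimes> x \<notin> P" using P.I_prime[OF dc] x d by blast
    moreover have "d \<otimes> x \<in> set (X (Suc k))" using x d by auto
    ultimately show ?case by blast
  qed
  then show False using XP by blast
qed

end

theorem deriv_subset_prime:
  assumes M: "maximalideal M R" "delta_ideal R \<delta> M"
    and P: "primeideal P R" "delta_ideal R \<delta> P" "P \<subseteq> M"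
    and height: "height R P + 1 = krull_dim R"
    and diamond: "diamond (diff_op_ring R \<delta>)"
  shows "\<delta> ` carrier R \<subseteq> P"
proof (rule ccontr)
  assume nonzero: "\<not> \<delta> ` carrier R \<subseteq> P"
  have dim: "\<not> Q1 \<subset> Q2" if "primeideal Q1 R" "primeideal Q2 R" "P \<subset> Q1" for Q1 Q2
    using no_longer_chain[OF P(1) height that] by blast
  obtain Q where Q: "primeideal Q R" "P \<subseteq> Q" "\<not> \<delta> ` Q \<subseteq> Q"
    and inverse: "\<And>r. r \<in> carrier R \<Longrightarrow> r \<notin> Q \<Longrightarrow> \<exists>s\<in>carrier R. s \<otimes> r \<ominus> \<one> \<in> Q"
    and core: "\<And>J. delta_ideal R \<delta> J \<Longrightarrow> P \<subset> J \<Longrightarrow> \<not> J \<subseteq> Q"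
    using exists_unstable_maximal[OF P(1,2) dim nonzero] by blast
  note P' = P
  interpret prime_pair R \<delta> Q P
  proof (intro prime_pair.intro deriv_ideal.intro prime_pair_axioms.intro deriv_ideal_axioms.intro)
    show "deriv_ring R \<delta>" ..
    show "ideal Q R" using Q(1) by (rule primeideal.axioms(1))
    show "cring R" ..
  qed (use Q P char_notin[OF Q(1)] inverse core in auto)
  \<comment> \<open>All derivatives lie in M, which is what Nakayama's lemma at M requires.\<close>
  have MR: "\<delta> ` carrier R \<subseteq> M"
    using maximal_deriv[OF M(1)] M(2) by (simp add: delta_ideal_def)
  have "\<exists>k. \<forall>m\<ge>k. J P m = J P k"
    by (rule delta_ideal_dcc[where J = "\<lambda>k. J P k"])
      (rule diamond J_stable[OF P'(2)] P_J[OF P'(2)] J_Suc[OF P'(2)])+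
  then obtain k where k: "\<forall>m\<ge>k. J P m = J P k" ..
  have "J P (Suc k) = J P k" by (rule k[rule_format, OF le_SucI[OF order_refl]])
  then show False
    by (rule notE[OF J_strict[OF P'(2,1) nonzero maximalideal_prime[OF M(1)] MR P'(3)]])
qed

end

section \<open>From affine algebras over a field to towers over the subring of scalars\<close>

lemma scalar_subring:
  fixes R (structure)
  assumes "algebra R M"
  shows "subring ((\<lambda>k. k \<odot>\<^bsub>M\<^esub> \<one>\<^bsub>M\<^esub>) ` carrier R) M"
proof -
  interpret M: cring M by (rule algebra.M_cring[OF assms])
  interpret algebra R M by fact
  show ?thesis
  proof (rule M.subringI)
    fix x y assume "x \<in> (\<lambda>k. k \<odot>\<^bsub>M\<^esub> \<one>\<^bsub>M\<^esub>) ` carrier R" "y \<in> (\<lambda>k. k \<odot>\<^bsub>M\<^esub> \<one>\<^bsub>M\<^esub>) ` carrier R"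
    then obtain a b where ab: "a \<in> carrier R" "b \<in> carrier R" "x = a \<odot>\<^bsub>M\<^esub> \<one>\<^bsub>M\<^esub>" "y = b \<odot>\<^bsub>M\<^esub> \<one>\<^bsub>M\<^esub>"
      by blast
    have "x \<otimes>\<^bsub>M\<^esub> y = (a \<otimes> b) \<odot>\<^bsub>M\<^esub> \<one>\<^bsub>M\<^esub>"
      using ab by (simp add: smult_assoc2 smult_assoc1)
    then show "x \<otimes>\<^bsub>M\<^esub> y \<in> (\<lambda>k. k \<odot>\<^bsub>M\<^esub> \<one>\<^bsub>M\<^esub>) ` carrier R" using ab by blast
    have "x \<oplus>\<^bsub>M\<^esub> y = (a \<oplus> b) \<odot>\<^bsub>M\<^esub> \<one>\<^bsub>M\<^esub>"
      using ab by (simp add: smult_l_distr)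
    then show "x \<oplus>\<^bsub>M\<^esub> y \<in> (\<lambda>k. k \<odot>\<^bsub>M\<^esub> \<one>\<^bsub>M\<^esub>) ` carrier R" using ab by blast
  next
    fix x assume "x \<in> (\<lambda>k. k \<odot>\<^bsub>M\<^esub> \<one>\<^bsub>M\<^esub>) ` carrier R"
    then obtain a where a: "a \<in> carrier R" "x = a \<odot>\<^bsub>M\<^esub> \<one>\<^bsub>M\<^esub>" by blast
    then have "\<ominus>\<^bsub>M\<^esub> x = (\<ominus> a) \<odot>\<^bsub>M\<^esub> \<one>\<^bsub>M\<^esub>" by (simp add: smult_l_minus)
    then show "\<ominus>\<^bsub>M\<^esub> x \<in> (\<lambda>k. k \<odot>\<^bsub>M\<^esub> \<one>\<^bsub>M\<^esub>) ` carrier R" using a by blast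
  next
    have "\<one>\<^bsub>M\<^esub> = \<one> \<odot>\<^bsub>M\<^esub> \<one>\<^bsub>M\<^esub>" by simp
    then show "\<one>\<^bsub>M\<^esub> \<in> (\<lambda>k. k \<odot>\<^bsub>M\<^esub> \<one>\<^bsub>M\<^esub>) ` carrier R" by blast
  qed auto
qed

text \<open>The tower over the scalars is a K-subalgebra containing the given generators, so the
  definition of an affine algebra makes it all of R. Characteristic zero makes positive integers
  nonzero scalars of a field, hence units of R.\<close>

lemma affine_deriv_exists:
  assumes K: "field K" "char_zero K" and R: "affine_algebra K R" and d: "K_derivation K R \<delta>"
  obtains cs where "affine_deriv R \<delta> ((\<lambda>k. k \<odot>\<^bsub>R\<^esub> \<one>\<^bsub>R\<^esub>) ` carrier K) cs"
proof -
  interpret K: field K by fact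
  have alg: "algebra K R" using R by (simp add: affine_algebra_def)
  interpret R: cring R by (rule algebra.M_cring[OF alg])
  interpret A: algebra K R by (rule alg)
  interpret dr: deriv_ring R \<delta>
    by (intro deriv_ring.intro deriv_ring_axioms.intro R.ring_axioms)
      (use d in \<open>simp add: K_derivation_def\<close>)
  let ?A = "(\<lambda>k. k \<odot>\<^bsub>R\<^esub> \<one>\<^bsub>R\<^esub>) ` carrier K"
  note sub = scalar_subring[OF alg]
  obtain G where G: "finite G" "G \<subseteq> carrier R"
    "\<forall>B. subring B R \<and> (\<forall>k\<in>carrier K. \<forall>b\<in>B. k \<odot>\<^bsub>R\<^esub> b \<in> B) \<and> G \<subseteq> B \<longrightarrow> B = carrier R"
    using R unfolding affine_algebra_def by (elim conjE exE) (rule that)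
  obtain cs where cs: "set cs = G" using finite_list[OF G(1)] by blast
  have csc: "set cs \<subseteq> carrier R" using cs G(2) by simp
  have T: "subring (tower R ?A cs) R" by (rule R.tower_subring[OF sub csc])
  have base: "?A \<subseteq> tower R ?A cs \<and> set cs \<subseteq> tower R ?A cs"
    using csc
  proof (induction cs)
    case (Cons c cs)
    then interpret cring_adjoin R "tower R ?A cs" c
      by (intro R.cring_adjoinI R.tower_subring sub) auto
    show ?case using Cons A_adjoin c_adjoin by auto
  qed simp
  have gen: "tower R ?A cs = carrier R"
  proof (rule G(3)[rule_format], intro conjI T)
    show "G \<subseteq> tower R ?A cs" using base cs by simp
    show "\<forall>k\<in>carrier K. \<forall>b\<in>tower R ?A cs. k \<odot>\<^bsub>R\<^esub> b \<in> tower R ?A cs"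
    proof (intro ballI)
      fix k b assume k: "k \<in> carrier K" and b: "b \<in> tower R ?A cs"
      have bc: "b \<in> carrier R" using subringE(1)[OF T] b by blast
      have "k \<odot>\<^bsub>R\<^esub> b = (k \<odot>\<^bsub>R\<^esub> \<one>\<^bsub>R\<^esub>) \<otimes>\<^bsub>R\<^esub> b" using k bc by (simp add: A.smult_assoc2)
      moreover have "k \<odot>\<^bsub>R\<^esub> \<one>\<^bsub>R\<^esub> \<in> tower R ?A cs" using base k by blast
      ultimately show "k \<odot>\<^bsub>R\<^esub> b \<in> tower R ?A cs" using subringE(6)[OF T _ b] by simp
    qed
  qed
  have unit: "k \<odot>\<^bsub>R\<^esub> \<one>\<^bsub>R\<^esub> \<in> Units R" if k: "k \<in> carrier K" "k \<noteq> \<zero>\<^bsub>K\<^esub>" for k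
  proof -
    have u: "k \<in> Units K" using k K.field_Units by blast
    then have i: "inv\<^bsub>K\<^esub> k \<in> carrier K" by simp
    have "(inv\<^bsub>K\<^esub> k \<odot>\<^bsub>R\<^esub> \<one>\<^bsub>R\<^esub>) \<otimes>\<^bsub>R\<^esub> (k \<odot>\<^bsub>R\<^esub> \<one>\<^bsub>R\<^esub>) = (inv\<^bsub>K\<^esub> k \<otimes>\<^bsub>K\<^esub> k) \<odot>\<^bsub>R\<^esub> \<one>\<^bsub>R\<^esub>"
      using i k by (simp add: A.smult_assoc2 A.smult_assoc1)
    also have "\<dots> = \<one>\<^bsub>R\<^esub>" using u by simp
    finally have l: "(inv\<^bsub>K\<^esub> k \<odot>\<^bsub>R\<^esub> \<one>\<^bsub>R\<^esub>) \<otimes>\<^bsub>R\<^esub> (k \<odot>\<^bsub>R\<^esub> \<one>\<^bsub>R\<^esub>) = \<one>\<^bsub>R\<^esub>" .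
    have c: "inv\<^bsub>K\<^esub> k \<odot>\<^bsub>R\<^esub> \<one>\<^bsub>R\<^esub> \<in> carrier R" "k \<odot>\<^bsub>R\<^esub> \<one>\<^bsub>R\<^esub> \<in> carrier R" using i k by auto
    then have r: "(k \<odot>\<^bsub>R\<^esub> \<one>\<^bsub>R\<^esub>) \<otimes>\<^bsub>R\<^esub> (inv\<^bsub>K\<^esub> k \<odot>\<^bsub>R\<^esub> \<one>\<^bsub>R\<^esub>) = \<one>\<^bsub>R\<^esub>"
      using l R.m_comm by simp
    show ?thesis using l r c unfolding Units_def by blast
  qed
  have "affine_deriv R \<delta> ?A cs"
  proof (intro affine_deriv.intro affine_deriv_axioms.intro sub csc gen)
    show "cring R" ..
    show "deriv_ring R \<delta>" ..
    show "?A - {\<zero>\<^bsub>R\<^esub>} \<subseteq> Units R"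
    proof
      fix a assume a: "a \<in> ?A - {\<zero>\<^bsub>R\<^esub>}"
      then obtain k where k: "k \<in> carrier K" "a = k \<odot>\<^bsub>R\<^esub> \<one>\<^bsub>R\<^esub>" by blast
      then have "k \<noteq> \<zero>\<^bsub>K\<^esub>" using a A.smult_l_null[OF R.one_closed] by auto
      then show "a \<in> Units R" unfolding k(2) by (rule unit[OF k(1)])
    qed
    show "[n] \<cdot>\<^bsub>R\<^esub> \<one>\<^bsub>R\<^esub> \<in> Units R" if "n > 0" for n :: nat
    proof -
      have "[n] \<cdot>\<^bsub>R\<^esub> \<one>\<^bsub>R\<^esub> = ([n] \<cdot>\<^bsub>K\<^esub> \<one>\<^bsub>K\<^esub>) \<odot>\<^bsub>R\<^esub> \<one>\<^bsub>R\<^esub>"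
        by (induction n) (auto simp: A.smult_l_distr)
      then show ?thesis using unit[of "[n] \<cdot>\<^bsub>K\<^esub> \<one>\<^bsub>K\<^esub>"] K(2) that by (simp add: char_zero_def)
    qed
    fix a assume "a \<in> ?A"
    then obtain k where k: "k \<in> carrier K" "a = k \<odot>\<^bsub>R\<^esub> \<one>\<^bsub>R\<^esub>" by blast
    \<comment> \<open>K-linearity reduces the claim to \<delta>(1) = 0.\<close>
    then have "\<delta> a = k \<odot>\<^bsub>R\<^esub> \<delta> \<one>\<^bsub>R\<^esub>" using d by (simp add: K_derivation_def)
    then show "\<delta> a = \<zero>\<^bsub>R\<^esub>" using k by simp
  qed
  then show ?thesis by (rule that)
qed

theorem proposition4p4:
  fixes K :: "'k ring" and R :: "('k, 'a) module" and \<delta> :: "'a \<Rightarrow> 'a"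
    and M P :: "'a set"
  assumes "field K" and "char_zero K"
    and "affine_algebra K R" and "domain R"
    and "K_derivation K R \<delta>"
    and "maximalideal M R" and "delta_ideal R \<delta> M"
    and "primeideal P R" and "delta_ideal R \<delta> P"
    and "P \<subseteq> M"
    and "height R P + 1 = krull_dim R"
    and "diamond (diff_op_ring R \<delta>)"
  shows "\<delta> ` carrier R \<subseteq> P"
proof -
  obtain cs where "affine_deriv R \<delta> ((\<lambda>k. k \<odot>\<^bsub>R\<^esub> \<one>\<^bsub>R\<^esub>) ` carrier K) cs"
    using affine_deriv_exists assms(1,2,3,5) by blast
  then show ?thesis by (rule affine_deriv.deriv_subset_prime) (rule assms)+
qed

end
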